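(* Let $G=(V,E)$ be a graph, let $k,m$ be positive integers, and let $1/2<\eta\le 1$. Let $V_1,\ldots,V_m$ be a partition of $V$ into nonempty sets with $|V_i|>7k-3$ for all $1\le i\le m$. Let $G_0=([m],E')$ be the graph with \[E'=\left\{\{i,j\}\in\binom{[m]}{2}:\ \text{for every } X\subseteq V_i,\ Y\subseteq V_j \text{ with } |X|=|Y|=k,\ E_G(X,Y)\ne\varnothing\right\}.\] Assume that $\delta(G_0)\ge \eta m-1$. Then there exists $W\subseteq V$ such that $G[W]$ is $d$-rigid for $d=\lfloor(\eta-1/2)m\rfloor$, and $|V_i\setminus W|\le 4k$ for all $1\le i\le m$.
   Context: For disjoint $X,Y\subseteq V$, $E_G(X,Y)$ is the set of edges of $G$ with one endpoint in $X$ and the other in $Y$. $\delta(H)$ is the minimum degree of a graph $H$, and $G[W]$ is the induced subgraph on $W$. A $d$-dimensional framework $(G,\mathbf{p})$, $\mathbf{p}:V\to\mathbb{R}^d$, is rigid if every continuous edge-length-preserving motion of the vertices starting at $\mathbf{p}$ preserves all pairwise distances; $\mathbf{p}$ is generic if its $d|V|$ coordinates are algebraically independent over $\mathbb{Q}$; a graph is $d$-rigid if $(G,\mathbf{p})$ is rigid for some (equivalently, every) generic $\mathbf{p}$. *)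

theory Defs
  imports
    "HOL-Analysis.Analysis"
    "HOL-Library.Poly_Mapping"
    "HOL-Library.Ramsey"
begin

text \<open>A graph is given by its vertex set and its set of two-element edges; \<open>nsets V 2\<close> is the set
  of two-element subsets of \<open>V\<close>.\<close>

definition simple_graph :: "'v set \<Rightarrow> 'v set set \<Rightarrow> bool" where
  "simple_graph V E \<longleftrightarrow> finite V \<and> E \<subseteq> nsets V 2"

definition edges_between :: "'v set set \<Rightarrow> 'v set \<Rightarrow> 'v set \<Rightarrow> 'v set set" where
  "edges_between E X Y = {e \<in> E. \<exists>x\<in>X. \<exists>y\<in>Y. e = {x, y}}"

definition induced_edges :: "'v set set \<Rightarrow> 'v set \<Rightarrow> 'v set set" where
  "induced_edges E W = {e \<in> E. e \<subseteq> W}"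

definition vertex_degree :: "'v set set \<Rightarrow> 'v \<Rightarrow> nat" where
  "vertex_degree E v = card {e \<in> E. v \<in> e}"

text \<open>Meaningful only for a nonempty finite vertex set.\<close>

definition min_degree :: "'v set \<Rightarrow> 'v set set \<Rightarrow> nat" where
  "min_degree V E = Min (vertex_degree E ` V)"

definition reduced_edges :: "'v set set \<Rightarrow> nat \<Rightarrow> nat \<Rightarrow> (nat \<Rightarrow> 'v set) \<Rightarrow> nat set set" where
  "reduced_edges E k m Vs =
    {{i, j} | i j. i \<in> {1..m} \<and> j \<in> {1..m} \<and> i \<noteq> j \<and>
       (\<forall>X Y. X \<subseteq> Vs i \<longrightarrow> Y \<subseteq> Vs j \<longrightarrow> card X = k \<longrightarrow> card Y = k \<longrightarrow> edges_between E X Y \<noteq> {})}"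

text \<open>A polynomial over \<open>\<rat>\<close> in variables of type \<open>'x\<close> is a finitely supported map from monomials
  to coefficients, a monomial being a finitely supported map from variables to exponents.\<close>

definition poly_eval :: "('x \<Rightarrow> real) \<Rightarrow> (('x \<Rightarrow>\<^sub>0 nat) \<Rightarrow>\<^sub>0 rat) \<Rightarrow> real" where
  "poly_eval a P =
    (\<Sum>mon\<in>Poly_Mapping.keys P. of_rat (Poly_Mapping.lookup P mon) *
       (\<Prod>x\<in>Poly_Mapping.keys mon. a x ^ Poly_Mapping.lookup mon x))"

definition poly_in_vars :: "'x set \<Rightarrow> (('x \<Rightarrow>\<^sub>0 nat) \<Rightarrow>\<^sub>0 rat) \<Rightarrow> bool" where
  "poly_in_vars I P \<longleftrightarrow> (\<forall>mon\<in>Poly_Mapping.keys P. Poly_Mapping.keys mon \<subseteq> I)"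

text \<open>This concerns the indexed family \<open>(a x)\<close> for \<open>x \<in> I\<close>, so it forces \<open>a\<close> to be injective on \<open>I\<close>.\<close>

definition alg_independent_over_rat :: "'x set \<Rightarrow> ('x \<Rightarrow> real) \<Rightarrow> bool" where
  "alg_independent_over_rat I a \<longleftrightarrow>
    (\<forall>P. poly_in_vars I P \<longrightarrow> poly_eval a P = 0 \<longrightarrow> P = 0)"

text \<open>Since the dimension \<open>d\<close> is a number computed from other data, a point of \<open>d\<close>-space is a function
  \<open>nat \<Rightarrow> real\<close> of which only the coordinates below \<open>d\<close> are ever inspected.\<close>

definition euclid_dist :: "nat \<Rightarrow> (nat \<Rightarrow> real) \<Rightarrow> (nat \<Rightarrow> real) \<Rightarrow> real" where
  "euclid_dist d x y = L2_set (\<lambda>i. x i - y i) {..<d}"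

definition generic_placement :: "nat \<Rightarrow> 'v set \<Rightarrow> ('v \<Rightarrow> nat \<Rightarrow> real) \<Rightarrow> bool" where
  "generic_placement d V p \<longleftrightarrow> alg_independent_over_rat (V \<times> {..<d}) (\<lambda>(v, i). p v i)"

definition framework_motion ::
    "nat \<Rightarrow> 'v set \<Rightarrow> 'v set set \<Rightarrow> ('v \<Rightarrow> nat \<Rightarrow> real) \<Rightarrow> (real \<Rightarrow> 'v \<Rightarrow> nat \<Rightarrow> real) \<Rightarrow> bool" where
  "framework_motion d V E p q \<longleftrightarrow>
    (\<forall>v\<in>V. \<forall>i<d. continuous_on {0..1} (\<lambda>t. q t v i)) \<and>
    (\<forall>v\<in>V. \<forall>i<d. q 0 v i = p v i) \<and>
    (\<forall>t\<in>{0..1}. \<forall>u\<in>V. \<forall>v\<in>V. {u, v} \<in> E \<longrightarrow>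
       euclid_dist d (q t u) (q t v) = euclid_dist d (p u) (p v))"

definition rigid_framework :: "nat \<Rightarrow> 'v set \<Rightarrow> 'v set set \<Rightarrow> ('v \<Rightarrow> nat \<Rightarrow> real) \<Rightarrow> bool" where
  "rigid_framework d V E p \<longleftrightarrow>
    (\<forall>q. framework_motion d V E p q \<longrightarrow>
       (\<forall>t\<in>{0..1}. \<forall>u\<in>V. \<forall>v\<in>V. euclid_dist d (q t u) (q t v) = euclid_dist d (p u) (p v)))"

definition rigid_graph :: "nat \<Rightarrow> 'v set \<Rightarrow> 'v set set \<Rightarrow> bool" where
  "rigid_graph d V E \<longleftrightarrow> (\<exists>p. generic_placement d V p \<and> rigid_framework d V E p)"

end

theory Submission
  imports Defs
begin

text \<open>A nontrivial infinitesimal motion of a framework is recorded by its strains, a symmetric matrix \<open>C\<close>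
  supported on the non-edges; in homogeneous coordinates \<open>a\<close> the strain matrices are exactly those whose
  quadratic form vanishes on the affine dependencies of the points.  If such a \<open>C \<noteq> 0\<close> has rank \<open>\<rho>\<close>, then it
  is determined by \<open>\<rho>\<close> of its rows, which are sparse when all vertices have few non-neighbours, and the
  column space of \<open>a\<close> meets that of \<open>C\<close> in dimension at least \<open>\<rho> / 2\<close>.  When the minimum degree of an
  \<open>m\<close>-vertex graph is at least \<open>m / 2 + d - 1\<close>, this expresses all coordinates of \<open>a\<close> through fewer
  parameters than there are coordinates, so \<open>C = 0\<close> for generic points: the reduced graph is rigid.

  Now place all vertices of each cluster at the generic point of that cluster.  Between adjacent clusters a giant
  component contains all but fewer than \<open>k\<close> vertices of either side.  After deleting at most \<open>4 * (k - 1)\<close>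
  vertices per cluster, any two vertices of a cluster lie in at least \<open>d\<close> common giant components, which
  forces them to move alike, so that rigidity of the reduced graph carries over.  Rigidity survives a small
  perturbation to a generic placement, and it implies continuous rigidity because two placements with
  the same edge lengths differ by an infinitesimal motion of their midpoint.\<close>

section \<open>Linear algebra over finite index sets\<close>

text \<open>A placement enters a strain form only through its linear dependencies. Hence coincident
  points are admissible, and a cluster may sit at one point; rows may be rescaled, so generic
  vectors of \<open>(d + 1)\<close>-space serve as homogeneous coordinates; and congruent placements
  have the same strain forms, with no isometry to construct. Genericity is a statement on
  transcendence degree: algebraically independent reals never lie in a field generated by fewer
  reals. "Determined by" therefore means "solvable by linear algebra over a subfield". The count is
  tight. With \<delta> the minimum degree of the reduced graph and
  \<open>\<Delta> = m - 1 - \<delta>\<close>, the degree hypothesis reads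
  \<open>2 * \<Delta> + 2 * (d + 1) \<le> m + 2\<close>. Scaling and symmetry of \<open>C\<close>
  then leave too few parameters, except when \<open>C\<close> has the full rank
  \<open>2 * (d + 1)\<close>, where more entries must be eliminated. Giant components need
  \<open>3 * k - 2\<close> vertices on each side for the \<open>k\<close> of the theorem. At most
  \<open>4 * (k - 1) + 1\<close> vertices of a cluster are missing at any time, so clusters of
  \<open>7 * k - 2\<close> vertices are large enough.\<close>

definition subfield_of_reals :: "real set \<Rightarrow> bool" where
  "subfield_of_reals F \<longleftrightarrow> 0 \<in> F \<and> 1 \<in> F \<and> (\<forall>x\<in>F. \<forall>y\<in>F. x + y \<in> F) \<and> (\<forall>x\<in>F. - x \<in> F)
     \<and> (\<forall>x\<in>F. \<forall>y\<in>F. x * y \<in> F) \<and> (\<forall>x\<in>F. inverse x \<in> F)"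

lemma subfield_UNIV: "subfield_of_reals UNIV"
  by (simp add: subfield_of_reals_def)

context
  fixes F assumes F: "subfield_of_reals F"
begin

lemma subfield_0: "0 \<in> F" and subfield_1: "1 \<in> F"
  and subfield_add: "x \<in> F \<Longrightarrow> y \<in> F \<Longrightarrow> x + y \<in> F"
  and subfield_uminus: "x \<in> F \<Longrightarrow> - x \<in> F"
  and subfield_mult: "x \<in> F \<Longrightarrow> y \<in> F \<Longrightarrow> x * y \<in> F"
  and subfield_inverse: "x \<in> F \<Longrightarrow> inverse x \<in> F"
  using F by (auto simp: subfield_of_reals_def)

lemma subfield_diff: "x \<in> F \<Longrightarrow> y \<in> F \<Longrightarrow> x - y \<in> F"
  using subfield_add[of x "- y"] subfield_uminus by simp

lemma subfield_divide: "x \<in> F \<Longrightarrow> y \<in> F \<Longrightarrow> x / y \<in> F"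
  using subfield_mult[of x "inverse y"] subfield_inverse by (simp add: divide_inverse)

lemma subfield_sum: "(\<And>i. i \<in> X \<Longrightarrow> f i \<in> F) \<Longrightarrow> sum f X \<in> F"
  by (induction X rule: infinite_finite_induct) (auto simp: subfield_0 subfield_add)

lemmas subfield_intros = subfield_0 subfield_1 subfield_add subfield_uminus subfield_mult
  subfield_inverse subfield_diff subfield_divide subfield_sum

end

lemma homogeneous_system_nontrivial:
  fixes M :: "'e \<Rightarrow> 'x \<Rightarrow> real"
  assumes "finite Y" "finite X" "card Y < card X"
  shows "\<exists>x. (\<exists>i\<in>X. x i \<noteq> 0) \<and> (\<forall>e\<in>Y. (\<Sum>i\<in>X. M e i * x i) = 0)"
  using assms
proof (induction Y arbitrary: X M rule: finite_induct)
  case empty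
  then have "X \<noteq> {}" by auto
  then show ?case by (auto intro!: exI[of _ "\<lambda>_. 1"])
next
  case (insert e Y)
  show ?case
  proof (cases "\<forall>i\<in>X. M e i = 0")
    case True
    have "card Y < card X" using insert by auto
    then obtain x where "(\<exists>i\<in>X. x i \<noteq> 0) \<and> (\<forall>e\<in>Y. (\<Sum>i\<in>X. M e i * x i) = 0)"
      using insert.IH[OF \<open>finite X\<close>, of M] by blast
    then show ?thesis using True by (intro exI[of _ x]) auto
  next
    case False
    then obtain p where p: "p \<in> X" "M e p \<noteq> 0" by auto
    let ?X = "X - {p}"
    define M' where "M' f i = M f i - M f p * M e i / M e p" for f i
    have "card Y < card ?X" using insert p by auto
    then obtain x where x: "\<exists>i\<in>?X. x i \<noteq> 0" "\<And>f. f \<in> Y \<Longrightarrow> (\<Sum>i\<in>?X. M' f i * x i) = 0"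
      using insert.IH[of ?X M'] \<open>finite X\<close> by auto
    define x' where "x' = x(p := - (\<Sum>i\<in>?X. M e i * x i) / M e p)"
    have split: "(\<Sum>i\<in>X. M f i * x' i) = M f p * x' p + (\<Sum>i\<in>?X. M f i * x i)" for f
      using p \<open>finite X\<close> by (subst sum.remove[of X p]) (auto simp: x'_def intro!: sum.cong)
    have "(\<Sum>i\<in>X. M f i * x' i) = 0" if "f \<in> Y" for f
    proof -
      have "(\<Sum>i\<in>?X. M' f i * x i) = (\<Sum>i\<in>?X. M f i * x i) - M f p / M e p * (\<Sum>i\<in>?X. M e i * x i)"
        by (simp add: M'_def algebra_simps sum_subtractf sum_distrib_left)
      with x(2)[OF that] show ?thesis
        unfolding split by (simp add: x'_def)
    qed
    moreover have "(\<Sum>i\<in>X. M e i * x' i) = 0"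
      unfolding split using p by (simp add: x'_def)
    moreover have "\<exists>i\<in>X. x' i \<noteq> 0"
      using x(1) by (auto simp: x'_def)
    ultimately show ?thesis by (intro exI[of _ x']) auto
  qed
qed

text \<open>Elimination stays inside the field of the entries, so injectivity tested on real vectors
  still yields a solution over \<open>F\<close>. Injectivity concerns the columns and solvability
  the transposed system; for a square matrix both mean invertibility. Over a generated field this
  shows that solving a system introduces no new parameters.\<close>

lemma square_system_solvable:
  fixes M :: "'i \<Rightarrow> 'j \<Rightarrow> real"
  assumes F: "subfield_of_reals F"
  assumes "finite J" "finite I" "card I = card J"
    and "\<And>i j. i \<in> I \<Longrightarrow> j \<in> J \<Longrightarrow> M i j \<in> F"
    and "\<And>x. (\<And>i. i \<in> I \<Longrightarrow> (\<Sum>j\<in>J. M i j * x j) = 0) \<Longrightarrow> \<forall>j\<in>J. x j = 0"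
    and "\<And>j. j \<in> J \<Longrightarrow> b j \<in> F"
  shows "\<exists>y. (\<forall>i. y i \<in> F) \<and> (\<forall>j\<in>J. (\<Sum>i\<in>I. y i * M i j) = b j)"
  using assms(2-)
proof (induction J arbitrary: I M b rule: finite_induct)
  case empty
  show ?case by (rule exI[of _ "\<lambda>_. 0"]) (simp add: subfield_0[OF F])
next
  case (insert j0 J)
  note inj = insert.prems(4) and MF = insert.prems(3) and bF = insert.prems(5)
  have "\<exists>i0\<in>I. M i0 j0 \<noteq> 0"
  proof (rule ccontr)
    assume "\<not> ?thesis"
    \<comment> \<open>If column \<open>j0\<close> were zero, the unit vector at \<open>j0\<close>
      would lie in the kernel.\<close>
    then have "\<forall>j\<in>insert j0 J. (if j = j0 then 1 else 0 :: real) = 0"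
      using insert.hyps by (intro inj) (auto simp: if_distrib cong: if_cong)
    then show False by auto
  qed
  then obtain i0 where i0: "i0 \<in> I" "M i0 j0 \<noteq> 0" by auto
  let ?I = "I - {i0}" and ?p = "M i0 j0"
  define M' where "M' i j = M i j - M i j0 * M i0 j / ?p" for i j
  define b' where "b' j = b j - b j0 * M i0 j / ?p" for j
  have "\<exists>y. (\<forall>i. y i \<in> F) \<and> (\<forall>j\<in>J. (\<Sum>i\<in>?I. y i * M' i j) = b' j)"
  proof (rule insert.IH)
    show "finite ?I" "card ?I = card J" using insert i0 by auto
    show "M' i j \<in> F" if "i \<in> ?I" "j \<in> J" for i j
      unfolding M'_def using that i0 MF by (intro subfield_intros[OF F]) auto
    show "b' j \<in> F" if "j \<in> J" for j
      unfolding b'_def using that i0 MF bF by (intro subfield_intros[OF F]) auto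
    fix x assume x: "\<And>i. i \<in> ?I \<Longrightarrow> (\<Sum>j\<in>J. M' i j * x j) = 0"
    define x' where "x' = x(j0 := - (\<Sum>j\<in>J. M i0 j * x j) / ?p)"
    have split: "(\<Sum>j\<in>insert j0 J. M i j * x' j) = M i j0 * x' j0 + (\<Sum>j\<in>J. M i j * x j)" for i
      using insert.hyps by (subst sum.insert) (auto simp: x'_def intro!: sum.cong)
    have "(\<Sum>j\<in>insert j0 J. M i j * x' j) = 0" if "i \<in> I" for i
    proof (cases "i = i0")
      case True
      then show ?thesis unfolding split using i0 by (simp add: x'_def)
    next
      case False
      have "(\<Sum>j\<in>J. M' i j * x j) = (\<Sum>j\<in>J. M i j * x j) - M i j0 / ?p * (\<Sum>j\<in>J. M i0 j * x j)"
        by (simp add: M'_def algebra_simps sum_subtractf sum_distrib_left)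
      with x[of i] that False show ?thesis
        unfolding split by (simp add: x'_def)
    qed
    then have "\<forall>j\<in>insert j0 J. x' j = 0" by (rule inj)
    then show "\<forall>j\<in>J. x j = 0" using insert.hyps by (metis fun_upd_other insertCI x'_def)
  qed
  then obtain y where yF: "\<And>i. y i \<in> F" and y: "\<And>j. j \<in> J \<Longrightarrow> (\<Sum>i\<in>?I. y i * M' i j) = b' j"
    by blast
  let ?y0 = "(b j0 - (\<Sum>i\<in>?I. y i * M i j0)) / ?p"
  define y' where "y' = y(i0 := ?y0)"
  have "?y0 \<in> F"
    using i0 MF bF yF by (intro subfield_intros[OF F]) auto
  then have "\<forall>i. y' i \<in> F" using yF by (auto simp: y'_def)
  moreover have split: "(\<Sum>i\<in>I. y' i * M i j) = ?y0 * M i0 j + (\<Sum>i\<in>?I. y i * M i j)" for j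
    using i0 insert.prems(1) by (subst sum.remove[of I i0]) (auto simp: y'_def intro!: sum.cong)
  have "(\<Sum>i\<in>I. y' i * M i j) = b j" if "j \<in> insert j0 J" for j
  proof (cases "j = j0")
    case True
    then show ?thesis unfolding split using i0 by simp
  next
    case False
    have "(\<Sum>i\<in>?I. y i * M' i j) = (\<Sum>i\<in>?I. y i * M i j) - (\<Sum>i\<in>?I. y i * M i j0) * (M i0 j / ?p)"
      by (simp add: M'_def algebra_simps sum_subtractf sum_distrib_left sum_distrib_right)
    with y[of j] that False show ?thesis
      unfolding split b'_def by (simp add: diff_divide_distrib algebra_simps)
  qed
  ultimately show ?case by blast
qed

definition rows_independent :: "'w set \<Rightarrow> 'x set \<Rightarrow> ('x \<Rightarrow> 'w \<Rightarrow> real) \<Rightarrow> bool" where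
  "rows_independent W X M \<longleftrightarrow>
     (\<forall>c. (\<forall>w\<in>W. (\<Sum>i\<in>X. c i * M i w) = 0) \<longrightarrow> (\<forall>i\<in>X. c i = 0))"

lemma rows_independentD:
  "rows_independent W X M \<Longrightarrow> (\<And>w. w \<in> W \<Longrightarrow> (\<Sum>i\<in>X. c i * M i w) = 0) \<Longrightarrow> i \<in> X \<Longrightarrow> c i = 0"
  by (auto simp: rows_independent_def)

text \<open>A maximal independent set of rows spans the others. The last clause makes expanding from
  \<open>I\<close> and restricting to \<open>I\<close> inverse to each other.\<close>

lemma row_basis_exists:
  assumes "finite X"
  obtains I z where "I \<subseteq> X" "rows_independent W I M"
    "\<And>v w. v \<in> X \<Longrightarrow> w \<in> W \<Longrightarrow> M v w = (\<Sum>i\<in>I. z v i * M i w)"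
    "\<And>i j. i \<in> I \<Longrightarrow> j \<in> I \<Longrightarrow> z i j = (if i = j then 1 else 0 :: real)"
proof -
  let ?P = "\<lambda>I. I \<subseteq> X \<and> rows_independent W I M"
  have "?P {}" by (simp add: rows_independent_def)
  moreover have "\<forall>I. ?P I \<longrightarrow> card I < Suc (card X)"
    using assms by (auto intro: card_mono less_Suc_eq_le[THEN iffD2])
  ultimately obtain I where I: "?P I" and max: "\<And>I'. ?P I' \<Longrightarrow> card I' \<le> card I"
    using ex_has_greatest_nat[of ?P "{}" card "Suc (card X)"] by blast
  have finI: "finite I" using I assms finite_subset by blast
  have "\<exists>z. (\<forall>w\<in>W. M v w = (\<Sum>i\<in>I. z i * M i w)) \<and> (v \<in> I \<longrightarrow> z = (\<lambda>j. if v = j then 1 else 0))"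
    if v: "v \<in> X" for v
  proof (cases "v \<in> I")
    case True
    then show ?thesis using finI
      by (intro exI[of _ "\<lambda>j. if v = j then 1 else 0"]) (simp add: if_distrib[of "\<lambda>x. x * _"] cong: if_cong)
  next
    case False
    have "\<not> ?P (insert v I)" using max[of "insert v I"] finI False by auto
    then obtain c i where c: "\<And>w. w \<in> W \<Longrightarrow> (\<Sum>i\<in>insert v I. c i * M i w) = 0"
      and i: "i \<in> insert v I" "c i \<noteq> 0"
      using v I unfolding rows_independent_def by blast
    have eq: "c v * M v w + (\<Sum>i\<in>I. c i * M i w) = 0" if "w \<in> W" for w
      using c[OF that] finI False by simp
    have cv: "c v \<noteq> 0"
    proof
      assume "c v = 0"
      then have "(\<Sum>i\<in>I. c i * M i w) = 0" if "w \<in> W" for w using eq[OF that] by simp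
      then have "\<forall>i\<in>I. c i = 0" using I unfolding rows_independent_def by blast
      with i \<open>c v = 0\<close> show False by auto
    qed
    show ?thesis
    proof (intro exI[of _ "\<lambda>i. - c i / c v"] conjI ballI)
      fix w assume "w \<in> W"
      have "(\<Sum>i\<in>I. - c i / c v * M i w) = - (\<Sum>i\<in>I. c i * M i w) / c v"
        by (simp add: sum_negf[symmetric] sum_divide_distrib)
      also have "\<dots> = M v w"
        using eq[OF \<open>w \<in> W\<close>] cv
        by (metis add.commute add_eq_0_iff nonzero_mult_div_cancel_left)
      finally show "M v w = (\<Sum>i\<in>I. - c i / c v * M i w)" by simp
    qed (use False in auto)
  qed
  then obtain z where z: "\<And>v. v \<in> X \<Longrightarrow> (\<forall>w\<in>W. M v w = (\<Sum>i\<in>I. z v i * M i w)) \<and>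
      (v \<in> I \<longrightarrow> z v = (\<lambda>j. if v = j then 1 else 0))"
    by metis
  show ?thesis
    by (rule that[of I z]) (use I z in \<open>auto simp: subset_iff\<close>)
qed

text \<open>The Gram matrix of independent rows is nonsingular, because its quadratic form is a sum
  of squares. A solution is then found among the combinations of the rows themselves.\<close>

lemma independent_rows_surj:
  assumes "finite X" "finite W" "rows_independent W X M"
  obtains t where "\<And>i. i \<in> X \<Longrightarrow> (\<Sum>w\<in>W. t w * M i w) = (b i :: real)"
proof -
  define N where "N i j = (\<Sum>w\<in>W. M i w * M j w)" for i j
  have "\<exists>y. (\<forall>i. y i \<in> UNIV) \<and> (\<forall>j\<in>X. (\<Sum>i\<in>X. y i * N i j) = b j)"
  proof (rule square_system_solvable[OF subfield_UNIV])
    fix x assume x: "\<And>i. i \<in> X \<Longrightarrow> (\<Sum>j\<in>X. N i j * x j) = 0"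
    define s where "s w = (\<Sum>i\<in>X. x i * M i w)" for w
    have "(\<Sum>w\<in>W. s w * s w) = (\<Sum>w\<in>W. \<Sum>i\<in>X. \<Sum>j\<in>X. x i * M i w * (x j * M j w))"
      by (simp add: s_def sum_product)
    also have "\<dots> = (\<Sum>i\<in>X. \<Sum>j\<in>X. \<Sum>w\<in>W. x i * M i w * (x j * M j w))"
      by (subst sum.swap) (rule sum.cong[OF refl], subst sum.swap, simp)
    also have "\<dots> = (\<Sum>i\<in>X. x i * (\<Sum>j\<in>X. N i j * x j))"
      by (simp add: N_def sum_distrib_left sum_distrib_right algebra_simps)
    also have "\<dots> = 0" using x by simp
    finally have "\<forall>w\<in>W. s w = 0"
      using assms(2) by (subst (asm) sum_nonneg_eq_0_iff) auto
    then show "\<forall>j\<in>X. x j = 0"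
      using assms(3) unfolding rows_independent_def s_def by blast
  qed (use assms in auto)
  then obtain y where y: "\<And>j. j \<in> X \<Longrightarrow> (\<Sum>i\<in>X. y i * N i j) = b j" by blast
  show ?thesis
  proof (rule that[of "\<lambda>w. \<Sum>i\<in>X. y i * M i w"])
    fix j assume "j \<in> X"
    have "(\<Sum>w\<in>W. (\<Sum>i\<in>X. y i * M i w) * M j w) = (\<Sum>i\<in>X. \<Sum>w\<in>W. y i * M i w * M j w)"
      by (simp add: sum_distrib_right) (rule sum.swap)
    also have "\<dots> = (\<Sum>i\<in>X. y i * N i j)"
      by (simp add: N_def sum_distrib_left algebra_simps)
    finally show "(\<Sum>w\<in>W. (\<Sum>i\<in>X. y i * M i w) * M j w) = b j" using y[OF \<open>j \<in> X\<close>] by simp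
  qed
qed

section \<open>Algebraically independent reals\<close>

inductive_set field_gen :: "real set \<Rightarrow> real set" for S where
  gen: "x \<in> S \<Longrightarrow> x \<in> field_gen S"
| zero: "0 \<in> field_gen S"
| one: "1 \<in> field_gen S"
| add: "x \<in> field_gen S \<Longrightarrow> y \<in> field_gen S \<Longrightarrow> x + y \<in> field_gen S"
| uminus: "x \<in> field_gen S \<Longrightarrow> - x \<in> field_gen S"
| mult: "x \<in> field_gen S \<Longrightarrow> y \<in> field_gen S \<Longrightarrow> x * y \<in> field_gen S"
| inverse: "x \<in> field_gen S \<Longrightarrow> inverse x \<in> field_gen S"

lemma subfield_field_gen: "subfield_of_reals (field_gen S)"
  by (simp add: subfield_of_reals_def field_gen.intros)

lemma subfield_of_nat: "subfield_of_reals F \<Longrightarrow> of_nat n \<in> F"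
  by (induction n) (auto intro: subfield_intros)

lemma subfield_of_rat:
  assumes "subfield_of_reals F" shows "of_rat q \<in> F"
proof -
  have "of_int n \<in> F" for n
    using subfield_of_nat[OF assms] subfield_uminus[OF assms] by (cases n rule: int_cases2) auto
  then show ?thesis
    by (cases q) (simp add: of_rat_rat subfield_divide[OF assms])
qed

lemma subfield_power: "subfield_of_reals F \<Longrightarrow> x \<in> F \<Longrightarrow> x ^ n \<in> F"
  by (induction n) (auto intro: subfield_intros)

lemma subfield_prod:
  "subfield_of_reals F \<Longrightarrow> (\<And>i. i \<in> X \<Longrightarrow> f i \<in> F) \<Longrightarrow> prod f X \<in> F"
  by (induction X rule: infinite_finite_induct) (auto intro: subfield_intros)

definition exponents :: "'x set \<Rightarrow> ('x \<Rightarrow> nat) set" where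
  "exponents I = {f. \<forall>x. x \<notin> I \<longrightarrow> f x = 0}"

text \<open>The notion of \<open>alg_independent_over_rat\<close> with monomials as exponent
  functions vanishing off \<open>I\<close>. Relations become plain finite sums, which are easy to
  regroup by the exponent of one variable.\<close>

definition alg_indep :: "'x set \<Rightarrow> ('x \<Rightarrow> real) \<Rightarrow> bool" where
  "alg_indep I a \<longleftrightarrow> (\<forall>M c. finite M \<longrightarrow> M \<subseteq> exponents I \<longrightarrow>
     (\<Sum>f\<in>M. of_rat (c f) * (\<Prod>x\<in>I. a x ^ f x)) = 0 \<longrightarrow> (\<forall>f\<in>M. c f = 0))"

lemma alg_indep_subset:
  assumes "alg_indep I a" "J \<subseteq> I" "finite I"
  shows "alg_indep J a"
  unfolding alg_indep_def
proof (intro allI impI)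
  fix M c assume M: "finite M" "M \<subseteq> exponents J"
    and sum: "(\<Sum>f\<in>M. of_rat (c f) * (\<Prod>x\<in>J. a x ^ f x)) = 0"
  have "(\<Prod>x\<in>I. a x ^ f x) = (\<Prod>x\<in>J. a x ^ f x)" if "f \<in> M" for f
    using that assms M by (intro prod.mono_neutral_right) (auto simp: exponents_def)
  then have "(\<Sum>f\<in>M. of_rat (c f) * (\<Prod>x\<in>I. a x ^ f x)) = 0"
    using sum by simp
  moreover have "M \<subseteq> exponents I" using M assms by (auto simp: exponents_def)
  ultimately show "\<forall>f\<in>M. c f = 0" using assms M unfolding alg_indep_def by blast
qed

lemma alg_independent_over_rat_if_alg_indep:
  assumes "alg_indep I a" "finite I"
  shows "alg_independent_over_rat I a"
  unfolding alg_independent_over_rat_def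
proof (intro allI impI)
  fix P assume P: "poly_in_vars I P" and ev: "poly_eval a P = 0"
  let ?M = "Poly_Mapping.lookup ` Poly_Mapping.keys P"
  let ?c = "\<lambda>f. Poly_Mapping.lookup P (Abs_poly_mapping f)"
  have keys: "Poly_Mapping.keys mon \<subseteq> I" if "mon \<in> Poly_Mapping.keys P" for mon
    using P that by (auto simp: poly_in_vars_def)
  have "(\<Prod>x\<in>Poly_Mapping.keys mon. a x ^ Poly_Mapping.lookup mon x) = (\<Prod>x\<in>I. a x ^ Poly_Mapping.lookup mon x)"
    if "mon \<in> Poly_Mapping.keys P" for mon
    using keys[OF that] assms(2) by (intro prod.mono_neutral_left) (auto simp: in_keys_iff)
  then have "(\<Sum>f\<in>?M. of_rat (?c f) * (\<Prod>x\<in>I. a x ^ f x)) = 0"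
    using ev
    by (subst sum.reindex) (simp_all add: poly_eval_def lookup_inject inj_on_def lookup_inverse)
  moreover have "?M \<subseteq> exponents I"
  proof
    fix f assume "f \<in> ?M"
    then obtain mon where mon: "mon \<in> Poly_Mapping.keys P" "f = Poly_Mapping.lookup mon" by blast
    show "f \<in> exponents I"
      unfolding exponents_def mem_Collect_eq mon(2)
      using keys[OF mon(1)] by (metis in_keys_iff subsetD)
  qed
  moreover have "finite ?M" by simp
  ultimately have "\<forall>f\<in>?M. ?c f = 0"
    using assms(1)[unfolded alg_indep_def, THEN spec[of _ ?M], THEN spec[of _ ?c]] by simp
  then have "Poly_Mapping.lookup P mon = 0" for mon
    by (cases "mon \<in> Poly_Mapping.keys P") (simp_all add: lookup_inverse in_keys_iff)
  then show "P = 0" by (intro poly_mapping_eqI) simp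
qed

section \<open>Transcendence degree by counting monomials in a rational vector space\<close>

global_interpretation rat_real: vector_space "\<lambda>(q::rat) (x::real). of_rat q * x"
  by unfold_locales (auto simp: algebra_simps of_rat_add of_rat_mult)

text \<open>These are real values, not formal monomials; coincidences can only lower their number.
  Bounding each exponent separately gives at most \<open>(N + 1) ^ card S\<close> of them.\<close>

definition monomials :: "real set \<Rightarrow> nat \<Rightarrow> real set" where
  "monomials S N = (\<lambda>f. \<Prod>s\<in>S. s ^ f s) ` (S \<rightarrow>\<^sub>E {..N})"

definition polys :: "real set \<Rightarrow> nat \<Rightarrow> real set" where
  "polys S N = rat_real.span (monomials S N)"

lemma monomials_mult:
  assumes "x \<in> monomials S N" "y \<in> monomials S N'"
  shows "x * y \<in> monomials S (N + N')"
proof -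
  obtain f g where f: "f \<in> S \<rightarrow>\<^sub>E {..N}" "x = (\<Prod>s\<in>S. s ^ f s)"
    and g: "g \<in> S \<rightarrow>\<^sub>E {..N'}" "y = (\<Prod>s\<in>S. s ^ g s)"
    using assms by (auto simp: monomials_def)
  let ?h = "restrict (\<lambda>s. f s + g s) S"
  have "x * y = (\<Prod>s\<in>S. s ^ ?h s)"
    using f g by (simp add: power_add prod.distrib)
  moreover have "?h \<in> S \<rightarrow>\<^sub>E {..N + N'}"
    using f g by (auto simp: PiE_iff intro!: add_mono)
  ultimately show ?thesis unfolding monomials_def by blast
qed

lemma polys_mult:
  assumes "x \<in> polys S N" "y \<in> polys S N'"
  shows "x * y \<in> polys S (N + N')"
  using assms(1) unfolding polys_def
proof (induction rule: rat_real.span_induct_alt)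
  case base
  show ?case by (simp add: rat_real.span_zero)
next
  case (step q u v)
  have "u * y \<in> rat_real.span (monomials S (N + N'))"
    using assms(2) unfolding polys_def
  proof (induction rule: rat_real.span_induct_alt)
    case base
    show ?case by (simp add: rat_real.span_zero)
  next
    case (step r w z)
    have "of_rat r * (u * w) + u * z \<in> rat_real.span (monomials S (N + N'))"
      using step(2) monomials_mult[OF \<open>u \<in> monomials S N\<close> step(1)]
      by (intro rat_real.span_add rat_real.span_scale) (auto intro: rat_real.span_base)
    then show ?case by (simp add: algebra_simps)
  qed
  then have "of_rat q * (u * y) + v * y \<in> rat_real.span (monomials S (N + N'))"
    using step by (intro rat_real.span_add rat_real.span_scale) auto
  then show ?case by (simp add: algebra_simps)
qed

lemma polys_add: "x \<in> polys S N \<Longrightarrow> y \<in> polys S N \<Longrightarrow> x + y \<in> polys S N"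
  unfolding polys_def by (rule rat_real.span_add)

lemma polys_uminus: "x \<in> polys S N \<Longrightarrow> - x \<in> polys S N"
  unfolding polys_def by (rule rat_real.span_neg)

lemma one_in_polys: "1 \<in> polys S N"
proof -
  have "1 \<in> monomials S N"
    unfolding monomials_def by (rule image_eqI[of _ _ "restrict (\<lambda>_. 0) S"]) auto
  then show ?thesis unfolding polys_def by (rule rat_real.span_base)
qed

lemma zero_in_polys: "0 \<in> polys S N"
  unfolding polys_def by (rule rat_real.span_zero)

lemma gen_in_polys:
  assumes "finite S" "x \<in> S" shows "x \<in> polys S 1"
proof -
  have "x \<in> monomials S 1"
    unfolding monomials_def
    using assms by (intro image_eqI[of _ _ "restrict (\<lambda>s. if s = x then 1 else 0) S"])
      (auto simp: prod.delta if_distrib[of "\<lambda>n. _ ^ n"] cong: if_cong prod.cong)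
  then show ?thesis unfolding polys_def by (rule rat_real.span_base)
qed

lemma polys_power: "x \<in> polys S N \<Longrightarrow> x ^ e \<in> polys S (e * N)"
proof (induction e)
  case (Suc e)
  then show ?case using polys_mult[of x S N "x ^ e" "e * N"] by simp
qed (simp add: one_in_polys)

lemma polys_prod:
  assumes "finite X" "\<And>x. x \<in> X \<Longrightarrow> g x \<in> polys S N"
  shows "(\<Prod>x\<in>X. g x) \<in> polys S (card X * N)"
  using assms
proof (induction X rule: finite_induct)
  case (insert x X)
  then show ?case using polys_mult[of "g x" S N "prod g X" "card X * N"] by simp
qed (simp add: one_in_polys)

text \<open>Every element is a quotient of two polynomial values. Stating this as
  \<open>x * D\<close> makes the closure steps a matter of multiplying denominators and adding
  degree bounds.\<close>

lemma field_gen_fraction: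
  assumes "finite S" "x \<in> field_gen S"
  shows "\<exists>N D. D \<noteq> 0 \<and> D \<in> polys S N \<and> x * D \<in> polys S N"
  using assms(2)
proof induction
  case (gen x)
  then show ?case
    using one_in_polys gen_in_polys[OF assms(1)] by (intro exI[of _ 1]) auto
next
  case zero
  then show ?case using one_in_polys zero_in_polys by (intro exI[of _ 1]) auto
next
  case one
  then show ?case using one_in_polys by (intro exI[of _ 1]) auto
next
  case (add x y)
  then obtain N D N' D' where *: "D \<noteq> 0" "D \<in> polys S N" "x * D \<in> polys S N"
    "D' \<noteq> 0" "D' \<in> polys S N'" "y * D' \<in> polys S N'" by blast
  have "(x + y) * (D * D') = x * D * D' + D * (y * D')" by (simp add: algebra_simps)
  also have "\<dots> \<in> polys S (N + N')" using * by (intro polys_add polys_mult)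
  finally show ?case using * by (intro exI[of _ "N + N'"] exI[of _ "D * D'"]) (auto intro: polys_mult)
next
  case (uminus x)
  then show ?case by (metis mult_minus_left polys_uminus)
next
  case (mult x y)
  then obtain N D N' D' where *: "D \<noteq> 0" "D \<in> polys S N" "x * D \<in> polys S N"
    "D' \<noteq> 0" "D' \<in> polys S N'" "y * D' \<in> polys S N'" by blast
  have "(x * y) * (D * D') = x * D * (y * D')" by (simp add: algebra_simps)
  also have "\<dots> \<in> polys S (N + N')" using * by (intro polys_mult)
  finally show ?case using * by (intro exI[of _ "N + N'"] exI[of _ "D * D'"]) (auto intro: polys_mult)
next
  case (inverse x)
  then obtain N D where *: "D \<noteq> 0" "D \<in> polys S N" "x * D \<in> polys S N" by blast
  show ?case
  proof (cases "x = 0")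
    case True
    then show ?thesis using one_in_polys zero_in_polys by (intro exI[of _ 1]) auto
  next
    case False
    then have "inverse x * (x * D) = D" by simp
    then have "inverse x * (x * D) \<in> polys S N" using *(2) by (simp only:)
    then show ?thesis using * False by (intro exI[of _ N] exI[of _ "x * D"]) simp
  qed
qed

lemma common_denominator:
  assumes "finite S" "finite X" "\<And>x. x \<in> X \<Longrightarrow> a x \<in> field_gen S"
  shows "\<exists>N D. D \<noteq> 0 \<and> D \<in> polys S N \<and> (\<forall>x\<in>X. a x * D \<in> polys S N)"
  using assms(2,3)
proof (induction X rule: finite_induct)
  case empty
  then show ?case using one_in_polys by (intro exI[of _ 1]) auto
next
  case (insert x X)
  then obtain N D where *: "D \<noteq> 0" "D \<in> polys S N" "\<forall>x\<in>X. a x * D \<in> polys S N" by auto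
  obtain N' D' where **: "D' \<noteq> 0" "D' \<in> polys S N'" "a x * D' \<in> polys S N'"
    using field_gen_fraction[OF assms(1)] insert.prems by blast
  have "a z * (D * D') \<in> polys S (N + N')" if "z \<in> insert x X" for z
  proof (cases "z = x")
    case True
    have "a x * (D * D') = D * (a x * D')" by simp
    also have "\<dots> \<in> polys S (N + N')" using * ** by (intro polys_mult) auto
    finally show ?thesis using True by simp
  next
    case False
    then have "a z * D * D' \<in> polys S (N + N')" using * ** that by (intro polys_mult) auto
    then show ?thesis by (simp add: mult.assoc)
  qed
  then show ?case using * ** by (intro exI[of _ "N + N'"] exI[of _ "D * D'"]) (auto intro: polys_mult)
qed

lemma card_monomials_le:
  assumes "finite S" shows "finite (monomials S N)" "card (monomials S N) \<le> Suc N ^ card S"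
proof -
  have "finite (S \<rightarrow>\<^sub>E {..N})" using assms by (simp add: finite_PiE)
  then show "finite (monomials S N)" "card (monomials S N) \<le> Suc N ^ card S"
    unfolding monomials_def using assms card_image_le[of "S \<rightarrow>\<^sub>E {..N}"]
    by (auto simp: card_PiE)
qed

lemma polynomial_growth:
  assumes "s < t" obtains E :: nat where "Suc (c * E) ^ s < Suc E ^ t"
proof -
  \<comment> \<open>Bounding \<open>c * E + 1\<close> by \<open>(c + 1) * (E + 1)\<close> costs the
    factor \<open>(c + 1) ^ s\<close>, which this choice keeps below \<open>E + 1\<close>.\<close>
  let ?E = "Suc c ^ s"
  have "Suc (c * ?E) \<le> Suc c * Suc ?E" by simp
  then have "Suc (c * ?E) ^ s \<le> Suc c ^ s * Suc ?E ^ s"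
    by (metis power_mono power_mult_distrib zero_le)
  also have "\<dots> < Suc ?E * Suc ?E ^ s" by simp
  also have "\<dots> = Suc ?E ^ Suc s" by simp
  also have "\<dots> \<le> Suc ?E ^ t" using assms by (intro power_increasing) auto
  finally show ?thesis using that by blast
qed

text \<open>Counting monomials: with exponents at most \<open>E\<close>, the powers of the \<open>a x\<close> number
  \<open>(E + 1) ^ card I\<close>, while over a common denominator they lie in a rational vector space of dimension
  \<open>O(E ^ card S)\<close>.\<close>

lemma alg_indep_card_le:
  assumes "finite S" "finite I" "alg_indep I a" "\<And>x. x \<in> I \<Longrightarrow> a x \<in> field_gen S"
  shows "card I \<le> card S"
proof (rule ccontr)
  assume "\<not> ?thesis"
  then have less: "card S < card I" by simp
  obtain N D where D: "D \<noteq> 0" "D \<in> polys S N" "\<And>x. x \<in> I \<Longrightarrow> a x * D \<in> polys S N"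
  proof -
    have "\<exists>N D. D \<noteq> 0 \<and> D \<in> polys S N \<and> (\<forall>x\<in>I. a x * D \<in> polys S N)"
      by (rule common_denominator[OF assms(1,2,4)])
    then show ?thesis by (elim exE conjE) (rule that, auto)
  qed
  obtain E where E: "Suc ((card I * N) * E) ^ card S < Suc E ^ card I"
    using polynomial_growth[OF less] by blast
  define Fs where "Fs = {f \<in> exponents I. \<forall>x\<in>I. f x \<le> E}"
  \<comment> \<open>All monomials are multiplied by the same power of \<open>D\<close>, so relations
    between them are preserved. The power splits as \<open>D ^ f x * D ^ (E - f x)\<close> for each
    \<open>x\<close>, enough to clear all denominators with a degree independent of
    \<open>f\<close>.\<close>
  define ev where "ev f = (\<Prod>x\<in>I. a x ^ f x) * D ^ (card I * E)" for f
  have bij: "bij_betw (\<lambda>f. restrict f I) Fs (I \<rightarrow>\<^sub>E {..E})"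
    by (rule bij_betwI[of _ _ _ "\<lambda>f x. if x \<in> I then f x else 0"])
       (auto simp: Fs_def exponents_def PiE_iff extensional_def fun_eq_iff)
  have "card Fs = Suc E ^ card I"
    using bij_betw_same_card[OF bij] assms(2) by (simp add: card_PiE)
  have "finite Fs" using bij_betw_finite[OF bij] assms(2) by (simp add: finite_PiE)
  have ev_in: "ev f \<in> rat_real.span (monomials S (card I * N * E))" if "f \<in> Fs" for f
  proof -
    have "ev f = (\<Prod>x\<in>I. (a x * D) ^ f x * D ^ (E - f x))"
    proof -
      have "D ^ (card I * E) = (\<Prod>x\<in>I. D ^ f x * D ^ (E - f x))"
        using that by (simp add: Fs_def power_add[symmetric] power_mult mult.commute)
      then show ?thesis
        by (simp add: ev_def prod.distrib power_mult_distrib mult.assoc)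
    qed
    also have "\<dots> \<in> polys S (card I * (E * N))"
    proof (rule polys_prod[OF assms(2)])
      fix x assume x: "x \<in> I"
      have "(a x * D) ^ f x * D ^ (E - f x) \<in> polys S (f x * N + (E - f x) * N)"
        using D x by (intro polys_mult polys_power) auto
      also have "f x * N + (E - f x) * N = E * N"
        using that x by (simp add: Fs_def add_mult_distrib[symmetric])
      finally show "(a x * D) ^ f x * D ^ (E - f x) \<in> polys S (E * N)" .
    qed
    finally show ?thesis by (simp add: polys_def mult_ac)
  qed
  have indep: "\<forall>f\<in>Fs. c f = 0" if "(\<Sum>f\<in>Fs. of_rat (c f) * ev f) = 0" for c
  proof -
    have "(\<Sum>f\<in>Fs. of_rat (c f) * ev f) = (\<Sum>f\<in>Fs. of_rat (c f) * (\<Prod>x\<in>I. a x ^ f x)) * D ^ (card I * E)"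
      by (simp add: ev_def sum_distrib_right mult.assoc)
    then have "(\<Sum>f\<in>Fs. of_rat (c f) * (\<Prod>x\<in>I. a x ^ f x)) = 0"
      using that D by simp
    then show ?thesis
      using assms(3) \<open>finite Fs\<close> unfolding alg_indep_def by (auto simp: Fs_def)
  qed
  have inj: "inj_on ev Fs"
  proof (rule inj_onI, rule ccontr)
    fix f g assume fg: "f \<in> Fs" "g \<in> Fs" "ev f = ev g" "f \<noteq> g"
    let ?c = "\<lambda>h. if h = f then 1 else if h = g then -1 else (0::rat)"
    have "(\<Sum>h\<in>Fs. of_rat (?c h) * ev h) = (\<Sum>h\<in>{f, g}. of_rat (?c h) * ev h)"
      using fg \<open>finite Fs\<close> by (intro sum.mono_neutral_right) auto
    also have "\<dots> = 0" using fg by (simp add: of_rat_minus)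
    finally have "\<forall>h\<in>Fs. ?c h = 0" by (rule indep)
    then show False using fg(1) by (auto dest: bspec[of _ _ f])
  qed
  have "rat_real.independent (ev ` Fs)"
  proof (subst rat_real.independent_explicit_finite_subsets, intro allI impI ballI)
    fix T u x assume T: "T \<subseteq> ev ` Fs" and "finite T" and s: "(\<Sum>v\<in>T. of_rat (u v) * v) = 0" and x: "x \<in> T"
    let ?c = "\<lambda>f. if ev f \<in> T then u (ev f) else 0"
    have "(\<Sum>f\<in>Fs. of_rat (?c f) * ev f) = (\<Sum>v\<in>ev ` Fs. of_rat (if v \<in> T then u v else 0) * v)"
      using inj by (simp add: sum.reindex)
    also have "\<dots> = (\<Sum>v\<in>T. of_rat (u v) * v)"
      using T \<open>finite Fs\<close> by (intro sum.mono_neutral_cong_right) auto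
    also note s
    finally have "\<forall>f\<in>Fs. ?c f = 0" by (rule indep)
    moreover obtain f where "f \<in> Fs" "x = ev f" using x T by blast
    ultimately show "u x = 0" using x by (auto dest: bspec[of _ _ f])
  qed
  moreover have "ev ` Fs \<subseteq> rat_real.span (monomials S (card I * N * E))" using ev_in by blast
  ultimately have "card (ev ` Fs) \<le> card (monomials S (card I * N * E))"
    using rat_real.independent_span_bound card_monomials_le(1)[OF assms(1)] by blast
  also have "\<dots> \<le> Suc (card I * N * E) ^ card S" using card_monomials_le(2)[OF assms(1)] .
  finally show False
    using E \<open>card Fs = _\<close> inj by (simp add: card_image)
qed

section \<open>Algebraically independent reals near prescribed values\<close>

lemma countable_field_gen:
  assumes "countable S" shows "countable (field_gen S)"
proof -
  define step where "step X = X \<union> (\<lambda>(x, y). x + y) ` (X \<times> X) \<union> (\<lambda>(x, y). x * y) ` (X \<times> X)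
     \<union> uminus ` X \<union> inverse ` X" for X :: "real set"
  define G where "G n = (step ^^ n) (S \<union> {0, 1})" for n
  have "countable (G n)" for n
  proof (induction n)
    case 0 then show ?case using assms by (simp add: G_def)
  next
    case (Suc n)
    have "G (Suc n) = step (G n)" by (simp add: G_def)
    then show ?case using Suc by (auto simp: step_def intro!: countable_Un countable_image countable_SIGMA)
  qed
  have mono: "G m \<subseteq> G n" if "m \<le> n" for m n
    by (rule lift_Suc_mono_le[OF _ that]) (unfold G_def funpow.simps o_apply step_def, blast)
  have G_Suc: "G (Suc n) = step (G n)" for n by (simp add: G_def)
  have "x \<in> (\<Union>n. G n)" if "x \<in> field_gen S" for x
    using that
  proof induction
    case (gen x) then have "x \<in> G 0" by (simp add: G_def) then show ?case by blast
  next
    case zero have "0 \<in> G 0" by (simp add: G_def) then show ?case by blast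
  next
    case one have "1 \<in> G 0" by (simp add: G_def) then show ?case by blast
  next
    case (add x y)
    then obtain m n where "x \<in> G m" "y \<in> G n" by blast
    then have "x \<in> G (max m n)" "y \<in> G (max m n)"
      using mono[of m "max m n"] mono[of n "max m n"] by auto
    then have "x + y \<in> G (Suc (max m n))" unfolding G_Suc step_def by force
    then show ?case by blast
  next
    case (uminus x)
    then obtain m where "x \<in> G m" by blast
    then have "- x \<in> G (Suc m)" unfolding G_Suc step_def by force
    then show ?case by blast
  next
    case (mult x y)
    then obtain m n where "x \<in> G m" "y \<in> G n" by blast
    then have "x \<in> G (max m n)" "y \<in> G (max m n)"
      using mono[of m "max m n"] mono[of n "max m n"] by auto
    then have "x * y \<in> G (Suc (max m n))" unfolding G_Suc step_def by force
    then show ?case by blast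
  next
    case (inverse x)
    then obtain m where "x \<in> G m" by blast
    then have "inverse x \<in> G (Suc m)" unfolding G_Suc step_def by force
    then show ?case by blast
  qed
  moreover have "countable (\<Union>n. G n)"
    using \<open>\<And>n. countable (G n)\<close> by (intro countable_UN) auto
  ultimately show ?thesis by (meson countable_subset subsetI)
qed

lemma countable_algebraic:
  fixes F :: "real set"
  assumes "countable F"
  shows "countable {r. \<exists>p. p \<noteq> 0 \<and> (\<forall>i. coeff p i \<in> F) \<and> poly p r = 0}"
proof -
  have "countable (Poly ` lists F)" using assms by simp
  moreover have "{p. \<forall>i. coeff p i \<in> F} \<subseteq> Poly ` lists F"
  proof
    fix p assume p: "p \<in> {p. \<forall>i. coeff p i \<in> F}"
    have "p = Poly (coeffs p)" by simp
    moreover have "coeffs p \<in> lists F" using p by (auto simp: coeffs_def)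
    ultimately show "p \<in> Poly ` lists F" by blast
  qed
  ultimately have "countable {p. \<forall>i. coeff p i \<in> F}" using countable_subset by blast
  then have "countable (\<Union>p\<in>{p. \<forall>i. coeff p i \<in> F} - {0}. {r. poly p r = 0})"
    by (intro countable_UN) (auto simp: poly_roots_finite countable_finite)
  then show ?thesis by (rule countable_subset[rotated]) auto
qed

text \<open>Grouping a relation by the exponent of \<open>x\<close> makes it a polynomial in
  \<open>r\<close> over the field of the old values. This polynomial must be zero, and each of its
  coefficients is a relation among the old values.\<close>

lemma alg_indep_insert:
  assumes I: "alg_indep I a" "finite I" "x \<notin> I"
    and r: "\<And>p. p \<noteq> 0 \<Longrightarrow> (\<forall>i. coeff p i \<in> field_gen (a ` I)) \<Longrightarrow> poly p r \<noteq> 0"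
  shows "alg_indep (insert x I) (a(x := r))"
  unfolding alg_indep_def
proof (intro allI impI ballI)
  fix M c f assume M: "finite M" "M \<subseteq> exponents (insert x I)" and f: "f \<in> M"
    and sum: "(\<Sum>f\<in>M. of_rat (c f) * (\<Prod>y\<in>insert x I. (a(x := r)) y ^ f y)) = 0"
  let ?v = "\<lambda>f. of_rat (c f) * (\<Prod>y\<in>I. a y ^ f y) :: real"
  define p where "p = (\<Sum>f\<in>M. monom (?v f) (f x))"
  have prod: "(\<Prod>y\<in>insert x I. (a(x := r)) y ^ f y) = r ^ f x * (\<Prod>y\<in>I. a y ^ f y)" for f
  proof -
    have "(\<Prod>y\<in>I. (a(x := r)) y ^ f y) = (\<Prod>y\<in>I. a y ^ f y)"
      using I(3) by (intro prod.cong refl) (metis fun_upd_other)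
    then show ?thesis using I(2,3) by simp
  qed
  have "poly p r = 0"
    using sum unfolding prod by (simp add: p_def poly_sum poly_monom mult_ac)
  have co: "coeff p e = (\<Sum>f\<in>{f \<in> M. f x = e}. ?v f)" for e
    using M by (simp add: p_def coeff_sum sum.If_cases Int_def)
  note F = subfield_field_gen[of "a ` I"]
  have "\<forall>i. coeff p i \<in> field_gen (a ` I)"
    unfolding co
    by (intro allI subfield_sum[OF F] subfield_mult[OF F] subfield_of_rat[OF F] subfield_prod[OF F] subfield_power[OF F])
       (auto intro: field_gen.gen)
  with r \<open>poly p r = 0\<close> have "p = 0" by blast
  define M' where "M' = {g \<in> M. g x = f x}"
  \<comment> \<open>Terms sharing the exponent of \<open>x\<close> stay distinct when it is
    forgotten, so they form a genuine relation over \<open>I\<close>.\<close>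
  let ?g = "\<lambda>h. h(x := 0)"
  have inj: "inj_on ?g M'"
  proof (rule inj_onI)
    fix g h assume "g \<in> M'" "h \<in> M'" and eq: "g(x := 0) = h(x := 0)"
    then have "g x = h x" by (simp add: M'_def)
    show "g = h"
    proof
      fix y show "g y = h y" using fun_cong[OF eq, of y] \<open>g x = h x\<close> by (cases "y = x") auto
    qed
  qed
  have "(\<Sum>g\<in>?g ` M'. of_rat (c (g(x := f x))) * (\<Prod>y\<in>I. a y ^ g y)) = (\<Sum>g\<in>M'. ?v g)"
  proof (subst sum.reindex[OF inj], rule sum.cong[OF refl])
    fix g assume g: "g \<in> M'"
    then have "(g(x := 0))(x := f x) = g" by (auto simp: M'_def)
    moreover have "(\<Prod>y\<in>I. a y ^ (g(x := 0)) y) = (\<Prod>y\<in>I. a y ^ g y)"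
      using I by (intro prod.cong) auto
    ultimately show "((\<lambda>g. of_rat (c (g(x := f x))) * (\<Prod>y\<in>I. a y ^ g y)) \<circ> ?g) g = ?v g" by simp
  qed
  also have "\<dots> = 0" using co[of "f x"] \<open>p = 0\<close> by (simp add: M'_def)
  finally have "(\<Sum>g\<in>?g ` M'. of_rat (c (g(x := f x))) * (\<Prod>y\<in>I. a y ^ g y)) = 0" .
  moreover have "finite (?g ` M')" "?g ` M' \<subseteq> exponents I"
    using M by (auto simp: M'_def exponents_def)
  ultimately have "\<forall>g\<in>?g ` M'. c (g(x := f x)) = 0"
    using I(1) unfolding alg_indep_def
    by (elim allE[of _ "?g ` M'"] allE[of _ "\<lambda>g. c (g(x := f x))"]) blast
  moreover have "f(x := 0) \<in> ?g ` M'" using f by (auto simp: M'_def)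
  ultimately have "c ((f(x := 0))(x := f x)) = 0" by (rule bspec)
  then show "c f = 0" by simp
qed

text \<open>The values to avoid at each step are the reals algebraic over a countable field; they
  are countable and cannot cover an interval.\<close>

lemma alg_indep_dense:
  fixes b :: "'x \<Rightarrow> real"
  assumes "finite I" "\<epsilon> > 0"
  shows "\<exists>a. alg_indep I a \<and> (\<forall>x\<in>I. \<bar>a x - b x\<bar> < \<epsilon>)"
  using assms(1)
proof (induction I rule: finite_induct)
  case empty
  have "\<forall>f\<in>M. c f = (0::rat)"
    if "M \<subseteq> exponents ({}::'x set)" "(\<Sum>f\<in>M. of_rat (c f)) = (0::real)" for M c
  proof -
    have "M \<subseteq> {\<lambda>_. 0}" using that by (auto simp: exponents_def)
    then have "M = {} \<or> M = {\<lambda>_. 0}" by blast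
    then show ?thesis using that(2) by auto
  qed
  then show ?case by (auto simp: alg_indep_def)
next
  case (insert x I)
  then obtain a where a: "alg_indep I a" "\<And>x. x \<in> I \<Longrightarrow> \<bar>a x - b x\<bar> < \<epsilon>" by blast
  let ?A = "{r. \<exists>p. p \<noteq> 0 \<and> (\<forall>i. coeff p i \<in> field_gen (a ` I)) \<and> poly p r = 0}"
  have "countable ?A"
    using insert by (intro countable_algebraic countable_field_gen) (simp add: countable_finite)
  moreover have "uncountable {b x - \<epsilon> <..< b x + \<epsilon>}"
    using assms(2) by (simp add: uncountable_open_interval)
  ultimately have "\<not> {b x - \<epsilon> <..< b x + \<epsilon>} \<subseteq> ?A" using countable_subset by blast
  then obtain r where r: "r \<in> {b x - \<epsilon> <..< b x + \<epsilon>}" "r \<notin> ?A" by blast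
  have "alg_indep (insert x I) (a(x := r))"
    using a(1) insert.hyps r(2) by (intro alg_indep_insert) auto
  moreover have "\<forall>y\<in>insert x I. \<bar>(a(x := r)) y - b y\<bar> < \<epsilon>"
    using a r insert.hyps by (auto simp: abs_less_iff)
  ultimately show ?case by blast
qed

section \<open>Strain forms\<close>

text \<open>Here \<open>k\<close> counts homogeneous coordinates, so it becomes
  \<open>Suc d\<close>; the cluster parameter of the theorem is called \<kappa> in the general
  lemmas below.\<close>

definition dependency :: "'v set \<Rightarrow> nat \<Rightarrow> ('v \<Rightarrow> nat \<Rightarrow> real) \<Rightarrow> ('v \<Rightarrow> real) \<Rightarrow> bool" where
  "dependency V k a y \<longleftrightarrow> (\<forall>\<alpha><k. (\<Sum>v\<in>V. y v * a v \<alpha>) = 0)"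

text \<open>For velocities \<open>w\<close> at points \<open>p\<close>, the strain of a pair is the
  inner product of \<open>p u - p v\<close> and \<open>w u - w v\<close>. When it is expanded and
  summed against two affine dependencies, each term contains a factor that one of them kills. The
  bilinear condition is the polarised quadratic one.\<close>

definition strain_form ::
    "'v set \<Rightarrow> 'v set set \<Rightarrow> nat \<Rightarrow> ('v \<Rightarrow> nat \<Rightarrow> real) \<Rightarrow> ('v \<Rightarrow> 'v \<Rightarrow> real) \<Rightarrow> bool" where
  "strain_form V E k a C \<longleftrightarrow>
    (\<forall>u\<in>V. \<forall>v\<in>V. C u v = C v u) \<and> (\<forall>v\<in>V. C v v = 0) \<and>
    (\<forall>u\<in>V. \<forall>v\<in>V. {u, v} \<in> E \<longrightarrow> C u v = 0) \<and>
    (\<forall>y z. dependency V k a y \<longrightarrow> dependency V k a z \<longrightarrow>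
       (\<Sum>u\<in>V. \<Sum>v\<in>V. y u * C u v * z v) = 0)"

definition strain_rigid :: "'v set \<Rightarrow> 'v set set \<Rightarrow> nat \<Rightarrow> ('v \<Rightarrow> nat \<Rightarrow> real) \<Rightarrow> bool" where
  "strain_rigid V E k a \<longleftrightarrow> (\<forall>C. strain_form V E k a C \<longrightarrow> (\<forall>u\<in>V. \<forall>v\<in>V. C u v = 0))"

text \<open>A kernel vector, scaled to have entry 1 at \<beta>, expresses column \<beta> through the
  other columns and \<open>k - 1\<close> ratios. This leaves
  \<open>k * (k - 1) + (k - 1) < k * k\<close> parameters.\<close>

lemma generic_rows_injective:
  assumes gen: "alg_indep (V \<times> {..<k}) (\<lambda>(v, \<alpha>). a v \<alpha>)" and "finite V"
    and J: "J \<subseteq> V" "card J = k" and x: "\<And>j. j \<in> J \<Longrightarrow> (\<Sum>\<alpha><k. a j \<alpha> * x \<alpha>) = 0"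
  shows "\<forall>\<alpha><k. x \<alpha> = 0"
proof (rule ccontr)
  assume "\<not> ?thesis"
  then obtain \<beta> where \<beta>: "\<beta> < k" "x \<beta> \<noteq> 0" by blast
  have finJ: "finite J" using J \<open>finite V\<close> finite_subset by blast
  let ?K = "{..<k} - {\<beta>}"
  define S where "S = (\<lambda>(j, \<alpha>). a j \<alpha>) ` (J \<times> ?K) \<union> (\<lambda>\<alpha>. x \<alpha> / x \<beta>) ` ?K"
  have "finite S" using finJ by (simp add: S_def)
  note F = subfield_field_gen[of S]
  have mem: "a j \<alpha> \<in> field_gen S" if "j \<in> J" "\<alpha> < k" for j \<alpha>
  proof (cases "\<alpha> = \<beta>")
    case False
    then show ?thesis using that by (intro field_gen.gen) (auto simp: S_def)
  next
    case True
    have "a j \<beta> * x \<beta> + (\<Sum>\<alpha>\<in>?K. a j \<alpha> * x \<alpha>) = 0"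
      using x[OF that(1)] \<beta> by (subst (asm) sum.remove[of _ \<beta>]) auto
    then have "a j \<beta> = - (\<Sum>\<alpha>\<in>?K. a j \<alpha> * x \<alpha>) / x \<beta>"
      using \<beta> by (simp add: eq_divide_eq add_eq_0_iff)
    also have "\<dots> = - (\<Sum>\<alpha>\<in>?K. a j \<alpha> * (x \<alpha> / x \<beta>))"
      by (simp add: sum_divide_distrib)
    also have "\<dots> \<in> field_gen S"
      using that by (intro subfield_uminus[OF F] subfield_sum[OF F] subfield_mult[OF F] field_gen.gen)
        (auto simp: S_def)
    finally show ?thesis using True by simp
  qed
  have "alg_indep (J \<times> {..<k}) (\<lambda>(v, \<alpha>). a v \<alpha>)"
    by (rule alg_indep_subset[OF gen]) (use J \<open>finite V\<close> in auto)
  then have "card (J \<times> {..<k}) \<le> card S"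
    by (rule alg_indep_card_le[OF \<open>finite S\<close>, rotated]) (use finJ mem in auto)
  also have "\<dots> \<le> card (J \<times> ?K) + card ?K"
    unfolding S_def using finJ
    by (intro order_trans[OF card_Un_le] add_mono card_image_le) auto
  also have "\<dots> = k * (k - 1) + (k - 1)" using J \<beta> by (simp add: card_cartesian_product)
  also have "\<dots> < k * k" using \<beta> by (cases k) auto
  finally show False using J by (simp add: card_cartesian_product)
qed

text \<open>The \<open>k\<close> coordinates of row \<open>s\<close> would be computed from the rows
  of \<open>J\<close> and only \<open>card J < k\<close> coefficients.\<close>

lemma generic_row_not_in_span:
  assumes gen: "alg_indep (V \<times> {..<k}) (\<lambda>(v, \<alpha>). a v \<alpha>)" and "finite V"
    and J: "J \<subseteq> V" "card J < k" and s: "s \<in> V" "s \<notin> J"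
    and r: "\<And>\<alpha>. \<alpha> < k \<Longrightarrow> a s \<alpha> = (\<Sum>j\<in>J. r j * a j \<alpha>)"
  shows False
proof -
  have finJ: "finite J" using J \<open>finite V\<close> finite_subset by blast
  define S where "S = (\<lambda>(j, \<alpha>). a j \<alpha>) ` (J \<times> {..<k}) \<union> r ` J"
  have "finite S" using finJ by (simp add: S_def)
  note F = subfield_field_gen[of S]
  have mem: "a j \<alpha> \<in> field_gen S" if "j \<in> insert s J" "\<alpha> < k" for j \<alpha>
  proof (cases "j = s")
    case True
    have "(\<Sum>j\<in>J. r j * a j \<alpha>) \<in> field_gen S"
      using that by (intro subfield_sum[OF F] subfield_mult[OF F] field_gen.gen) (auto simp: S_def)
    then show ?thesis using r that True by simp
  next
    case False
    then show ?thesis using that by (intro field_gen.gen) (auto simp: S_def)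
  qed
  have "alg_indep (insert s J \<times> {..<k}) (\<lambda>(v, \<alpha>). a v \<alpha>)"
    by (rule alg_indep_subset[OF gen]) (use J s \<open>finite V\<close> in auto)
  then have "card (insert s J \<times> {..<k}) \<le> card S"
    by (rule alg_indep_card_le[OF \<open>finite S\<close>, rotated]) (use finJ mem in auto)
  also have "\<dots> \<le> card (J \<times> {..<k}) + card J"
    unfolding S_def using finJ
    by (intro order_trans[OF card_Un_le] add_mono card_image_le) auto
  finally show False using J s finJ by (simp add: card_cartesian_product)
qed

text \<open>The weights form the unit vector at \<open>s\<close> minus the combination
  \<open>r\<close>; they are a dependency as soon as \<open>r\<close> expresses row \<open>s\<close>
  through the rows of \<open>J\<close>.\<close>

lemma sum_unit_minus_combination:
  fixes g r :: "'v \<Rightarrow> real"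
  assumes "finite V" "s \<in> V" "J \<subseteq> V" "s \<notin> J"
  shows "(\<Sum>v\<in>V. (if v = s then 1 else if v \<in> J then - r v else 0) * g v) = g s - (\<Sum>j\<in>J. r j * g j)"
proof -
  have "(\<Sum>v\<in>V. (if v = s then 1 else if v \<in> J then - r v else 0) * g v)
      = (\<Sum>v\<in>insert s J. (if v = s then 1 else if v \<in> J then - r v else 0) * g v)"
    using assms by (intro sum.mono_neutral_right) auto
  also have "\<dots> = g s + (\<Sum>v\<in>J. - r v * g v)"
    using assms by (subst sum.insert) (auto intro: finite_subset intro!: sum.cong)
  finally show ?thesis by (simp add: sum_negf)
qed

text \<open>By symmetry, the columns indexed by a row basis \<open>I\<close> span all columns. A
  relation that holds on the columns of \<open>I\<close> thus holds on all of \<open>V\<close>, so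
  the principal submatrix on \<open>I\<close> is nonsingular.\<close>

lemma strain_form_row_basis:
  assumes "finite V" "strain_form V E k a C"
  obtains I z where "I \<subseteq> V"
    "\<And>u v. u \<in> V \<Longrightarrow> v \<in> V \<Longrightarrow> C u v = (\<Sum>i\<in>I. z u i * C i v)"
    "\<And>i j. i \<in> I \<Longrightarrow> j \<in> I \<Longrightarrow> z i j = (if i = j then 1 else 0 :: real)"
    "rows_independent I I C"
proof -
  obtain I z where I: "I \<subseteq> V" "rows_independent V I C"
    and z: "\<And>u v. u \<in> V \<Longrightarrow> v \<in> V \<Longrightarrow> C u v = (\<Sum>i\<in>I. z u i * C i v)"
      "\<And>i j. i \<in> I \<Longrightarrow> j \<in> I \<Longrightarrow> z i j = (if i = j then 1 else 0 :: real)"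
    using row_basis_exists[OF assms(1), of V C] by blast
  have sym: "C u v = C v u" if "u \<in> V" "v \<in> V" for u v
    using assms(2) that by (auto simp: strain_form_def)
  have "rows_independent I I C"
    unfolding rows_independent_def
  proof (intro allI impI)
    fix c assume c: "\<forall>w\<in>I. (\<Sum>i\<in>I. c i * C i w) = 0"
    have "(\<Sum>i\<in>I. c i * C i v) = 0" if v: "v \<in> V" for v
    proof -
      have "(\<Sum>i\<in>I. c i * C i v) = (\<Sum>i\<in>I. \<Sum>j\<in>I. c i * (z v j * C i j))"
      proof (rule sum.cong[OF refl])
        fix i assume i: "i \<in> I"
        have "C i v = (\<Sum>j\<in>I. z v j * C j i)" using z(1)[OF v, of i] sym[of i v] i I v by auto
        also have "\<dots> = (\<Sum>j\<in>I. z v j * C i j)"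
          using I i sym by (intro sum.cong refl) (auto simp: subset_iff)
        finally show "c i * C i v = (\<Sum>j\<in>I. c i * (z v j * C i j))" by (simp add: sum_distrib_left)
      qed
      also have "\<dots> = (\<Sum>j\<in>I. z v j * (\<Sum>i\<in>I. c i * C i j))"
        by (subst sum.swap) (simp add: sum_distrib_left mult_ac)
      finally show ?thesis using c by simp
    qed
    then show "\<forall>i\<in>I. c i = 0" using I(2) unfolding rows_independent_def by blast
  qed
  with I z show ?thesis using that by blast
qed

text \<open>With \<open>C = Z C\<^sub>I Z\<^sup>T\<close>, the vectors \<open>x\<close> such that \<open>a x\<close> lies in the column space of \<open>C\<close>
  form a space of dimension \<open>k - card B\<close>, here given in echelon form.  Its image in the row space
  is the annihilator of an isotropic subspace for the nondegenerate form \<open>C\<^sub>I\<close>, so that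
  its dimension is at least half of the rank.\<close>

lemma strain_form_column_space:
  assumes "finite V" and C: "strain_form V E k a C"
    and I: "I \<subseteq> V" "rows_independent I I C"
    and z: "\<And>u v. u \<in> V \<Longrightarrow> v \<in> V \<Longrightarrow> C u v = (\<Sum>i\<in>I. z u i * C i v)"
      "\<And>i j. i \<in> I \<Longrightarrow> j \<in> I \<Longrightarrow> z i j = (if i = j then 1 else 0 :: real)"
  obtains B \<xi> where "B \<subseteq> {..<k}" "card I \<le> 2 * (k - card B)"
    "\<And>v \<kappa>. v \<in> V \<Longrightarrow> \<kappa> < k \<Longrightarrow> a v \<kappa> - (\<Sum>\<beta>\<in>B. \<xi> \<kappa> \<beta> * a v \<beta>)
        = (\<Sum>i\<in>I. z v i * (a i \<kappa> - (\<Sum>\<beta>\<in>B. \<xi> \<kappa> \<beta> * a i \<beta>)))"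
proof -
  have finI: "finite I" using I assms(1) finite_subset by blast
  have sym: "C u v = C v u" if "u \<in> V" "v \<in> V" for u v
    using C that by (auto simp: strain_form_def)
  \<comment> \<open>The part of coordinate column \<alpha> that its entries on \<open>I\<close> do
    not predict through \<open>z\<close>. Combinations of coordinates with vanishing
    \<open>D\<close> lie in the column space of \<open>C\<close>; a basis \<open>B\<close> of the
    columns of \<open>D\<close> leaves \<open>k - card B\<close> of them, and \<open>g\<close> lists
    these.\<close>
  define D where "D \<alpha> v = a v \<alpha> - (\<Sum>i\<in>I. z v i * a i \<alpha>)" for \<alpha> v
  obtain B \<xi> where B: "B \<subseteq> {..<k}" "rows_independent V B D"
    and \<xi>: "\<And>\<kappa> v. \<kappa> < k \<Longrightarrow> v \<in> V \<Longrightarrow> D \<kappa> v = (\<Sum>\<beta>\<in>B. \<xi> \<kappa> \<beta> * D \<beta> v)"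
    using row_basis_exists[of "{..<k}" V D] by (metis finite_lessThan lessThan_iff)
  have finB: "finite B" using B(1) finite_subset by blast
  define g where "g \<kappa> i = a i \<kappa> - (\<Sum>\<beta>\<in>B. \<xi> \<kappa> \<beta> * a i \<beta>)" for \<kappa> i
  have eq: "g \<kappa> v = (\<Sum>i\<in>I. z v i * g \<kappa> i)" if "\<kappa> < k" "v \<in> V" for \<kappa> v
  proof -
    have "(\<Sum>\<beta>\<in>B. \<xi> \<kappa> \<beta> * D \<beta> v)
       = (\<Sum>\<beta>\<in>B. \<xi> \<kappa> \<beta> * a v \<beta>) - (\<Sum>i\<in>I. z v i * (\<Sum>\<beta>\<in>B. \<xi> \<kappa> \<beta> * a i \<beta>))"
    proof -
      have "(\<Sum>\<beta>\<in>B. \<xi> \<kappa> \<beta> * (\<Sum>i\<in>I. z v i * a i \<beta>)) = (\<Sum>i\<in>I. z v i * (\<Sum>\<beta>\<in>B. \<xi> \<kappa> \<beta> * a i \<beta>))"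
        unfolding sum_distrib_left by (subst sum.swap) (simp add: mult_ac)
      then show ?thesis by (simp add: D_def right_diff_distrib sum_subtractf)
    qed
    with \<xi>[OF that] show ?thesis
      by (simp add: D_def g_def right_diff_distrib sum_subtractf)
  qed
  define K where "K = {..<k} - B"
  have cardK: "card K = k - card B" using B(1) finB by (simp add: K_def card_Diff_subset)
  have lift: "\<exists>y. dependency V k a y \<and> (\<forall>i\<in>I. (\<Sum>v\<in>V. y v * z v i) = w i)"
    if w: "\<And>\<kappa>. \<kappa> \<in> K \<Longrightarrow> (\<Sum>i\<in>I. w i * g \<kappa> i) = 0" for w
  proof -
    obtain t where t: "\<And>\<beta>. \<beta> \<in> B \<Longrightarrow> (\<Sum>v\<in>V. t v * D \<beta> v) = - (\<Sum>i\<in>I. w i * a i \<beta>)"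
      using independent_rows_surj[OF finB assms(1) B(2), of "\<lambda>\<beta>. - (\<Sum>i\<in>I. w i * a i \<beta>)"] by metis
    \<comment> \<open>As \<open>z\<close> is the identity on \<open>I\<close>, the correction there
      forces the sums against \<open>z\<close> to be \<open>w\<close>. The remaining freedom
      \<open>t\<close> cancels the coordinates in \<open>B\<close>; the other coordinates then
      vanish because \<open>w\<close> annihilates every \<open>g \<kappa>\<close>.\<close>
    define y where "y v = t v + (if v \<in> I then w v - (\<Sum>u\<in>V. t u * z u v) else 0)" for v
    have ysum: "(\<Sum>v\<in>V. y v * f v) = (\<Sum>v\<in>V. t v * f v) + (\<Sum>i\<in>I. w i * f i)
        - (\<Sum>v\<in>V. t v * (\<Sum>i\<in>I. z v i * f i))" for f
    proof -
      have "(\<Sum>v\<in>V. y v * f v) = (\<Sum>v\<in>V. t v * f v)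
          + (\<Sum>v\<in>V. if v \<in> I then (w v - (\<Sum>u\<in>V. t u * z u v)) * f v else 0)"
        unfolding sum.distrib[symmetric] by (rule sum.cong) (auto simp: y_def distrib_right)
      also have "(\<Sum>v\<in>V. if v \<in> I then (w v - (\<Sum>u\<in>V. t u * z u v)) * f v else 0)
          = (\<Sum>v\<in>I. (w v - (\<Sum>u\<in>V. t u * z u v)) * f v)"
        using I(1) assms(1) by (simp add: sum.inter_restrict[symmetric] Int_absorb1)
      also have "\<dots> = (\<Sum>v\<in>I. w v * f v) - (\<Sum>v\<in>I. (\<Sum>u\<in>V. t u * z u v) * f v)"
        by (simp add: left_diff_distrib sum_subtractf)
      also have "(\<Sum>v\<in>I. (\<Sum>u\<in>V. t u * z u v) * f v) = (\<Sum>v\<in>V. t v * (\<Sum>i\<in>I. z v i * f i))"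
        unfolding sum_distrib_left sum_distrib_right by (subst sum.swap) (simp add: mult_ac)
      finally show ?thesis by simp
    qed
    have "(\<Sum>v\<in>V. y v * z v i) = w i" if i: "i \<in> I" for i
    proof -
      have "(\<Sum>j\<in>I. z v j * z j i) = z v i" for v
      proof -
        have "(\<Sum>j\<in>I. z v j * z j i) = (\<Sum>j\<in>I. if j = i then z v i else 0)"
          using i by (intro sum.cong) (auto simp: z(2))
        then show ?thesis using i finI by simp
      qed
      moreover have "(\<Sum>j\<in>I. w j * z j i) = w i"
      proof -
        have "(\<Sum>j\<in>I. w j * z j i) = (\<Sum>j\<in>I. if j = i then w i else 0)"
          using i by (intro sum.cong) (auto simp: z(2))
        then show ?thesis using i finI by simp
      qed
      ultimately show ?thesis unfolding ysum by simp
    qed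
    moreover have "dependency V k a y"
      unfolding dependency_def
    proof (intro allI impI)
      fix \<alpha> assume \<alpha>: "\<alpha> < k"
      have yD: "(\<Sum>v\<in>V. y v * a v \<alpha>) = (\<Sum>v\<in>V. t v * D \<alpha> v) + (\<Sum>i\<in>I. w i * a i \<alpha>)" for \<alpha>
        unfolding ysum by (simp add: D_def right_diff_distrib sum_subtractf)
      show "(\<Sum>v\<in>V. y v * a v \<alpha>) = 0"
      proof (cases "\<alpha> \<in> B")
        case True
        then show ?thesis using yD t by simp
      next
        case False
        have "(\<Sum>i\<in>I. w i * a i \<alpha>) = (\<Sum>i\<in>I. w i * (\<Sum>\<beta>\<in>B. \<xi> \<alpha> \<beta> * a i \<beta>))"
          using w[of \<alpha>] \<alpha> False by (simp add: K_def g_def right_diff_distrib sum_subtractf)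
        also have "\<dots> = (\<Sum>\<beta>\<in>B. \<xi> \<alpha> \<beta> * (\<Sum>i\<in>I. w i * a i \<beta>))"
          unfolding sum_distrib_left by (subst sum.swap) (simp add: mult_ac)
        also have "\<dots> = - (\<Sum>\<beta>\<in>B. \<xi> \<alpha> \<beta> * (\<Sum>v\<in>V. t v * D \<beta> v))"
          using t by (simp add: sum_negf)
        also have "\<dots> = - (\<Sum>v\<in>V. t v * D \<alpha> v)"
        proof -
          have "(\<Sum>v\<in>V. t v * D \<alpha> v) = (\<Sum>v\<in>V. t v * (\<Sum>\<beta>\<in>B. \<xi> \<alpha> \<beta> * D \<beta> v))"
            using \<xi>[OF \<alpha>] by simp
          also have "\<dots> = (\<Sum>\<beta>\<in>B. \<xi> \<alpha> \<beta> * (\<Sum>v\<in>V. t v * D \<beta> v))"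
            unfolding sum_distrib_left by (subst sum.swap) (simp add: mult_ac)
          finally show ?thesis by simp
        qed
        finally show ?thesis using yD by simp
      qed
    qed
    ultimately show ?thesis by blast
  qed
  have iso: "(\<Sum>i\<in>I. w i * (\<Sum>j\<in>I. C i j * u j)) = 0"
    if w: "\<And>\<kappa>. \<kappa> \<in> K \<Longrightarrow> (\<Sum>i\<in>I. w i * g \<kappa> i) = 0"
      and u: "\<And>\<kappa>. \<kappa> \<in> K \<Longrightarrow> (\<Sum>i\<in>I. u i * g \<kappa> i) = 0" for w u
  proof -
    obtain y where y: "dependency V k a y" "\<And>i. i \<in> I \<Longrightarrow> (\<Sum>v\<in>V. y v * z v i) = w i"
      using lift[of w] w by metis
    obtain x where x: "dependency V k a x" "\<And>i. i \<in> I \<Longrightarrow> (\<Sum>v\<in>V. x v * z v i) = u i"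
      using lift[of u] u by metis
    have CV: "C p q = (\<Sum>i\<in>I. \<Sum>j\<in>I. z p i * C i j * z q j)" if "p \<in> V" "q \<in> V" for p q
    proof -
      have "C p q = (\<Sum>i\<in>I. z p i * C i q)" using z(1) that by simp
      also have "\<dots> = (\<Sum>i\<in>I. z p i * (\<Sum>j\<in>I. z q j * C j i))"
      proof (rule sum.cong[OF refl])
        fix i assume "i \<in> I"
        then have "C i q = (\<Sum>j\<in>I. z q j * C j i)" using z(1)[of q i] sym[of i q] that I by auto
        then show "z p i * C i q = z p i * (\<Sum>j\<in>I. z q j * C j i)" by simp
      qed
      also have "\<dots> = (\<Sum>i\<in>I. \<Sum>j\<in>I. z p i * C i j * z q j)"
        unfolding sum_distrib_left using I(1) sym
        by (intro sum.cong refl) (auto simp: subset_iff mult_ac)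
      finally show ?thesis .
    qed
    have "0 = (\<Sum>p\<in>V. \<Sum>q\<in>V. y p * C p q * x q)"
      using C x y by (auto simp: strain_form_def)
    also have "\<dots> = (\<Sum>p\<in>V. \<Sum>q\<in>V. \<Sum>i\<in>I. \<Sum>j\<in>I. (y p * z p i) * C i j * (x q * z q j))"
      by (intro sum.cong refl) (simp add: CV sum_distrib_left sum_distrib_right mult_ac)
    also have "\<dots> = (\<Sum>p\<in>V. \<Sum>i\<in>I. \<Sum>q\<in>V. \<Sum>j\<in>I. (y p * z p i) * C i j * (x q * z q j))"
      by (intro sum.cong refl sum.swap)
    also have "\<dots> = (\<Sum>i\<in>I. \<Sum>p\<in>V. \<Sum>q\<in>V. \<Sum>j\<in>I. (y p * z p i) * C i j * (x q * z q j))"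
      by (rule sum.swap)
    also have "\<dots> = (\<Sum>i\<in>I. \<Sum>p\<in>V. \<Sum>j\<in>I. \<Sum>q\<in>V. (y p * z p i) * C i j * (x q * z q j))"
      by (intro sum.cong refl sum.swap)
    also have "\<dots> = (\<Sum>i\<in>I. (\<Sum>p\<in>V. y p * z p i) * (\<Sum>j\<in>I. C i j * (\<Sum>q\<in>V. x q * z q j)))"
      unfolding sum_product by (simp add: sum_distrib_left mult_ac)
    also have "\<dots> = (\<Sum>i\<in>I. w i * (\<Sum>j\<in>I. C i j * u j))"
      using x(2) y(2) by simp
    finally show ?thesis by simp
  qed
  have "card I \<le> 2 * (k - card B)"
  proof (rule ccontr)
    assume "\<not> ?thesis"
    then have less: "card (K \<times> {False, True}) < card I"
      by (simp add: card_cartesian_product cardK)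
    \<comment> \<open>The Boolean selects one of two conditions for each \<kappa>: \<open>u\<close>
      annihilates \<open>g \<kappa>\<close>, or its image under \<open>C\<close> does. If
      \<open>2 * card K < card I\<close>, some nonzero \<open>u\<close> meets them all, and isotropy
      of the pair gives that this image has square sum 0.\<close>
    define M where "M e i = (if snd e then \<Sum>j\<in>I. g (fst e) j * C j i else g (fst e) i)" for e i
    obtain u where u: "\<exists>i\<in>I. u i \<noteq> 0"
      and ueq: "\<And>e. e \<in> K \<times> {False, True} \<Longrightarrow> (\<Sum>i\<in>I. M e i * u i) = 0"
      using homogeneous_system_nontrivial[OF _ finI less, of M] by (auto simp: K_def)
    define w where "w i = (\<Sum>j\<in>I. C i j * u j)" for i
    have u0: "(\<Sum>i\<in>I. u i * g \<kappa> i) = 0" if "\<kappa> \<in> K" for \<kappa>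
      using ueq[of "(\<kappa>, False)"] that by (simp add: M_def mult.commute)
    have w0: "(\<Sum>i\<in>I. w i * g \<kappa> i) = 0" if "\<kappa> \<in> K" for \<kappa>
    proof -
      have "(\<Sum>i\<in>I. w i * g \<kappa> i) = (\<Sum>i\<in>I. \<Sum>j\<in>I. g \<kappa> i * C i j * u j)"
        by (simp add: w_def sum_distrib_left sum_distrib_right mult_ac)
      also have "\<dots> = (\<Sum>j\<in>I. (\<Sum>i\<in>I. g \<kappa> i * C i j) * u j)"
        by (subst sum.swap) (simp add: sum_distrib_right)
      also have "\<dots> = 0" using ueq[of "(\<kappa>, True)"] that by (simp add: M_def)
      finally show ?thesis .
    qed
    have "(\<Sum>i\<in>I. w i * w i) = 0" using iso[of w u, OF w0 u0] by (simp add: w_def)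
    then have "\<forall>i\<in>I. w i = 0" using finI by (subst (asm) sum_nonneg_eq_0_iff) auto
    have "(\<Sum>i\<in>I. u i * C i j) = 0" if "j \<in> I" for j
    proof -
      have "(\<Sum>i\<in>I. u i * C i j) = w j"
        unfolding w_def using that I(1) sym by (intro sum.cong refl) (auto simp: subset_iff mult_ac)
      then show ?thesis using \<open>\<forall>i\<in>I. w i = 0\<close> that by simp
    qed
    then have "\<forall>i\<in>I. u i = 0" using I(2) unfolding rows_independent_def by blast
    with u show False by blast
  qed
  then show ?thesis using that[of B \<xi>] B(1) eq by (simp add: g_def)
qed

text \<open>The four parts of \<open>S\<close> generate a field containing all coordinates:
  \<open>C\<close> on the rows of \<open>I\<close> gives \<open>z\<close>, and \<open>z\<close> with
  \<xi> gives the coordinates outside \<open>B\<close>. Dividing by \<open>c0\<close> exploits that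
  \<open>C\<close> matters only up to scale. Which entries suffice is left to the hypothesis
  \<open>determined\<close>, since the two applications save parameters differently.\<close>

lemma generic_strain_form_count:
  assumes gen: "alg_indep (V \<times> {..<k}) (\<lambda>(v, \<alpha>). a v \<alpha>)" and finV: "finite V"
    and C: "strain_form V E k a C"
    and I: "I \<subseteq> V" "rows_independent I I C"
    and z: "\<And>u v. u \<in> V \<Longrightarrow> v \<in> V \<Longrightarrow> C u v = (\<Sum>i\<in>I. z u i * C i v)"
    and B: "B \<subseteq> {..<k}"
    and \<xi>: "\<And>v \<kappa>. v \<in> V \<Longrightarrow> \<kappa> < k \<Longrightarrow> a v \<kappa> - (\<Sum>\<beta>\<in>B. \<xi> \<kappa> \<beta> * a v \<beta>)
        = (\<Sum>i\<in>I. z v i * (a i \<kappa> - (\<Sum>\<beta>\<in>B. \<xi> \<kappa> \<beta> * a i \<beta>)))"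
    and c0: "c0 \<noteq> 0" and P: "finite P"
    and determined: "\<And>F i v. subfield_of_reals F \<Longrightarrow> (\<And>i \<alpha>. i \<in> I \<Longrightarrow> \<alpha> < k \<Longrightarrow> a i \<alpha> \<in> F) \<Longrightarrow>
        (\<And>i j. (i, j) \<in> P \<Longrightarrow> C i j / c0 \<in> F) \<Longrightarrow> i \<in> I \<Longrightarrow> v \<in> V \<Longrightarrow> C i v / c0 \<in> F"
  shows "card V * k \<le> card V * card B + (k - card B) * card B + card I * (k - card B) + card P"
proof -
  have finI: "finite I" using I finV finite_subset by blast
  have finB: "finite B" using B finite_subset by blast
  let ?K = "{..<k} - B"
  define S where "S = (\<lambda>(v, \<beta>). a v \<beta>) ` (V \<times> B) \<union> (\<lambda>(\<kappa>, \<beta>). \<xi> \<kappa> \<beta>) ` (?K \<times> B)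
    \<union> (\<lambda>(i, \<kappa>). a i \<kappa>) ` (I \<times> ?K) \<union> (\<lambda>(i, j). C i j / c0) ` P"
  have finS: "finite S" using finV finI finB P by (simp add: S_def)
  note F = subfield_field_gen[of S]
  have aI: "a i \<alpha> \<in> field_gen S" if "i \<in> I" "\<alpha> < k" for i \<alpha>
    using that I(1) by (intro field_gen.gen) (cases "\<alpha> \<in> B"; force simp: S_def)
  have Cin: "C i v / c0 \<in> field_gen S" if "i \<in> I" "v \<in> V" for i v
    using F aI _ that by (rule determined) (auto intro!: field_gen.gen simp: S_def)
  have zin: "z v i \<in> field_gen S" if v: "v \<in> V" and i: "i \<in> I" for v i
  proof -
    \<comment> \<open>Row \<open>v\<close> of \<open>C\<close> restricted to \<open>I\<close> is
      \<open>z v\<close> times the nonsingular block on \<open>I\<close>, so \<open>z v\<close> is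
      recovered inside the field.\<close>
    have "\<exists>y. (\<forall>i. y i \<in> field_gen S) \<and> (\<forall>j\<in>I. (\<Sum>i\<in>I. y i * (C i j / c0)) = C v j / c0)"
    proof (rule square_system_solvable[OF F finI finI refl])
      show "C i j / c0 \<in> field_gen S" if "i \<in> I" "j \<in> I" for i j using Cin that I by auto
      show "C v j / c0 \<in> field_gen S" if "j \<in> I" for j
        using Cin[of j v] v that C I by (auto simp: strain_form_def subset_iff)
      fix x assume x: "\<And>i. i \<in> I \<Longrightarrow> (\<Sum>j\<in>I. C i j / c0 * x j) = 0"
      have "(\<Sum>j\<in>I. x j * C j i) = 0" if "i \<in> I" for i
      proof -
        have "(\<Sum>j\<in>I. x j * C j i) = c0 * (\<Sum>j\<in>I. C i j / c0 * x j)"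
          unfolding sum_distrib_left using C I that c0
          by (intro sum.cong refl) (auto simp: strain_form_def subset_iff)
        then show ?thesis using x[OF that] by simp
      qed
      then show "\<forall>j\<in>I. x j = 0" using I(2) unfolding rows_independent_def by blast
    qed
    then obtain y where y: "\<And>i. y i \<in> field_gen S"
      "\<And>j. j \<in> I \<Longrightarrow> (\<Sum>i\<in>I. y i * (C i j / c0)) = C v j / c0" by blast
    have "(\<Sum>i\<in>I. (z v i - y i) * C i j) = 0" if "j \<in> I" for j
    proof -
      have "(\<Sum>i\<in>I. y i * C i j) = c0 * (\<Sum>i\<in>I. y i * (C i j / c0))"
        using c0 by (simp add: sum_distrib_left)
      also have "\<dots> = C v j" using y(2)[OF that] c0 by simp
      also have "\<dots> = (\<Sum>i\<in>I. z v i * C i j)" using z v that I by auto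
      finally show ?thesis by (simp add: left_diff_distrib sum_subtractf)
    qed
    then have "\<forall>i\<in>I. z v i - y i = 0"
      using I(2)[unfolded rows_independent_def, THEN spec[of _ "\<lambda>i. z v i - y i"]] by blast
    then show ?thesis using y(1)[of i] i by auto
  qed
  have ain: "a v \<alpha> \<in> field_gen S" if v: "v \<in> V" and \<alpha>: "\<alpha> < k" for v \<alpha>
  proof (cases "\<alpha> \<in> B")
    case True
    then show ?thesis using v by (intro field_gen.gen) (force simp: S_def)
  next
    case False
    have \<xi>in: "\<xi> \<alpha> \<beta> \<in> field_gen S" if "\<beta> \<in> B" for \<beta>
      using that \<alpha> False by (intro field_gen.gen) (force simp: S_def)
    have aB: "a u \<beta> \<in> field_gen S" if "\<beta> \<in> B" "u \<in> V" for u \<beta>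
      using that by (intro field_gen.gen) (force simp: S_def)
    have "a v \<alpha> = (\<Sum>i\<in>I. z v i * (a i \<alpha> - (\<Sum>\<beta>\<in>B. \<xi> \<alpha> \<beta> * a i \<beta>))) + (\<Sum>\<beta>\<in>B. \<xi> \<alpha> \<beta> * a v \<beta>)"
      using \<xi>[OF v \<alpha>] by simp
    also have "\<dots> \<in> field_gen S"
      using v \<alpha> I(1)
      by (intro subfield_add[OF F] subfield_sum[OF F] subfield_mult[OF F] subfield_diff[OF F] zin \<xi>in aB aI) auto
    finally show ?thesis .
  qed
  have "card (V \<times> {..<k}) \<le> card S"
    using finS _ gen by (rule alg_indep_card_le) (use finV ain in auto)
  also have "\<dots> \<le> card (V \<times> B) + card (?K \<times> B) + card (I \<times> ?K) + card P"
    unfolding S_def using finV finI finB P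
    by (intro order_trans[OF card_Un_le] add_mono card_image_le) auto
  also have "\<dots> = card V * card B + (k - card B) * card B + card I * (k - card B) + card P"
    using B finB by (simp add: card_cartesian_product card_Diff_subset)
  finally show ?thesis by (simp add: card_cartesian_product)
qed

text \<open>To be read with \<open>n = card V\<close>, \<open>h = k - card B\<close>,
  \<open>\<rho> = card I\<close>, \<open>q\<close> the number of entries kept after scaling one to
  1, and \<open>t\<close> the number of symmetric pairs inside \<open>I\<close>. The excluded case
  is the only one in which these inequalities are consistent.\<close>

lemma count_contradiction:
  fixes n k h \<rho> \<Delta> q t :: int
  assumes "2 * \<Delta> + 2 * k \<le> n + 2" "n * h \<le> h * (k - h) + \<rho> * h + q" "q + 1 + t \<le> \<rho> * \<Delta>"
    "\<rho> \<le> 2 * t" "\<rho> \<le> 2 * h" "1 \<le> \<rho>" "h \<le> k" "0 \<le> \<Delta>" "\<not> (h = k \<and> \<rho> = 2 * k)"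
  shows False
proof -
  have h: "1 \<le> h" using assms by linarith
  have "(2 * \<Delta> + 2 * k - 2) * h \<le> n * h" using assms h by (intro mult_right_mono) auto
  then have 1: "2 * ((2 * \<Delta> + 2 * k - 2) * h) \<le> 2 * (h * (k - h)) + 2 * (\<rho> * h) + 2 * (\<rho> * \<Delta>) - 2 - \<rho>"
    using assms by linarith
  have 2: "2 * (\<rho> * h) + 2 * (\<rho> * \<Delta>) - \<rho> = \<rho> * (2 * h + 2 * \<Delta> - 1)" by (simp add: algebra_simps)
  show False
  proof (cases "h = k")
    case True
    then have "\<rho> \<le> 2 * k - 1" using assms by linarith
    then have "\<rho> * (2 * h + 2 * \<Delta> - 1) \<le> (2 * k - 1) * (2 * h + 2 * \<Delta> - 1)"
      using assms h by (intro mult_right_mono) auto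
    then show False using 1 2 True assms(8) by (simp add: algebra_simps)
  next
    case False
    then have "h + 1 \<le> k" using assms by linarith
    then have "(h + 1) * h \<le> k * h" using h by (intro mult_right_mono) auto
    moreover have "\<rho> * (2 * h + 2 * \<Delta> - 1) \<le> (2 * h) * (2 * h + 2 * \<Delta> - 1)"
      using assms h by (intro mult_right_mono) auto
    ultimately show False using 1 2 by (simp add: algebra_simps)
  qed
qed

text \<open>In full rank, scaling and symmetry leave a slack of up to \<open>k - 1\<close>. Saving
  \<open>k\<close> further entries, the extra summand in the third hypothesis, turns it into a
  deficit of one.\<close>

lemma count_contradiction_full_rank:
  fixes n k \<Delta> q t :: int
  assumes "2 * \<Delta> + 2 * k \<le> n + 2" "n * k \<le> 2 * k * k + q" "q + 1 + k + t \<le> 2 * k * \<Delta>"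
    "k \<le> t" "1 \<le> k"
  shows False
proof -
  have "(2 * \<Delta> + 2 * k - 2) * k \<le> n * k" using assms by (intro mult_right_mono) auto
  then show False using assms by (simp add: algebra_simps)
qed

text \<open>For a maximal independent set \<open>M\<close>, vertices outside have a neighbour in
  \<open>M\<close> by maximality, and vertices of \<open>M\<close> have one outside as none is
  isolated. One of the two sets has at least \<open>k\<close> elements, and shrinking it keeps
  outside neighbours outside.\<close>

lemma large_set_with_outside_neighbours:
  fixes adj :: "'v \<Rightarrow> 'v \<Rightarrow> bool"
  assumes "finite I" "card I = 2 * k"
    and nbr: "\<And>i. i \<in> I \<Longrightarrow> \<exists>j\<in>I. adj i j"
    and irr: "\<And>i. i \<in> I \<Longrightarrow> \<not> adj i i"
    and sym: "\<And>i j. i \<in> I \<Longrightarrow> j \<in> I \<Longrightarrow> adj i j \<Longrightarrow> adj j i"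
  obtains R where "R \<subseteq> I" "card R = k" "\<And>s. s \<in> R \<Longrightarrow> \<exists>j\<in>I - R. adj s j"
proof -
  let ?P = "\<lambda>M. M \<subseteq> I \<and> (\<forall>i\<in>M. \<forall>j\<in>M. \<not> adj i j)"
  have "?P {}" by simp
  moreover have "\<forall>M. ?P M \<longrightarrow> card M < Suc (card I)"
    using assms(1) by (auto intro: card_mono less_Suc_eq_le[THEN iffD2])
  ultimately obtain M where M: "?P M" and max: "\<And>M'. ?P M' \<Longrightarrow> card M' \<le> card M"
    using ex_has_greatest_nat[of ?P "{}" card "Suc (card I)"] by blast
  have finM: "finite M" using M assms(1) finite_subset by blast
  have out: "\<exists>j\<in>M. adj i j" if i: "i \<in> I - M" for i
  proof (rule ccontr)
    assume no: "\<not> ?thesis"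
    then have "?P (insert i M)" using i M irr sym by blast
    then have "card (insert i M) \<le> card M" by (rule max)
    then show False using i finM by simp
  qed
  have M_out: "\<exists>j\<in>I - M. adj i j" if "i \<in> M" for i
    using nbr[of i] that M by blast
  have "card I = card M + card (I - M)"
    using M assms(1) by (metis card_Diff_subset card_mono finM le_add_diff_inverse)
  then have "k \<le> card M \<or> k \<le> card (I - M)" using assms(2) by linarith
  then obtain Q where Q: "Q \<subseteq> I" "k \<le> card Q" "\<And>i. i \<in> Q \<Longrightarrow> \<exists>j\<in>I - Q. adj i j"
    using M M_out out by (metis Diff_subset Diff_Diff_Int inf.absorb_iff2)
  obtain R where R: "R \<subseteq> Q" "card R = k"
    using obtain_subset_with_card_n[OF Q(2)] by blast
  have "\<exists>j\<in>I - R. adj s j" if "s \<in> R" for s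
    using Q(3)[of s] R that by blast
  moreover have "R \<subseteq> I" using R Q by blast
  ultimately show ?thesis using R that by blast
qed

text \<open>When \<open>C\<close> has full rank \<open>2 * k\<close>, the parameter count alone falls just short; vanishing on one dependency
  supported on \<open>insert s J\<close> expresses the entry \<open>C s j0\<close> through the others and saves one parameter for
  each \<open>s\<close>.\<close>

lemma strain_form_eliminate_entry:
  assumes gen: "alg_indep (V \<times> {..<k}) (\<lambda>(v, \<alpha>). a v \<alpha>)" and finV: "finite V"
    and C: "strain_form V E k a C"
    and J: "J \<subseteq> V" "card J = k" and s: "s \<in> V" "s \<notin> J" and j0: "j0 \<in> J"
    and F: "subfield_of_reals F" "\<And>i \<alpha>. i \<in> insert s J \<Longrightarrow> \<alpha> < k \<Longrightarrow> a i \<alpha> \<in> F"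
    and J_entries: "\<And>i j. i \<in> J \<Longrightarrow> j \<in> J \<Longrightarrow> C i j / \<gamma> \<in> F"
    and s_entries: "\<And>j. j \<in> J \<Longrightarrow> j \<noteq> j0 \<Longrightarrow> C s j / \<gamma> \<in> F"
  shows "C s j0 / \<gamma> \<in> F"
    and "(\<And>i j. i \<in> J \<Longrightarrow> j \<in> J \<Longrightarrow> C i j = 0) \<Longrightarrow> (\<And>j. j \<in> J \<Longrightarrow> j \<noteq> j0 \<Longrightarrow> C s j = 0) \<Longrightarrow> C s j0 = 0"
proof -
  have finJ: "finite J" using J finV finite_subset by blast
  have "\<exists>y. (\<forall>i. y i \<in> F) \<and> (\<forall>\<alpha>\<in>{..<k}. (\<Sum>i\<in>J. y i * a i \<alpha>) = a s \<alpha>)"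
  proof (rule square_system_solvable[OF F(1)])
    fix x assume "\<And>i. i \<in> J \<Longrightarrow> (\<Sum>j<k. a i j * x j) = 0"
    then show "\<forall>j\<in>{..<k}. x j = 0"
      using generic_rows_injective[OF gen finV J, of x] by blast
  qed (use finJ J F in auto)
  then obtain r where rF: "\<And>i. r i \<in> F" and r: "\<And>\<alpha>. \<alpha> < k \<Longrightarrow> (\<Sum>i\<in>J. r i * a i \<alpha>) = a s \<alpha>"
    by auto
  \<comment> \<open>The eliminated entry must really occur in the relation. Otherwise the row of
    \<open>s\<close> would lie in the span of only \<open>k - 1\<close> other rows.\<close>
  have "r j0 \<noteq> 0"
  proof
    assume r0: "r j0 = 0"
    have "a s \<alpha> = (\<Sum>j\<in>J - {j0}. r j * a j \<alpha>)" if "\<alpha> < k" for \<alpha>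
      using r[OF that] r0 finJ j0 by (subst (asm) sum.remove[of J j0]) auto
    moreover have "card (J - {j0}) < k" using J j0 finJ by (metis card_Diff1_less)
    ultimately show False
      using generic_row_not_in_span[OF gen finV, of "J - {j0}" s r] J s by blast
  qed
  define y where "y v = (if v = s then 1 else if v \<in> J then - r v else 0)" for v
  have ysum: "(\<Sum>v\<in>V. y v * g v) = g s - (\<Sum>j\<in>J. r j * g j)" for g
    unfolding y_def by (rule sum_unit_minus_combination[OF finV s(1) J(1) s(2)])
  have "dependency V k a y" using r by (simp add: dependency_def ysum)
  then have "(\<Sum>u\<in>V. \<Sum>v\<in>V. y u * C u v * y v) = 0" using C by (auto simp: strain_form_def)
  also have "(\<Sum>u\<in>V. \<Sum>v\<in>V. y u * C u v * y v) = (\<Sum>u\<in>V. y u * (\<Sum>v\<in>V. y v * C u v))"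
    by (simp add: sum_distrib_left mult_ac)
  also have "\<dots> = (C s s - (\<Sum>j\<in>J. r j * C s j)) - (\<Sum>i\<in>J. r i * (C i s - (\<Sum>j\<in>J. r j * C i j)))"
    by (simp add: ysum)
  also have "(\<Sum>i\<in>J. r i * (C i s - (\<Sum>j\<in>J. r j * C i j)))
      = (\<Sum>j\<in>J. r j * C s j) - (\<Sum>i\<in>J. \<Sum>j\<in>J. r i * r j * C i j)"
  proof -
    have "C i s = C s i" if "i \<in> J" for i using C J s that by (auto simp: strain_form_def subset_iff)
    then show ?thesis by (simp add: right_diff_distrib sum_subtractf sum_distrib_left mult_ac)
  qed
  also have "C s s = 0" using C s by (auto simp: strain_form_def)
  finally have "2 * (\<Sum>j\<in>J. r j * C s j) = (\<Sum>i\<in>J. \<Sum>j\<in>J. r i * r j * C i j)" by simp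
  \<comment> \<open>The quadratic form at \<open>y\<close> is linear in the entries of row
    \<open>s\<close>, so the one at \<open>j0\<close> can be isolated.\<close>
  then have "2 * r j0 * C s j0 = (\<Sum>i\<in>J. \<Sum>j\<in>J. r i * r j * C i j) - 2 * (\<Sum>j\<in>J - {j0}. r j * C s j)"
    using finJ j0 by (subst (asm) sum.remove[of J j0]) auto
  then have eq: "C s j0 = ((\<Sum>i\<in>J. \<Sum>j\<in>J. r i * r j * C i j) - 2 * (\<Sum>j\<in>J - {j0}. r j * C s j)) / (2 * r j0)"
    using \<open>r j0 \<noteq> 0\<close> by (simp add: field_simps)
  show "C s j0 = 0"
    if "\<And>i j. i \<in> J \<Longrightarrow> j \<in> J \<Longrightarrow> C i j = 0" "\<And>j. j \<in> J \<Longrightarrow> j \<noteq> j0 \<Longrightarrow> C s j = 0"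
  proof -
    have "(\<Sum>i\<in>J. \<Sum>j\<in>J. r i * r j * C i j) = 0" "(\<Sum>j\<in>J - {j0}. r j * C s j) = 0"
      using that by (auto intro!: sum.neutral)
    then show ?thesis using eq by simp
  qed
  have "C s j0 / \<gamma> = ((\<Sum>i\<in>J. \<Sum>j\<in>J. r i * r j * (C i j / \<gamma>))
      - of_nat 2 * (\<Sum>j\<in>J - {j0}. r j * (C s j / \<gamma>))) / (of_nat 2 * r j0)"
    unfolding eq by (simp add: sum_divide_distrib diff_divide_distrib mult_ac)
  also have "\<dots> \<in> F"
    by (intro subfield_divide[OF F(1)] subfield_diff[OF F(1)] subfield_mult[OF F(1)] subfield_sum[OF F(1)]
        subfield_of_nat[OF F(1)] rF J_entries s_entries) auto
  finally show "C s j0 / \<gamma> \<in> F" .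
qed

text \<open>The linear order on the vertices serves to select one of the two positions of each
  symmetric entry inside \<open>I\<close>.\<close>

theorem generic_strain_rigid:
  fixes V :: "'v::linorder set"
  assumes gen: "alg_indep (V \<times> {..<k}) (\<lambda>(v, \<alpha>). a v \<alpha>)" and finV: "finite V" and k: "k \<ge> 1"
    and \<Delta>: "\<And>v. v \<in> V \<Longrightarrow> card {u \<in> V. u \<noteq> v \<and> {u, v} \<notin> E} \<le> \<Delta>"
    and bound: "2 * \<Delta> + 2 * k \<le> card V + 2"
  shows "strain_rigid V E k a"
  unfolding strain_rigid_def
proof (intro allI impI, rule ccontr)
  fix C assume C: "strain_form V E k a C" and "\<not> (\<forall>u\<in>V. \<forall>v\<in>V. C u v = 0)"
  then obtain u0 v0 where uv0: "u0 \<in> V" "v0 \<in> V" "C u0 v0 \<noteq> 0" by blast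
  have sym: "C u v = C v u" if "u \<in> V" "v \<in> V" for u v
    using C that by (auto simp: strain_form_def)
  have diag: "C v v = 0" if "v \<in> V" for v
    using C that by (auto simp: strain_form_def)
  obtain I z where I: "I \<subseteq> V" "rows_independent I I C"
    and z: "\<And>u v. u \<in> V \<Longrightarrow> v \<in> V \<Longrightarrow> C u v = (\<Sum>i\<in>I. z u i * C i v)"
      "\<And>i j. i \<in> I \<Longrightarrow> j \<in> I \<Longrightarrow> z i j = (if i = j then 1 else 0 :: real)"
    by (rule strain_form_row_basis[OF finV C]) (rule that)
  obtain B \<xi> where B: "B \<subseteq> {..<k}" and rank: "card I \<le> 2 * (k - card B)"
    and \<xi>: "\<And>v \<kappa>. v \<in> V \<Longrightarrow> \<kappa> < k \<Longrightarrow> a v \<kappa> - (\<Sum>\<beta>\<in>B. \<xi> \<kappa> \<beta> * a v \<beta>)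
        = (\<Sum>i\<in>I. z v i * (a i \<kappa> - (\<Sum>\<beta>\<in>B. \<xi> \<kappa> \<beta> * a i \<beta>)))"
  proof (rule strain_form_column_space[OF finV C I])
    show "C u v = (\<Sum>i\<in>I. z u i * C i v)" if "u \<in> V" "v \<in> V" for u v using z(1) that .
    show "z i j = (if i = j then 1 else 0)" if "i \<in> I" "j \<in> I" for i j using z(2) that .
  qed (rule that)
  note count = generic_strain_form_count[OF gen finV C I z(1) B \<xi>]
  have finI: "finite I" using I finV finite_subset by blast
  have finB: "finite B" using B finite_subset by blast
  have cardB: "card B \<le> k" using card_mono[OF _ B] by simp
  have "I \<noteq> {}" using z(1)[OF uv0(1,2)] uv0(3) by auto
  have nbr: "\<exists>j\<in>I. C i j \<noteq> 0" if "i \<in> I" for i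
  proof (rule ccontr)
    assume no: "\<not> ?thesis"
    have "(\<Sum>j\<in>I. (if j = i then 1 else 0) * C j w) = 0" if "w \<in> I" for w
      using no that \<open>i \<in> I\<close> by (intro sum.neutral) auto
    from rows_independentD[OF I(2) this \<open>i \<in> I\<close>] show False by simp
  qed
  \<comment> \<open>\<open>P\<close> lists the nonzero entries in the rows of \<open>I\<close> up to
    symmetry. Those in \<open>T\<close> occupy two positions each, so \<open>card P + card T\<close>
    counts positions, at most \<Delta> in each row.\<close>
  define P where "P = {(i, v) \<in> I \<times> V. C i v \<noteq> 0 \<and> (v \<in> I \<longrightarrow> i < v)}"
  define T where "T = {(i, j) \<in> I \<times> I. C i j \<noteq> 0 \<and> i < j}"
  define T' where "T' = {(i, j) \<in> I \<times> I. C i j \<noteq> 0 \<and> j < i}"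
  define Q where "Q = {(i, v) \<in> I \<times> V. C i v \<noteq> 0}"
  have fin: "finite P" "finite T" "finite T'" "finite Q"
    using finite_subset[of _ "I \<times> V"] finI finV I(1) unfolding P_def T_def T'_def Q_def
    by (auto intro: finite_subset[of _ "I \<times> V"])
  have "card T' = card T"
  proof (rule bij_betw_same_card[of prod.swap])
    show "bij_betw prod.swap T' T"
      by (rule bij_betw_byWitness[of _ prod.swap]) (use sym I(1) in \<open>auto simp: T_def T'_def subset_iff\<close>)
  qed
  have "Q = P \<union> T'"
  proof (intro equalityI subsetI)
    fix e assume "e \<in> Q"
    then obtain i v where e: "e = (i, v)" "i \<in> I" "v \<in> V" "C i v \<noteq> 0" by (auto simp: Q_def)
    then have "i \<noteq> v" using diag by auto
    then show "e \<in> P \<union> T'" using e by (cases "v \<in> I") (auto simp: P_def T'_def not_less_iff_gr_or_eq)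
  qed (use I(1) in \<open>auto simp: P_def T'_def Q_def\<close>)
  then have cardQ: "card Q = card P + card T"
    using fin \<open>card T' = card T\<close> by (simp add: card_Un_disjoint P_def T'_def disjoint_iff less_imp_not_less)
  have "card Q \<le> card I * \<Delta>"
  proof -
    have "Q = (SIGMA i:I. {v \<in> V. C i v \<noteq> 0})" by (auto simp: Q_def)
    then have "card Q = (\<Sum>i\<in>I. card {v \<in> V. C i v \<noteq> 0})" using finI finV by simp
    also have "\<dots> \<le> (\<Sum>i\<in>I. \<Delta>)"
    proof (rule sum_mono)
      fix i assume i: "i \<in> I"
      have sub: "{v \<in> V. C i v \<noteq> 0} \<subseteq> {u \<in> V. u \<noteq> i \<and> {u, i} \<notin> E}"
        using i I(1) C diag by (auto simp: strain_form_def insert_commute)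
      then show "card {v \<in> V. C i v \<noteq> 0} \<le> \<Delta>"
        using \<Delta>[of i] card_mono[OF _ sub] i I(1) finV by auto
    qed
    finally show ?thesis by simp
  qed
  then have PT: "card P + card T \<le> card I * \<Delta>" using cardQ by simp
  \<comment> \<open>No row of the nonsingular block on \<open>I\<close> vanishes, so every index of
    \<open>I\<close> is an end of some pair in \<open>T\<close>.\<close>
  have IT: "card I \<le> 2 * card T"
  proof -
    have "I \<subseteq> fst ` (T \<union> T')"
    proof
      fix i assume i: "i \<in> I"
      obtain j where j: "j \<in> I" "C i j \<noteq> 0" using nbr[OF i] by blast
      then have "i \<noteq> j" using diag i I(1) by auto
      then have "(i, j) \<in> T \<union> T'" using i j by (auto simp: T_def T'_def)
      then show "i \<in> fst ` (T \<union> T')" by force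
    qed
    then have "card I \<le> card (fst ` (T \<union> T'))" using fin by (intro card_mono) auto
    also have "\<dots> \<le> card (T \<union> T')" using fin by (intro card_image_le) auto
    also have "\<dots> \<le> card T + card T'" by (rule card_Un_le)
    finally show ?thesis using \<open>card T' = card T\<close> by simp
  qed
  have cases: "C i v / c0 \<in> F"
    if "subfield_of_reals F" "i \<in> I" "v \<in> V" "\<And>i v. (i, v) \<in> P \<Longrightarrow> C i v / c0 \<in> F" for F i v c0
  proof -
    have "C i v = 0 \<or> (i, v) \<in> P \<or> (v, i) \<in> P"
      using that(2,3) I(1) sym[of i v] diag[of i]
      by (auto simp: P_def subset_iff not_less_iff_gr_or_eq)
    then show ?thesis
      using that(4)[of i v] that(4)[of v i] sym[of i v] that I(1) subfield_0[OF that(1)] by auto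
  qed
  have card1: "1 \<le> card I" using \<open>I \<noteq> {}\<close> finI by (simp add: Suc_leI card_gt_0_iff)
  show False
  proof (cases "card B = 0 \<and> card I = 2 * k")
    case False
    obtain i j where ij: "i \<in> I" "j \<in> I" "C i j \<noteq> 0" using nbr \<open>I \<noteq> {}\<close> by blast
    then have "(i, j) \<in> P \<or> (j, i) \<in> P"
      using sym[of i j] diag[of i] I(1) by (auto simp: P_def subset_iff not_less_iff_gr_or_eq)
    then have "P \<noteq> {}" by blast
    \<comment> \<open>This entry is scaled to 1, which saves one parameter.\<close>
    then obtain i0 v1 where e0: "(i0, v1) \<in> P" by auto
    have "card V * k \<le> card V * card B + (k - card B) * card B + card I * (k - card B) + card (P - {(i0, v1)})"
    proof (rule count[of "C i0 v1"])
      show "C i0 v1 \<noteq> 0" using e0 by (auto simp: P_def)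
      fix F i v assume F: "subfield_of_reals F"
        and PF: "\<And>i j. (i, j) \<in> P - {(i0, v1)} \<Longrightarrow> C i j / C i0 v1 \<in> F" and iv: "i \<in> I" "v \<in> V"
      show "C i v / C i0 v1 \<in> F"
      proof (rule cases[OF F iv])
        fix i v assume "(i, v) \<in> P"
        then show "C i v / C i0 v1 \<in> F"
          using PF[of i v] subfield_1[OF F] e0 by (cases "(i, v) = (i0, v1)") (auto simp: P_def)
      qed
    qed (use fin in auto)
    moreover have "card (P - {(i0, v1)}) + 1 = card P" using e0 fin by (metis Suc_eq_plus1 card_Suc_Diff1)
    ultimately have
      "int (card V) * int k \<le> int (card V) * int (card B) + (int k - int (card B)) * int (card B)
        + int (card I) * (int k - int (card B)) + int (card (P - {(i0, v1)}))"
      using cardB by (metis (mono_tags) of_nat_add of_nat_diff of_nat_le_iff of_nat_mult)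
    then show False
      using \<open>card (P - {(i0, v1)}) + 1 = card P\<close> PT IT rank card1 cardB bound False k
      by (intro count_contradiction[of "int \<Delta>" "int k" "int (card V)" "int k - int (card B)" "int (card I)"
            "int (card (P - {(i0, v1)}))" "int (card T)"])
         (auto simp: algebra_simps simp flip: of_nat_add of_nat_mult)
  next
    case True
    then have [simp]: "B = {}" using finB by auto
    have cardI: "card I = 2 * k" using True by simp
    obtain R where R: "R \<subseteq> I" "card R = k" and R_out: "\<And>s. s \<in> R \<Longrightarrow> \<exists>j\<in>I - R. C s j \<noteq> 0"
    proof (rule large_set_with_outside_neighbours[of I k "\<lambda>i j. C i j \<noteq> 0"])
      show "\<exists>j\<in>I. C i j \<noteq> 0" if "i \<in> I" for i using nbr that .
      show "\<not> C i i \<noteq> 0" if "i \<in> I" for i using diag that I by auto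
      show "C j i \<noteq> 0" if "i \<in> I" "j \<in> I" "C i j \<noteq> 0" for i j
        using that sym[of i j] subsetD[OF I(1)] by simp
    qed (use finI cardI in auto)
    \<comment> \<open>For each \<open>s\<close> in \<open>R\<close> the entry at \<open>f s\<close>
      will be eliminated by a dependency on \<open>s\<close> and the \<open>k\<close> rows of
      \<open>I - R\<close>. Such a dependency involves just one row from \<open>R\<close>, so the
      eliminations do not interfere.\<close>
    obtain f where f: "\<And>s. s \<in> R \<Longrightarrow> f s \<in> I - R \<and> C s (f s) \<noteq> 0" using R_out by metis
    let ?J = "I - R"
    have finR: "finite R" using R finI finite_subset by blast
    have cardJ: "card ?J = k" using R finR cardI by (simp add: card_Diff_subset)
    \<comment> \<open>The position by which \<open>P\<close> represents the entry at
      \<open>s\<close> and \<open>f s\<close>. Only one of the two lies in \<open>R\<close>, so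
      different \<open>s\<close> give different positions.\<close>
    define e where "e s = (min s (f s), max s (f s))" for s
    have e_eq: "e s = e s' \<Longrightarrow> s = s'" if "s \<in> R" "s' \<in> R" for s s'
      using f[OF that(1)] f[OF that(2)] that
      by (auto simp: e_def min_def max_def split: if_splits)
    have eR: "e ` R \<subseteq> P"
    proof
      fix p assume "p \<in> e ` R"
      then obtain s where s: "s \<in> R" "p = e s" by blast
      have "s \<in> V" "f s \<in> V" using f[OF s(1)] s R I(1) by auto
      then have "C (f s) s \<noteq> 0" using f[OF s(1)] sym[of s "f s"] by simp
      then show "p \<in> P" using f[OF s(1)] s R I(1)
        by (auto simp: e_def P_def min_def max_def subset_iff less_le)
    qed
    have card_eR: "card (e ` R) = k" using R(2) e_eq by (simp add: card_image inj_on_def)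
    have not_chosen: "(i, j) \<notin> e ` R" if "i \<in> ?J" "j \<in> ?J" for i j
      using that by (auto simp: e_def min_def max_def split: if_splits)
    have chosen_unique: "j = f s" if sj: "s \<in> R" "j \<in> ?J" "(s, j) \<in> e ` R \<or> (j, s) \<in> e ` R" for s j
    proof -
      obtain s' where "s' \<in> R" "e s' = (s, j) \<or> e s' = (j, s)" using sj(3) by force
      then show ?thesis using sj(1,2) f[of s'] by (auto simp: e_def min_def max_def split: if_splits)
    qed
    define P' where "P' = P - e ` R"
    have inP': "C i j = 0 \<or> (i, j) \<in> P' \<or> (j, i) \<in> P'"
      if "i \<in> ?J \<and> j \<in> ?J \<or> i \<in> R \<and> j \<in> ?J \<and> j \<noteq> f i" for i j
    proof -
      have "i \<in> I" "j \<in> I" using that R by auto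
      then have "C i j = 0 \<or> (i, j) \<in> P \<or> (j, i) \<in> P"
        using I(1) sym[of i j] diag[of i] by (auto simp: P_def subset_iff not_less_iff_gr_or_eq)
      moreover have "(i, j) \<notin> e ` R \<and> (j, i) \<notin> e ` R"
        using that not_chosen chosen_unique by metis
      ultimately show ?thesis by (auto simp: P'_def)
    qed
    note eliminate = strain_form_eliminate_entry[OF gen finV C _ cardJ]
    \<comment> \<open>An entry for scaling must survive the elimination. If none did, the relation
      for one \<open>s\<close> would have \<open>C s (f s)\<close> as its sole possibly nonzero
      entry and force it to vanish.\<close>
    have "P' \<noteq> {}"
    proof
      assume "P' = {}"
      have "R \<noteq> {}" using R(2) k by auto
      then obtain s where s: "s \<in> R" by blast
      have "C s (f s) = 0"
      proof (rule eliminate(2)[where F = UNIV and \<gamma> = 1])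
        show "C i j = 0" if "i \<in> ?J" "j \<in> ?J" for i j using inP'[of i j] that \<open>P' = {}\<close> by blast
        show "C s j = 0" if "j \<in> ?J" "j \<noteq> f s" for j using inP'[of s j] that \<open>P' = {}\<close> s by blast
      qed (use f[OF s] s R I(1) subfield_UNIV in auto)
      then show False using f s by blast
    qed
    then obtain i0 v1 where e0: "(i0, v1) \<in> P'" by auto
    then have c0: "C i0 v1 \<noteq> 0" by (auto simp: P'_def P_def)
    have "card V * k \<le> card V * card B + (k - card B) * card B + card I * (k - card B) + card (P' - {(i0, v1)})"
    proof (rule count[of "C i0 v1"])
      show "C i0 v1 \<noteq> 0" by (rule c0)
      fix F i v assume F: "subfield_of_reals F" and aF: "\<And>i \<alpha>. i \<in> I \<Longrightarrow> \<alpha> < k \<Longrightarrow> a i \<alpha> \<in> F"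
        and PF: "\<And>i j. (i, j) \<in> P' - {(i0, v1)} \<Longrightarrow> C i j / C i0 v1 \<in> F" and iv: "i \<in> I" "v \<in> V"
      have P'F: "C i j / C i0 v1 \<in> F" if "(i, j) \<in> P'" for i j
        using PF[of i j] that subfield_1[OF F] c0 by (cases "(i, j) = (i0, v1)") auto
      have inF: "C i j / C i0 v1 \<in> F"
        if "i \<in> ?J \<and> j \<in> ?J \<or> i \<in> R \<and> j \<in> ?J \<and> j \<noteq> f i" for i j
      proof -
        have "C i j = C j i" using that R I(1) by (intro sym) auto
        then show ?thesis using inP'[OF that] P'F[of i j] P'F[of j i] subfield_0[OF F] by auto
      qed
      have chosen: "C s (f s) / C i0 v1 \<in> F" if s: "s \<in> R" for s
        by (rule eliminate(1)) (use f[OF s] s R I(1) F aF inF in auto)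
      show "C i v / C i0 v1 \<in> F"
      proof (rule cases[OF F iv])
        fix i v assume iv: "(i, v) \<in> P"
        show "C i v / C i0 v1 \<in> F"
        proof (cases "(i, v) \<in> e ` R")
          case True
          then obtain s where s: "s \<in> R" "(i, v) = e s" by auto
          have "C s (f s) = C (f s) s" using f[OF s(1)] s R I(1) by (intro sym) auto
          then have "C i v = C s (f s)"
            using s(2) by (auto simp: e_def min_def max_def split: if_splits)
          then show ?thesis using chosen[OF s(1)] by simp
        next
          case False
          then show ?thesis using P'F iv by (auto simp: P'_def)
        qed
      qed
    qed (use fin in \<open>auto simp: P'_def\<close>)
    then have "card V * k \<le> 2 * k * k + card (P' - {(i0, v1)})" using cardI by simp
    moreover have "card P' + k = card P"
      using eR fin card_eR card_mono[OF fin(1) eR] by (simp add: P'_def card_Diff_subset finR)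
    moreover have "card (P' - {(i0, v1)}) + 1 = card P'"
      using e0 fin by (metis P'_def Suc_eq_plus1 card_Suc_Diff1 finite_Diff)
    ultimately show False
      using PT IT cardI bound k
        of_nat_le_iff[of "card V * k" "2 * k * k + card (P' - {(i0, v1)})", where ?'a = int]
        of_nat_le_iff[of "card P + card T" "2 * k * \<Delta>", where ?'a = int]
      by (intro count_contradiction_full_rank[of "int \<Delta>" "int k" "int (card V)"
            "int (card (P' - {(i0, v1)}))" "int (card T)"])
         simp_all
  qed
qed

section \<open>Giant components in joined bipartite graphs\<close>

definition edge_closed :: "'v set set \<Rightarrow> 'v set \<Rightarrow> 'v set \<Rightarrow> 'v set \<Rightarrow> bool" where
  "edge_closed E X Y S \<longleftrightarrow> S \<subseteq> X \<union> Y \<and> (\<forall>x\<in>X. \<forall>y\<in>Y. {x, y} \<in> E \<longrightarrow> (x \<in> S \<longleftrightarrow> y \<in> S))"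

text \<open>Edge-closed sets are unions of components, and this is the intersection of all large
  ones. The description avoids paths; that it is itself large and behaves as connected is shown in
  \<open>giant_large\<close> and \<open>giant_constant\<close>.\<close>

definition giant :: "'v set set \<Rightarrow> nat \<Rightarrow> 'v set \<Rightarrow> 'v set \<Rightarrow> 'v set" where
  "giant E \<kappa> X Y = {u \<in> X \<union> Y. \<forall>S. edge_closed E X Y S \<longrightarrow> card (X - S) < \<kappa> \<longrightarrow> card (Y - S) < \<kappa> \<longrightarrow> u \<in> S}"

definition joined :: "'v set set \<Rightarrow> nat \<Rightarrow> 'v set \<Rightarrow> 'v set \<Rightarrow> bool" where
  "joined E \<kappa> X Y \<longleftrightarrow> (\<forall>A B. A \<subseteq> X \<longrightarrow> B \<subseteq> Y \<longrightarrow> card A = \<kappa> \<longrightarrow> card B = \<kappa> \<longrightarrow>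
     (\<exists>x\<in>A. \<exists>y\<in>B. {x, y} \<in> E))"

lemma joined_subset: "joined E \<kappa> X Y \<Longrightarrow> X' \<subseteq> X \<Longrightarrow> Y' \<subseteq> Y \<Longrightarrow> joined E \<kappa> X' Y'"
  by (simp add: joined_def)

lemma joined_large:
  assumes "joined E \<kappa> X Y" "A \<subseteq> X" "B \<subseteq> Y" "\<kappa> \<le> card A" "\<kappa> \<le> card B"
  shows "\<exists>x\<in>A. \<exists>y\<in>B. {x, y} \<in> E"
proof -
  obtain A' B' where "A' \<subseteq> A" "card A' = \<kappa>" "B' \<subseteq> B" "card B' = \<kappa>"
    using assms by (meson obtain_subset_with_card_n)
  moreover from this have "A' \<subseteq> X" "B' \<subseteq> Y" using assms by auto
  ultimately have "\<exists>x\<in>A'. \<exists>y\<in>B'. {x, y} \<in> E" using assms(1) unfolding joined_def by blast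
  then show ?thesis using \<open>A' \<subseteq> A\<close> \<open>B' \<subseteq> B\<close> by blast
qed

lemma giant_subset: "giant E \<kappa> X Y \<subseteq> X \<union> Y"
  by (auto simp: giant_def)

lemma giant_closed:
  assumes "x \<in> X" "y \<in> Y" "{x, y} \<in> E"
  shows "x \<in> giant E \<kappa> X Y \<longleftrightarrow> y \<in> giant E \<kappa> X Y"
  using assms unfolding giant_def edge_closed_def by blast

text \<open>A large closed set of the bigger graph restricts to a large closed set of the smaller
  one, so the smaller intersection is the more restrictive.\<close>

lemma giant_mono:
  assumes "finite X" "finite Y" "X' \<subseteq> X" "Y' \<subseteq> Y"
  shows "giant E \<kappa> X' Y' \<subseteq> giant E \<kappa> X Y"
proof
  fix u assume u: "u \<in> giant E \<kappa> X' Y'"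
  show "u \<in> giant E \<kappa> X Y"
    unfolding giant_def
  proof (intro CollectI conjI allI impI)
    show "u \<in> X \<union> Y" using subsetD[OF giant_subset u] assms by blast
    fix S assume S: "edge_closed E X Y S" "card (X - S) < \<kappa>" "card (Y - S) < \<kappa>"
    let ?S = "S \<inter> (X' \<union> Y')"
    have "edge_closed E X' Y' ?S" using S(1) assms unfolding edge_closed_def by blast
    moreover have "card (X' - ?S) \<le> card (X - S)" "card (Y' - ?S) \<le> card (Y - S)"
      using assms by (auto intro!: card_mono)
    then have "card (X' - ?S) < \<kappa>" "card (Y' - ?S) < \<kappa>" using S(2,3) by linarith+
    ultimately have "u \<in> ?S" using u unfolding giant_def mem_Collect_eq by blast
    then show "u \<in> S" by blast
  qed
qed

context
  fixes E :: "'v set set" and \<kappa> :: nat and X Y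
  assumes fin: "finite X" "finite Y" and j: "joined E \<kappa> X Y"
    and size: "3 * \<kappa> \<le> card X + 2" "3 * \<kappa> \<le> card Y + 2" and \<kappa>: "\<kappa> \<ge> 1"
begin

text \<open>No edge joins \<open>X \<inter> S\<close> to \<open>Y - S\<close>, so one of them is
  small, and likewise for \<open>X - S\<close> and \<open>Y \<inter> S\<close>. The size bounds
  forbid that both parts of one side are small.\<close>

lemma edge_closed_dichotomy:
  assumes "edge_closed E X Y S"
  shows "card (X - S) < \<kappa> \<and> card (Y - S) < \<kappa> \<or> card (X \<inter> S) < \<kappa> \<and> card (Y \<inter> S) < \<kappa>"
proof -
  have 1: "card (X \<inter> S) < \<kappa> \<or> card (Y - S) < \<kappa>"
  proof (rule ccontr)
    assume "\<not> ?thesis"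
    then have "\<exists>x\<in>X \<inter> S. \<exists>y\<in>Y - S. {x, y} \<in> E" by (intro joined_large[OF j]) auto
    then show False using assms by (auto simp: edge_closed_def)
  qed
  have 2: "card (X - S) < \<kappa> \<or> card (Y \<inter> S) < \<kappa>"
  proof (rule ccontr)
    assume "\<not> ?thesis"
    then have "\<exists>x\<in>X - S. \<exists>y\<in>Y \<inter> S. {x, y} \<in> E" by (intro joined_large[OF j]) auto
    then show False using assms by (auto simp: edge_closed_def)
  qed
  have "card X = card (X \<inter> S) + card (X - S)" "card Y = card (Y \<inter> S) + card (Y - S)"
    using fin by (metis card_Int_Diff add.commute)+
  then show ?thesis using 1 2 size \<kappa> by linarith
qed

text \<open>Two large closed sets together miss at most \<open>2 * (\<kappa> - 1)\<close> vertices
  of \<open>X\<close>, so at least \<kappa> of the \<open>3 * \<kappa> - 2\<close> lie in both, and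
  the dichotomy makes their intersection large. This is the origin of the constant 3.\<close>

lemma giant_large: "card (X - giant E \<kappa> X Y) < \<kappa>" "card (Y - giant E \<kappa> X Y) < \<kappa>"
proof -
  define \<S> where "\<S> = {S. edge_closed E X Y S \<and> card (X - S) < \<kappa> \<and> card (Y - S) < \<kappa>}"
  have "\<S> \<subseteq> Pow (X \<union> Y)" by (auto simp: \<S>_def edge_closed_def)
  then have "finite \<S>" using fin finite_subset by (metis finite_Pow_iff finite_UnI)
  have inter: "S \<inter> T \<in> \<S>" if "S \<in> \<S>" "T \<in> \<S>" for S T
  proof -
    have ec: "edge_closed E X Y (S \<inter> T)" using that unfolding \<S>_def edge_closed_def by blast
    have "card (X - (S \<inter> T)) \<le> card (X - S) + card (X - T)"
      by (metis Diff_Int card_Un_le)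
    moreover have "card X = card (X \<inter> (S \<inter> T)) + card (X - (S \<inter> T))"
      using fin by (metis card_Int_Diff)
    ultimately have "\<not> card (X \<inter> (S \<inter> T)) < \<kappa>" using that size \<kappa> by (simp add: \<S>_def)
    then show ?thesis using edge_closed_dichotomy[OF ec] ec by (auto simp: \<S>_def)
  qed
  have whole: "X \<union> Y \<in> \<S>"
  proof -
    have "card (X - (X \<union> Y)) = 0" "card (Y - (X \<union> Y)) = 0"
      by (metis Diff_cancel Diff_eq_empty_iff card.empty sup_ge1, metis Diff_eq_empty_iff card.empty sup_ge2)
    then show ?thesis using \<kappa> unfolding \<S>_def edge_closed_def by auto
  qed
  have "\<T> \<subseteq> \<S> \<Longrightarrow> (X \<union> Y) \<inter> \<Inter>\<T> \<in> \<S>" if "finite \<T>" for \<T>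
    using that
  proof (induction \<T> rule: finite_induct)
    case (insert S \<T>)
    then have "S \<in> \<S>" "(X \<union> Y) \<inter> \<Inter>\<T> \<in> \<S>" by simp_all
    then have "S \<inter> ((X \<union> Y) \<inter> \<Inter>\<T>) \<in> \<S>" by (rule inter)
    moreover have "S \<inter> ((X \<union> Y) \<inter> \<Inter>\<T>) = (X \<union> Y) \<inter> \<Inter>(insert S \<T>)" by blast
    ultimately show ?case by simp
  qed (use whole in simp)
  from this[OF \<open>finite \<S>\<close> order_refl] have "(X \<union> Y) \<inter> \<Inter>\<S> \<in> \<S>" .
  also have "(X \<union> Y) \<inter> \<Inter>\<S> = giant E \<kappa> X Y" by (auto simp: giant_def \<S>_def)
  finally show "card (X - giant E \<kappa> X Y) < \<kappa>" "card (Y - giant E \<kappa> X Y) < \<kappa>"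
    by (auto simp: \<S>_def)
qed

text \<open>A level set of \<open>g\<close> and its complement are both closed; one of them is large
  and contains the whole giant.\<close>

lemma giant_constant:
  assumes "\<And>x y. x \<in> X \<Longrightarrow> y \<in> Y \<Longrightarrow> {x, y} \<in> E \<Longrightarrow> g x = g y"
    and "u \<in> giant E \<kappa> X Y" "v \<in> giant E \<kappa> X Y"
  shows "g u = g v"
proof (rule ccontr)
  assume ne: "g u \<noteq> g v"
  let ?L = "{w \<in> X \<union> Y. g w = g u}" and ?N = "{w \<in> X \<union> Y. g w \<noteq> g u}"
  have "edge_closed E X Y ?L" "edge_closed E X Y ?N" using assms(1) by (auto simp: edge_closed_def)
  moreover have "X \<inter> ?L = X - ?N" "Y \<inter> ?L = Y - ?N" by auto
  ultimately have "v \<in> ?L \<or> u \<in> ?N"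
    using edge_closed_dichotomy[of ?L] assms(2,3) unfolding giant_def
    by (smt (verit, best) mem_Collect_eq)
  then show False using ne by auto
qed

end

section \<open>Deleting badly attached vertices from the clusters\<close>

lemma sum_card_swap:
  assumes "finite A" "finite B"
  shows "(\<Sum>x\<in>A. card {y \<in> B. P x y}) = (\<Sum>y\<in>B. card {x \<in> A. P x y})"
proof -
  have "card {y \<in> B. P x y} = (\<Sum>y\<in>B. if P x y then 1 else 0)" for x
    using assms by (simp add: sum.If_cases Int_def)
  moreover have "card {x \<in> A. P x y} = (\<Sum>x\<in>A. if P x y then 1 else 0)" for y
    using assms by (simp add: sum.If_cases Int_def)
  ultimately show ?thesis by (simp add: sum.swap[of _ A B])
qed

locale cluster_graph =
  fixes E :: "'v set set" and \<kappa> d :: nat and M :: "'i set" and Vs :: "'i \<Rightarrow> 'v set"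
    and nbrs :: "'i \<Rightarrow> 'i set"
  assumes finM: "finite M" and finV: "\<And>i. i \<in> M \<Longrightarrow> finite (Vs i)"
    and disj: "disjoint_family_on Vs M" and \<kappa>: "\<kappa> \<ge> 1"
    and nbrs: "\<And>i. nbrs i \<subseteq> M - {i}"
    and nbrs_joined: "\<And>i j. i \<in> M \<Longrightarrow> j \<in> nbrs i \<Longrightarrow> joined E \<kappa> (Vs i) (Vs j)"
    and size: "\<And>i. i \<in> M \<Longrightarrow> 7 * \<kappa> \<le> card (Vs i) + 2"
    and degree: "\<And>i. i \<in> M \<Longrightarrow> card M + 2 * d \<le> 2 * card (nbrs i) + 2"
begin

abbreviation G :: "'v set \<Rightarrow> 'i \<Rightarrow> 'i \<Rightarrow> 'v set" where
  "G W i j \<equiv> giant E \<kappa> (Vs i \<inter> W) (Vs j \<inter> W)"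

text \<open>Pairs of a removed vertex and a neighbouring cluster in whose giant it has no neighbour
  are counted twice. Each removed vertex lies in at least \<open>card M / 4\<close> pairs, each
  cluster in fewer than \<kappa>, since \<kappa> vertices would see the at least \<kappa> giant
  vertices there. This improves the assumed bound by one.\<close>

lemma removed_bound:
  assumes few: "\<And>i. i \<in> M \<Longrightarrow> card (Vs i - W) \<le> 4 * (\<kappa> - 1) + 1"
    and i: "i \<in> M"
    and rem: "\<And>u. u \<in> Vs i - W \<Longrightarrow> card M \<le> 4 * card {j \<in> nbrs i. \<forall>y\<in>G W i j \<inter> Vs j. {u, y} \<notin> E}"
  shows "card (Vs i - W) \<le> 4 * (\<kappa> - 1)"
proof -
  let ?R = "Vs i - W"
  have finN: "finite (nbrs i)" using nbrs finM finite_subset by blast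
  \<comment> \<open>At least \<open>7 * \<kappa> - 2\<close> vertices minus
    \<open>4 * \<kappa> - 3\<close> removed ones.\<close>
  have large: "3 * \<kappa> \<le> card (Vs j \<inter> W) + 2" if "j \<in> M" for j
  proof -
    have "card (Vs j) = card (Vs j \<inter> W) + card (Vs j - W)" using finV that by (metis card_Int_Diff)
    then show ?thesis using few[OF that] size[OF that] \<kappa> by linarith
  qed
  have col: "card {u \<in> ?R. \<forall>y\<in>G W i j \<inter> Vs j. {u, y} \<notin> E} \<le> \<kappa> - 1" if j: "j \<in> nbrs i" for j
  proof (rule ccontr)
    let ?A = "{u \<in> ?R. \<forall>y\<in>G W i j \<inter> Vs j. {u, y} \<notin> E}" and ?B = "G W i j \<inter> Vs j"
    assume "\<not> ?thesis"
    then have A: "\<kappa> \<le> card ?A" by simp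
    have jM: "j \<in> M" using j nbrs by blast
    have "card (Vs j \<inter> W - G W i j) < \<kappa>"
      using finV[OF i] finV[OF jM] joined_subset[OF nbrs_joined[OF i j]] large[OF i] large[OF jM] \<kappa>
      by (intro giant_large) auto
    moreover have "card (Vs j \<inter> W) \<le> card ?B + card (Vs j \<inter> W - G W i j)"
    proof -
      have "card (Vs j \<inter> W) \<le> card (?B \<union> (Vs j \<inter> W - G W i j))"
        using finV[OF jM] by (intro card_mono) auto
      then show ?thesis using card_Un_le le_trans by blast
    qed
    ultimately have "\<kappa> \<le> card ?B" using large[OF jM] \<kappa> by linarith
    then have "\<exists>x\<in>?A. \<exists>y\<in>?B. {x, y} \<in> E"
      using A by (intro joined_large[OF nbrs_joined[OF i j]]) auto
    then show False by auto
  qed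
  have "card ?R * card M = (\<Sum>u\<in>?R. card M)" by simp
  also have "\<dots> \<le> (\<Sum>u\<in>?R. 4 * card {j \<in> nbrs i. \<forall>y\<in>G W i j \<inter> Vs j. {u, y} \<notin> E})"
    by (intro sum_mono rem)
  also have "\<dots> = 4 * (\<Sum>u\<in>?R. card {j \<in> nbrs i. \<forall>y\<in>G W i j \<inter> Vs j. {u, y} \<notin> E})"
    by (simp add: sum_distrib_left)
  also have "\<dots> = 4 * (\<Sum>j\<in>nbrs i. card {u \<in> ?R. \<forall>y\<in>G W i j \<inter> Vs j. {u, y} \<notin> E})"
    using finV[OF i] finN by (subst sum_card_swap) auto
  also have "\<dots> \<le> 4 * (\<Sum>j\<in>nbrs i. \<kappa> - 1)"
    by (intro mult_left_mono sum_mono col) auto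
  also have "\<dots> = 4 * (\<kappa> - 1) * card (nbrs i)" by simp
  also have "\<dots> \<le> 4 * (\<kappa> - 1) * card M"
    using nbrs[of i] finM by (intro mult_left_mono card_mono) auto
  finally show ?thesis using i finM by (auto simp: card_gt_0_iff)
qed

text \<open>Vertices lying outside too many giant components are deleted one at a time.  Giant components only
  shrink, so the deleted vertices keep lacking neighbours in them, which bounds the number of deletions
  by \<open>removed_bound\<close>.\<close>

lemma peeling:
  obtains W where "W \<subseteq> (\<Union>i\<in>M. Vs i)" "\<And>i. i \<in> M \<Longrightarrow> card (Vs i - W) \<le> 4 * (\<kappa> - 1)"
    "\<And>i u. i \<in> M \<Longrightarrow> u \<in> Vs i \<inter> W \<Longrightarrow> 2 * card {j \<in> nbrs i. u \<notin> G W i j} + d \<le> card (nbrs i)"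
proof -
  define V where "V = (\<Union>i\<in>M. Vs i)"
  have finVV: "finite V" using finM finV by (simp add: V_def)
  \<comment> \<open>The order of deletions is not recorded; it suffices that every deleted vertex
    still lacks neighbours in many giants. A set \<open>W\<close> of least size with this property
    is where the process stops.\<close>
  define Inv where "Inv W \<longleftrightarrow> W \<subseteq> V \<and> (\<forall>i\<in>M. card (Vs i - W) \<le> 4 * (\<kappa> - 1) \<and>
     (\<forall>u\<in>Vs i - W. card M \<le> 4 * card {j \<in> nbrs i. \<forall>y\<in>G W i j \<inter> Vs j. {u, y} \<notin> E}))" for W
  have "Vs i - V = {}" if "i \<in> M" for i using that by (auto simp: V_def)
  then have "Inv V" unfolding Inv_def by (metis card.empty empty_iff order_refl zero_le)
  then obtain W where W: "Inv W" and min: "\<And>W'. Inv W' \<Longrightarrow> card W \<le> card W'"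
    using ex_has_least_nat[of Inv V card] by blast
  have "2 * card {j \<in> nbrs i. u \<notin> G W i j} + d \<le> card (nbrs i)" if i: "i \<in> M" and u: "u \<in> Vs i \<inter> W" for i u
  proof (rule ccontr)
    assume "\<not> ?thesis"
    \<comment> \<open>With \<open>b\<close> missed giants among \<open>N\<close> neighbours,
      \<open>2 * b \<ge> N - d + 1\<close>, hence
      \<open>4 * b \<ge> 2 * N - 2 * d + 2 \<ge> card M\<close> by \<open>degree\<close>.\<close>
    then have bad: "card M \<le> 4 * card {j \<in> nbrs i. u \<notin> G W i j}" using degree[OF i] by linarith
    define W' where "W' = W - {u}"
    have mono: "G W' i' j \<subseteq> G W i' j" if "i' \<in> M" "j \<in> M" for i' j
      using finV that by (intro giant_mono) (auto simp: W'_def)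
    have rem: "card M \<le> 4 * card {j \<in> nbrs i'. \<forall>y\<in>G W' i' j \<inter> Vs j. {u', y} \<notin> E}"
      if i': "i' \<in> M" and u': "u' \<in> Vs i' - W'" for i' u'
    proof (cases "u' = u")
      case True
      then have [simp]: "i' = i" using u u' i i' disj unfolding disjoint_family_on_def by auto
      have "{j \<in> nbrs i. u \<notin> G W i j} \<subseteq> {j \<in> nbrs i. \<forall>y\<in>G W' i j \<inter> Vs j. {u, y} \<notin> E}"
      proof safe
        fix j y assume j: "j \<in> nbrs i" "u \<notin> G W i j" and y: "y \<in> G W' i j" "y \<in> Vs j" "{u, y} \<in> E"
        have jM: "j \<in> M" using j nbrs by blast
        have "y \<in> G W i j" using mono[OF i jM] y by blast
        moreover have "y \<in> Vs j \<inter> W" using y giant_subset by (fastforce simp: W'_def)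
        ultimately show False using giant_closed[of u "Vs i \<inter> W" y "Vs j \<inter> W" E] u y j by blast
      qed
      then have "card {j \<in> nbrs i. u \<notin> G W i j} \<le> card {j \<in> nbrs i. \<forall>y\<in>G W' i j \<inter> Vs j. {u, y} \<notin> E}"
        using nbrs[of i] finM by (intro card_mono) (auto intro: finite_subset)
      then show ?thesis using bad True by simp
    next
      case False
      then have "u' \<in> Vs i' - W" using u' by (auto simp: W'_def)
      then have "card M \<le> 4 * card {j \<in> nbrs i'. \<forall>y\<in>G W i' j \<inter> Vs j. {u', y} \<notin> E}"
        using W i' by (auto simp: Inv_def)
      also have "\<dots> \<le> 4 * card {j \<in> nbrs i'. \<forall>y\<in>G W' i' j \<inter> Vs j. {u', y} \<notin> E}"
      proof (intro mult_left_mono card_mono)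
        show "finite {j \<in> nbrs i'. \<forall>y\<in>G W' i' j \<inter> Vs j. {u', y} \<notin> E}"
          using nbrs[of i'] finM by (auto intro: finite_subset)
        show "{j \<in> nbrs i'. \<forall>y\<in>G W i' j \<inter> Vs j. {u', y} \<notin> E} \<subseteq> {j \<in> nbrs i'. \<forall>y\<in>G W' i' j \<inter> Vs j. {u', y} \<notin> E}"
          using mono[OF i'] nbrs[of i'] by blast
      qed simp
      finally show ?thesis .
    qed
    \<comment> \<open>Deleting \<open>u\<close> may exceed the invariant by one, which
      \<open>removed_bound\<close> wins back.\<close>
    have few: "card (Vs i' - W') \<le> 4 * (\<kappa> - 1) + 1" if "i' \<in> M" for i'
    proof -
      have "card (Vs i' - W') \<le> card (insert u (Vs i' - W))"
        using finV that by (intro card_mono) (auto simp: W'_def)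
      also have "\<dots> \<le> card (Vs i' - W) + 1" by (simp add: card_insert_le_m1 card_insert_if finV that)
      finally show ?thesis using W that by (fastforce simp: Inv_def)
    qed
    have "Inv W'"
      unfolding Inv_def using W rem removed_bound[of W', OF few] by (auto simp: Inv_def W'_def)
    then have "card W \<le> card W'" by (rule min)
    moreover have "card W' < card W"
      using u W finVV unfolding W'_def Inv_def by (intro card_Diff1_less) (auto intro: finite_subset)
    ultimately show False by simp
  qed
  then show ?thesis using W that[of W] by (auto simp: Inv_def V_def)
qed

end

text \<open>Coincident vertices \<open>u\<close> and \<open>u'\<close> give a dependency, against
  which \<open>C\<close> yields the difference \<gamma> of their rows. It annihilates all
  dependencies, so it is a linear function of the position. It vanishes on their own cluster and on
  the \<open>k - 1\<close> clusters whose giants contain both; these positions span, so \<gamma> is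
  zero. Hence \<open>C\<close> is constant on clusters and descends to the reduced graph.\<close>

lemma strain_rigid_blowup:
  fixes E :: "'v set set" and E0 :: "'i set set" and Us :: "'i \<Rightarrow> 'v set" and cls :: "'v \<Rightarrow> 'i"
  assumes finM: "finite M" and finU: "\<And>i. i \<in> M \<Longrightarrow> finite (Us i)"
    and cls: "\<And>i u. i \<in> M \<Longrightarrow> u \<in> Us i \<Longrightarrow> cls u = i"
    and \<kappa>: "\<kappa> \<ge> 1" and size: "\<And>i. i \<in> M \<Longrightarrow> 3 * \<kappa> \<le> card (Us i) + 2"
    and nbrs: "\<And>i. nbrs i \<subseteq> M - {i}"
    and nbrs_joined: "\<And>i j. i \<in> M \<Longrightarrow> j \<in> nbrs i \<Longrightarrow> joined E \<kappa> (Us i) (Us j)"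
    and nonempty: "\<And>i. i \<in> M \<Longrightarrow> \<kappa> \<le> card (Us i)"
    and link: "\<And>i u u'. i \<in> M \<Longrightarrow> u \<in> Us i \<Longrightarrow> u' \<in> Us i \<Longrightarrow>
        k \<le> card {j \<in> nbrs i. u \<in> giant E \<kappa> (Us i) (Us j) \<and> u' \<in> giant E \<kappa> (Us i) (Us j)} + 1"
    and inj: "\<And>J x. J \<subseteq> M \<Longrightarrow> card J = k \<Longrightarrow> (\<And>j. j \<in> J \<Longrightarrow> (\<Sum>\<alpha><k. a j \<alpha> * x \<alpha>) = 0) \<Longrightarrow> \<forall>\<alpha><k. x \<alpha> = 0"
    and k: "k \<ge> 1"
    and E0: "\<And>i j. i \<in> M \<Longrightarrow> j \<in> M \<Longrightarrow> {i, j} \<in> E0 \<Longrightarrow> i = j \<or> j \<in> nbrs i"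
    and rigid: "strain_rigid M E0 k a"
  shows "strain_rigid (\<Union>i\<in>M. Us i) E k (\<lambda>u. a (cls u))"
  unfolding strain_rigid_def
proof (intro allI impI)
  define W where "W = (\<Union>i\<in>M. Us i)"
  fix C assume "strain_form (\<Union>i\<in>M. Us i) E k (\<lambda>u. a (cls u)) C"
  then have C: "strain_form W E k (\<lambda>u. a (cls u)) C" by (simp add: W_def)
  have finW: "finite W" using finM finU by (simp add: W_def)
  have UW: "u \<in> W" if "i \<in> M" "u \<in> Us i" for i u using that by (auto simp: W_def)
  have clsW: "cls u \<in> M" "u \<in> Us (cls u)" if "u \<in> W" for u using that cls by (auto simp: W_def)
  have sym: "C u v = C v u" if "u \<in> W" "v \<in> W" for u v
    using C that by (auto simp: strain_form_def)
  have diag: "C v v = 0" if "v \<in> W" for v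
    using C that by (auto simp: strain_form_def)
  have edge0: "C u v = 0" if "u \<in> W" "v \<in> W" "{u, v} \<in> E" for u v
    using C that by (auto simp: strain_form_def)
  have iso: "(\<Sum>u\<in>W. y u * (\<Sum>v\<in>W. z v * C u v)) = 0"
    if "dependency W k (\<lambda>u. a (cls u)) y" "dependency W k (\<lambda>u. a (cls u)) z" for y z
  proof -
    have "(\<Sum>u\<in>W. \<Sum>v\<in>W. y u * C u v * z v) = 0" using C that by (auto simp: strain_form_def)
    then show ?thesis by (simp add: sum_distrib_left mult_ac)
  qed
  define unit where "unit s J r v = (if v = s then 1 else if v \<in> J then - r v else (0::real))"
    for s J v and r :: "'v \<Rightarrow> real"
  have unit_sum: "(\<Sum>v\<in>W. unit s J r v * g v) = g s - (\<Sum>j\<in>J. r j * g j)"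
    if "s \<in> W" "J \<subseteq> W" "s \<notin> J" for s J r and g :: "'v \<Rightarrow> real"
    unfolding unit_def by (rule sum_unit_minus_combination[OF finW that])
  have unit_dep: "dependency W k (\<lambda>u. a (cls u)) (unit s J r)"
    if "s \<in> W" "J \<subseteq> W" "s \<notin> J" "\<And>\<alpha>. \<alpha> < k \<Longrightarrow> a (cls s) \<alpha> = (\<Sum>j\<in>J. r j * a (cls j) \<alpha>)" for s J r
    using that by (simp add: dependency_def unit_sum)
  have row_eq: "C u w = C u' w"
    if i: "i \<in> M" and u: "u \<in> Us i" and u': "u' \<in> Us i" and w: "w \<in> W" for i u u' w
  proof (cases "u = u'")
    case False
    have uW: "u \<in> W" "u' \<in> W" using UW i u u' by auto
    have cl: "cls u = i" "cls u' = i" using cls i u u' by auto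
    define \<gamma> where "\<gamma> x = C u x - C u' x" for x
    have pair: "dependency W k (\<lambda>u. a (cls u)) (unit u {u'} (\<lambda>_. 1))"
      using False uW cl by (intro unit_dep) auto
    have dep\<gamma>: "(\<Sum>x\<in>W. y x * \<gamma> x) = 0" if "dependency W k (\<lambda>u. a (cls u)) y" for y
    proof -
      have "(\<Sum>x\<in>W. y x * \<gamma> x) = (\<Sum>x\<in>W. y x * (\<Sum>v\<in>W. unit u {u'} (\<lambda>_. 1) v * C x v))"
        using False uW sym by (intro sum.cong refl) (simp add: unit_sum \<gamma>_def)
      also have "\<dots> = 0" by (rule iso[OF that pair])
      finally show ?thesis .
    qed
    \<comment> \<open>Symmetry and the zero diagonal make these two values opposite, while the
      dependency makes them equal.\<close>
    have "\<gamma> u - \<gamma> u' = 0" using dep\<gamma>[OF pair] False uW by (simp add: unit_sum)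
    moreover have "\<gamma> u = - C u u'" "\<gamma> u' = C u u'" using uW diag sym[of u u'] by (auto simp: \<gamma>_def)
    ultimately have \<gamma>u: "\<gamma> u = 0" by simp
    have \<gamma>i: "\<gamma> x = 0" if "x \<in> Us i" for x
    proof (cases "x = u")
      case False
      have "dependency W k (\<lambda>u. a (cls u)) (unit x {u} (\<lambda>_. 1))"
        using False uW cl that i cls UW by (intro unit_dep) auto
      from dep\<gamma>[OF this] show ?thesis using False uW UW[OF i that] \<gamma>u by (simp add: unit_sum)
    qed (use \<gamma>u in simp)
    define Gd where "Gd = {j \<in> nbrs i. u \<in> giant E \<kappa> (Us i) (Us j) \<and> u' \<in> giant E \<kappa> (Us i) (Us j)}"
    have \<gamma>j: "\<gamma> v = 0" if j: "j \<in> Gd" and v: "v \<in> Us j" for j v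
    proof -
      have jn: "j \<in> nbrs i" using j by (simp add: Gd_def)
      then have jM: "j \<in> M" "j \<noteq> i" using nbrs by auto
      \<comment> \<open>Testing \<open>C\<close> against two coincident pairs gives
        \<open>C x y - C x v = C u y - C u v\<close>. Along an edge \<open>C x y = 0\<close>, so
        \<open>g\<close> takes equal values at both ends and is constant on the giant; at
        \<open>u\<close> and \<open>u'\<close> it is the two entries to be compared.\<close>
      define g where "g x = (if x \<in> Us i then C x v else C u v - C u x)" for x
      have rect: "C x y - C x v - C u y + C u v = 0" if x: "x \<in> Us i" and y: "y \<in> Us j" for x y
      proof (cases "x = u \<or> y = v")
        case False
        have xy: "x \<in> W" "y \<in> W" "v \<in> W" using x y v i jM UW by auto
        have 1: "dependency W k (\<lambda>u. a (cls u)) (unit x {u} (\<lambda>_. 1))"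
          using False uW cl x i cls xy by (intro unit_dep) auto
        have 2: "dependency W k (\<lambda>u. a (cls u)) (unit y {v} (\<lambda>_. 1))"
          using False xy y v jM cls by (intro unit_dep) auto
        have "(\<Sum>p\<in>W. unit x {u} (\<lambda>_. 1) p * (\<Sum>q\<in>W. unit y {v} (\<lambda>_. 1) q * C p q)) = 0"
          by (rule iso[OF 1 2])
        then show ?thesis using False xy uW by (simp add: unit_sum)
      qed auto
      have "g u = g u'"
      proof (rule giant_constant[of "Us i" "Us j" E \<kappa>])
        show "u \<in> giant E \<kappa> (Us i) (Us j)" "u' \<in> giant E \<kappa> (Us i) (Us j)" using j by (auto simp: Gd_def)
        fix x y assume x: "x \<in> Us i" and y: "y \<in> Us j" and "{x, y} \<in> E"
        then have "C x y = 0" using UW i jM by (intro edge0) auto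
        moreover have "y \<notin> Us i" using cls[OF i, of y] cls[OF jM(1) y] jM by auto
        ultimately show "g x = g y" using rect[OF x y] x by (simp add: g_def)
      qed (use i jM jn finU size nbrs_joined \<kappa> in auto)
      then show ?thesis using u u' by (simp add: g_def \<gamma>_def)
    qed
    have finGd: "finite Gd" using nbrs[of i] finM by (auto simp: Gd_def intro: finite_subset)
    have "k - 1 \<le> card Gd" using link[OF i u u'] by (simp add: Gd_def)
    then obtain L0 where L0: "L0 \<subseteq> Gd" "card L0 = k - 1" using obtain_subset_with_card_n by metis
    \<comment> \<open>The own cluster is the \<open>k\<close>-th one, which explains the
      \<open>+ 1\<close> in \<open>link\<close>.\<close>
    define L where "L = insert i L0"
    have "i \<notin> Gd" using nbrs[of i] by (auto simp: Gd_def)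
    then have cardL: "card L = k" using L0 finGd k by (auto simp: L_def card_insert_if finite_subset)
    have LM: "L \<subseteq> M" using i L0 nbrs[of i] by (auto simp: L_def Gd_def)
    have finL: "finite L" using LM finM finite_subset by blast
    have \<gamma>L: "\<gamma> x = 0" if "l \<in> L" "x \<in> Us l" for l x
      using that \<gamma>i \<gamma>j L0 by (auto simp: L_def)
    have "\<gamma> w = 0"
    proof (cases "cls w \<in> L")
      case True
      then show ?thesis using \<gamma>L clsW[OF w] by blast
    next
      case False
      define rep where "rep l = (SOME x. x \<in> Us l)" for l
      have rep: "rep l \<in> Us l" if "l \<in> L" for l
      proof -
        have "card (Us l) \<noteq> 0" using nonempty[of l] \<kappa> LM that by auto
        then have "Us l \<noteq> {}" by force
        then have "\<exists>x. x \<in> Us l" by blast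
        then show ?thesis unfolding rep_def by (rule someI_ex)
      qed
      have "\<exists>y. (\<forall>i. y i \<in> UNIV) \<and> (\<forall>\<alpha>\<in>{..<k}. (\<Sum>l\<in>L. y l * a l \<alpha>) = a (cls w) \<alpha>)"
      proof (rule square_system_solvable[OF subfield_UNIV])
        fix x assume "\<And>l. l \<in> L \<Longrightarrow> (\<Sum>j<k. a l j * x j) = 0"
        then show "\<forall>j\<in>{..<k}. x j = 0" using inj[OF LM cardL, of x] by blast
      qed (use finL cardL in auto)
      then obtain r where r: "\<And>\<alpha>. \<alpha> < k \<Longrightarrow> (\<Sum>l\<in>L. r l * a l \<alpha>) = a (cls w) \<alpha>" by auto
      have clsrep: "cls (rep l) = l" if "l \<in> L" for l using rep[OF that] cls LM that by blast
      have injrep: "inj_on rep L" using clsrep by (metis inj_onI)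
      have J: "rep ` L \<subseteq> W" using rep LM UW by blast
      have wJ: "w \<notin> rep ` L" using False clsrep by auto
      have sumJ: "(\<Sum>v\<in>rep ` L. r (cls v) * f v) = (\<Sum>l\<in>L. r l * f (rep l))" for f
        using injrep clsrep by (simp add: sum.reindex)
      have "dependency W k (\<lambda>u. a (cls u)) (unit w (rep ` L) (\<lambda>v. r (cls v)))"
      proof (rule unit_dep[OF w J wJ])
        fix \<alpha> assume "\<alpha> < k"
        have "(\<Sum>l\<in>L. r l * a (cls (rep l)) \<alpha>) = (\<Sum>l\<in>L. r l * a l \<alpha>)" using clsrep by simp
        then show "a (cls w) \<alpha> = (\<Sum>j\<in>rep ` L. r (cls j) * a (cls j) \<alpha>)"
          unfolding sumJ using r[OF \<open>\<alpha> < k\<close>] by simp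
      qed
      from dep\<gamma>[OF this] have "\<gamma> w = (\<Sum>l\<in>L. r l * \<gamma> (rep l))"
        by (simp add: unit_sum[OF w J wJ] sumJ)
      also have "\<dots> = 0" using \<gamma>L rep by (intro sum.neutral) auto
      finally show ?thesis .
    qed
    then show ?thesis by (simp add: \<gamma>_def)
  qed simp
  define rep where "rep l = (SOME x. x \<in> Us l)" for l
  have rep: "rep l \<in> Us l" if "l \<in> M" for l
  proof -
    have "card (Us l) \<noteq> 0" using nonempty[of l] \<kappa> that by auto
    then have "Us l \<noteq> {}" by force
    then have "\<exists>x. x \<in> Us l" by blast
    then show ?thesis unfolding rep_def by (rule someI_ex)
  qed
  have repW: "rep l \<in> W" if "l \<in> M" for l using rep UW that by blast
  have clsrep: "cls (rep l) = l" if "l \<in> M" for l using rep cls that by blast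
  have injrep: "inj_on rep M" using clsrep by (metis inj_onI)
  define C0 where "C0 i j = C (rep i) (rep j)" for i j
  have Crep: "C u v = C0 (cls u) (cls v)" if "u \<in> W" "v \<in> W" for u v
  proof -
    have "C u v = C (rep (cls u)) v" using row_eq clsW rep that by metis
    also have "\<dots> = C v (rep (cls u))" using sym repW clsW that by metis
    also have "\<dots> = C (rep (cls v)) (rep (cls u))" using row_eq clsW rep repW that by metis
    also have "\<dots> = C0 (cls u) (cls v)" using sym repW clsW that by (metis C0_def)
    finally show ?thesis .
  qed
  have "strain_form M E0 k a C0"
    unfolding strain_form_def
  proof (intro conjI ballI impI allI)
    show "C0 i j = C0 j i" if "i \<in> M" "j \<in> M" for i j using sym repW that by (simp add: C0_def)
    show "C0 i i = 0" if "i \<in> M" for i using diag repW that by (simp add: C0_def)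
    show "C0 i j = 0" if ij: "i \<in> M" "j \<in> M" "{i, j} \<in> E0" for i j
    proof (cases "i = j")
      case True
      then show ?thesis using diag repW ij by (simp add: C0_def)
    next
      case False
      then have "j \<in> nbrs i" using E0 ij by blast
      \<comment> \<open>One actual edge between the two clusters suffices, as \<open>C\<close> has
        the same value on all pairs between them.\<close>
      then obtain x y where "x \<in> Us i" "y \<in> Us j" "{x, y} \<in> E"
        using joined_large[OF nbrs_joined[OF ij(1)], of j "Us i" "Us j"] nonempty ij by blast
      then show ?thesis using Crep[of x y] edge0[of x y] UW cls ij by metis
    qed
    fix y z assume yz: "dependency M k a y" "dependency M k a z"
    \<comment> \<open>A dependency of cluster points is placed on one representative per
      cluster.\<close>
    define ext where "ext y v = (if v \<in> rep ` M then y (cls v) else (0::real))" for y v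
    have ext_sum: "(\<Sum>v\<in>W. ext y v * f v) = (\<Sum>l\<in>M. y l * f (rep l))" for y and f :: "'v \<Rightarrow> real"
    proof -
      have "(\<Sum>v\<in>W. ext y v * f v) = (\<Sum>v\<in>rep ` M. ext y v * f v)"
        using finW repW by (intro sum.mono_neutral_right) (auto simp: ext_def)
      also have "\<dots> = (\<Sum>l\<in>M. y l * f (rep l))"
        using injrep clsrep by (simp add: sum.reindex ext_def)
      finally show ?thesis .
    qed
    have "dependency W k (\<lambda>u. a (cls u)) (ext y)" if "dependency M k a y" for y
      using that clsrep by (simp add: dependency_def ext_sum)
    then have "(\<Sum>u\<in>W. ext y u * (\<Sum>v\<in>W. ext z v * C u v)) = 0" using yz by (intro iso) auto
    then show "(\<Sum>u\<in>M. \<Sum>v\<in>M. y u * C0 u v * z v) = 0"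
      unfolding ext_sum by (simp add: C0_def sum_distrib_left mult_ac)
  qed
  then have "\<forall>i\<in>M. \<forall>j\<in>M. C0 i j = 0" using rigid by (auto simp: strain_rigid_def)
  then show "\<forall>u\<in>\<Union>i\<in>M. Us i. \<forall>v\<in>\<Union>i\<in>M. Us i. C u v = 0"
    using Crep clsW(1) unfolding W_def by metis
qed

section \<open>Openness and rigidity\<close>

lemma strain_rigid_cong_dependency:
  assumes "\<And>y. dependency V k a y \<longleftrightarrow> dependency V k' b y"
  shows "strain_rigid V E k a \<longleftrightarrow> strain_rigid V E k' b"
  using assms by (simp add: strain_rigid_def strain_form_def)

text \<open>Projective invariance: weights absorb the factors \<open>s\<close>, and \<open>C\<close>
  is scaled by them on both sides. It turns generic vectors into homogeneous coordinates with first
  entry 1.\<close>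

lemma strain_rigid_rescale:
  assumes s: "\<And>v. v \<in> V \<Longrightarrow> s v \<noteq> 0" and rigid: "strain_rigid V E k a"
  shows "strain_rigid V E k (\<lambda>v \<alpha>. a v \<alpha> / s v)"
  unfolding strain_rigid_def
proof (intro allI impI)
  fix C assume C: "strain_form V E k (\<lambda>v \<alpha>. a v \<alpha> / s v) C"
  have dep: "dependency V k (\<lambda>v \<alpha>. a v \<alpha> / s v) (\<lambda>v. y v * s v)" if "dependency V k a y" for y
  proof -
    have "(\<Sum>v\<in>V. y v * s v * (a v \<alpha> / s v)) = (\<Sum>v\<in>V. y v * a v \<alpha>)" for \<alpha>
      using s by (intro sum.cong) auto
    then show ?thesis using that by (simp add: dependency_def)
  qed
  have "strain_form V E k a (\<lambda>u v. s u * C u v * s v)"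
    unfolding strain_form_def
  proof (intro conjI ballI impI allI)
    fix y z assume "dependency V k a y" "dependency V k a z"
    then have "(\<Sum>u\<in>V. \<Sum>v\<in>V. (y u * s u) * C u v * (z v * s v)) = 0"
      using C dep unfolding strain_form_def by blast
    then show "(\<Sum>u\<in>V. \<Sum>v\<in>V. y u * (s u * C u v * s v) * z v) = 0" by (simp add: mult_ac)
  qed (use C in \<open>auto simp: strain_form_def mult_ac\<close>)
  then have "\<forall>u\<in>V. \<forall>v\<in>V. s u * C u v * s v = 0" using rigid unfolding strain_rigid_def by blast
  then show "\<forall>u\<in>V. \<forall>v\<in>V. C u v = 0" using s by auto
qed

text \<open>Given a column relation with \<open>c w0 \<noteq> 0\<close>, a nonzero row combination
  vanishing in all columns but \<open>w0\<close> exists by counting equations; the relation makes it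
  vanish at \<open>w0\<close> too.\<close>

lemma rows_independent_transpose:
  assumes "finite X" "finite W" "card X = card W" "rows_independent W X M"
  shows "rows_independent X W (\<lambda>w x. M x w)"
  unfolding rows_independent_def
proof (intro allI impI, rule ccontr)
  fix c assume c: "\<forall>x\<in>X. (\<Sum>w\<in>W. c w * M x w) = 0" and "\<not> (\<forall>w\<in>W. c w = 0)"
  then obtain w0 where w0: "w0 \<in> W" "c w0 \<noteq> 0" by blast
  have "card (W - {w0}) < card X" using w0 assms by (metis card_Diff1_less)
  then obtain x where x: "\<exists>i\<in>X. x i \<noteq> 0" "\<And>w. w \<in> W - {w0} \<Longrightarrow> (\<Sum>i\<in>X. M i w * x i) = 0"
    using homogeneous_system_nontrivial[of "W - {w0}" X "\<lambda>w i. M i w"] assms by auto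
  have "c w0 * (\<Sum>i\<in>X. M i w0 * x i) = (\<Sum>w\<in>W. c w * (\<Sum>i\<in>X. M i w * x i))"
    using x(2) assms(2) w0 by (subst sum.remove[of W w0]) auto
  also have "\<dots> = (\<Sum>i\<in>X. x i * (\<Sum>w\<in>W. c w * M i w))"
    unfolding sum_distrib_left by (subst sum.swap) (simp add: mult_ac)
  also have "\<dots> = 0" using c by simp
  finally have "(\<Sum>i\<in>X. M i w0 * x i) = 0" using w0 by simp
  then have "(\<Sum>i\<in>X. x i * M i w) = 0" if "w \<in> W" for w
    using x(2)[of w] that by (cases "w = w0") (auto simp: mult.commute)
  then show False using x(1) assms(4) unfolding rows_independent_def by blast
qed

lemma bounded_family_convergent_subsequence:
  fixes f :: "nat \<Rightarrow> 'x \<Rightarrow> real"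
  assumes "finite X" "\<And>n x. x \<in> X \<Longrightarrow> \<bar>f n x\<bar> \<le> B"
  shows "\<exists>r l. strict_mono r \<and> (\<forall>x\<in>X. (\<lambda>n. f (r n) x) \<longlonglongrightarrow> l x)"
  using assms
proof (induction X rule: finite_induct)
  case empty
  show ?case by (rule exI[of _ id]) (simp add: strict_mono_def)
next
  case (insert x X)
  have "\<exists>r l. strict_mono r \<and> (\<forall>y\<in>X. (\<lambda>n. f (r n) y) \<longlonglongrightarrow> l y)"
    by (rule insert.IH) (use insert.prems in auto)
  then obtain r l where r: "strict_mono r" "\<And>y. y \<in> X \<Longrightarrow> (\<lambda>n. f (r n) y) \<longlonglongrightarrow> l y" by blast
  have "bounded (range (\<lambda>n. f (r n) x))" using insert.prems by (intro boundedI[of _ B]) auto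
  then obtain l0 s where s: "strict_mono s" "((\<lambda>n. f (r n) x) \<circ> s) \<longlonglongrightarrow> l0"
    using bounded_imp_convergent_subsequence by blast
  have "(\<lambda>n. f (r (s n)) y) \<longlonglongrightarrow> (l(x := l0)) y" if "y \<in> insert x X" for y
  proof (cases "y = x")
    case True
    then show ?thesis using s(2) by (simp add: o_def)
  next
    case False
    then show ?thesis using LIMSEQ_subseq_LIMSEQ[OF r(2) s(1), of y] that by (simp add: o_def)
  qed
  then show ?case using r(1) s(1) by (intro exI[of _ "r \<circ> s"] exI[of _ "l(x := l0)"]) (auto simp: strict_mono_def)
qed

lemma open_condition_by_sequences:
  fixes a :: "'v \<Rightarrow> nat \<Rightarrow> real"
  assumes "\<And>b. (\<And>v \<alpha>. v \<in> V \<Longrightarrow> \<alpha> < k \<Longrightarrow> (\<lambda>n. b n v \<alpha>) \<longlonglongrightarrow> a v \<alpha>) \<Longrightarrow> (\<And>n. \<not> P (b n)) \<Longrightarrow> False"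
  shows "\<exists>\<epsilon>>0. \<forall>b. (\<forall>v\<in>V. \<forall>\<alpha><k. \<bar>b v \<alpha> - a v \<alpha>\<bar> < \<epsilon>) \<longrightarrow> P b"
proof (rule ccontr)
  assume no: "\<not> ?thesis"
  have "\<exists>b. (\<forall>v\<in>V. \<forall>\<alpha><k. \<bar>b v \<alpha> - a v \<alpha>\<bar> < inverse (real (Suc n))) \<and> \<not> P b" for n
    using no by (metis inverse_positive_iff_positive of_nat_0_less_iff zero_less_Suc)
  then obtain b where b: "\<And>n v \<alpha>. v \<in> V \<Longrightarrow> \<alpha> < k \<Longrightarrow> \<bar>b n v \<alpha> - a v \<alpha>\<bar> < inverse (real (Suc n))"
    and nP: "\<And>n. \<not> P (b n)" by metis
  have "(\<lambda>n. b n v \<alpha>) \<longlonglongrightarrow> a v \<alpha>" if "v \<in> V" "\<alpha> < k" for v \<alpha>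
  proof -
    have "(\<lambda>n. b n v \<alpha> - a v \<alpha>) \<longlonglongrightarrow> 0"
      by (rule Lim_null_comparison[OF _ LIMSEQ_inverse_real_of_nat])
        (use b[OF that] in \<open>auto intro!: always_eventually less_imp_le\<close>)
    then show ?thesis by (simp add: LIM_zero_iff)
  qed
  from assms[OF this nP] show False by blast
qed

text \<open>Compactness: relations of nearby rows, normalised to absolute sum 1, accumulate at a
  nonzero relation of the limit.\<close>

lemma rows_independent_open:
  fixes a :: "'v \<Rightarrow> nat \<Rightarrow> real"
  assumes "finite J" "rows_independent {..<k} J a"
  shows "\<exists>\<epsilon>>0. \<forall>b. (\<forall>v\<in>J. \<forall>\<alpha><k. \<bar>b v \<alpha> - a v \<alpha>\<bar> < \<epsilon>) \<longrightarrow> rows_independent {..<k} J b"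
proof (rule open_condition_by_sequences)
  fix b assume b: "\<And>v \<alpha>. v \<in> J \<Longrightarrow> \<alpha> < k \<Longrightarrow> (\<lambda>n. b n v \<alpha>) \<longlonglongrightarrow> a v \<alpha>"
    and "\<And>n. \<not> rows_independent {..<k} J (b n)"
  then have "\<exists>c. (\<forall>\<alpha><k. (\<Sum>j\<in>J. c j * b n j \<alpha>) = 0) \<and> (\<exists>j\<in>J. c j \<noteq> 0)" for n
    unfolding rows_independent_def by (metis lessThan_iff)
  then obtain c where c: "\<And>n \<alpha>. \<alpha> < k \<Longrightarrow> (\<Sum>j\<in>J. c n j * b n j \<alpha>) = 0" "\<And>n. \<exists>j\<in>J. c n j \<noteq> 0"
    by metis
  define s where "s n = (\<Sum>j\<in>J. \<bar>c n j\<bar>)" for n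
  have s: "s n > 0" for n
    unfolding s_def using c(2)[of n] assms(1) by (auto intro: sum_pos2)
  define e where "e n j = c n j / s n" for n j
  have sum1: "(\<Sum>j\<in>J. \<bar>e n j\<bar>) = 1" for n
    using s[of n] by (simp add: e_def s_def[symmetric] sum_divide_distrib[symmetric])
  have "\<bar>e n j\<bar> \<le> 1" if "j \<in> J" for n j
    using member_le_sum[of j J "\<lambda>j. \<bar>e n j\<bar>"] assms(1) that sum1[of n] by simp
  then have "\<exists>r l. strict_mono r \<and> (\<forall>j\<in>J. (\<lambda>n. e (r n) j) \<longlonglongrightarrow> l j)"
    by (intro bounded_family_convergent_subsequence[where B = 1] assms(1))
  then obtain r l where r: "strict_mono r" and l: "\<And>j. j \<in> J \<Longrightarrow> (\<lambda>n. e (r n) j) \<longlonglongrightarrow> l j" by blast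
  have "(\<lambda>n. \<Sum>j\<in>J. \<bar>e (r n) j\<bar>) \<longlonglongrightarrow> (\<Sum>j\<in>J. \<bar>l j\<bar>)" by (intro tendsto_intros l)
  then have "(\<Sum>j\<in>J. \<bar>l j\<bar>) = 1" by (simp add: sum1 LIMSEQ_const_iff)
  have "(\<Sum>j\<in>J. l j * a j \<alpha>) = 0" if \<alpha>: "\<alpha> < k" for \<alpha>
  proof -
    have "(\<lambda>n. b (r n) j \<alpha>) \<longlonglongrightarrow> a j \<alpha>" if "j \<in> J" for j
      using LIMSEQ_subseq_LIMSEQ[OF b[OF that \<alpha>] r] by (simp add: o_def)
    then have "(\<lambda>n. \<Sum>j\<in>J. e (r n) j * b (r n) j \<alpha>) \<longlonglongrightarrow> (\<Sum>j\<in>J. l j * a j \<alpha>)" by (intro tendsto_intros l)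
    moreover have "(\<Sum>j\<in>J. e n j * b n j \<alpha>) = 0" for n
    proof -
      have "(\<Sum>j\<in>J. e n j * b n j \<alpha>) = (\<Sum>j\<in>J. c n j * b n j \<alpha>) / s n"
        by (simp add: e_def sum_divide_distrib)
      then show ?thesis using c(1)[OF \<alpha>] by simp
    qed
    ultimately show ?thesis by (simp add: LIMSEQ_const_iff)
  qed
  then have "\<forall>j\<in>J. l j = 0" using assms(2) unfolding rows_independent_def by blast
  then show False using \<open>(\<Sum>j\<in>J. \<bar>l j\<bar>) = 1\<close> by simp
qed

text \<open>Rows of full rank \<open>k\<close> are essential: at a placement of lower rank there are
  dependencies that disappear under perturbation. With independent rows \<open>J\<close>, the defect
  of \<open>y\<close> at \<open>b n\<close> is repaired by a small change on
  \<open>J\<close>.\<close>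

lemma dependency_approximation:
  assumes finV: "finite V" and J: "J \<subseteq> V" "card J = k" "rows_independent {..<k} J a"
    and b: "\<And>v \<alpha>. v \<in> V \<Longrightarrow> \<alpha> < k \<Longrightarrow> (\<lambda>n. b n v \<alpha>) \<longlonglongrightarrow> a v \<alpha>"
    and y: "dependency V k a y"
  shows "\<exists>ys. (\<forall>v\<in>V. (\<lambda>n. ys n v) \<longlonglongrightarrow> y v) \<and> (\<forall>\<^sub>F n in sequentially. dependency V k (b n) (ys n))"
proof -
  have finJ: "finite J" using J finV finite_subset by blast
  have cols: "rows_independent J {..<k} (\<lambda>\<alpha> j. a j \<alpha>)"
    by (rule rows_independent_transpose[OF finJ _ _ J(3)]) (simp_all add: J(2))
  have "\<exists>m. \<forall>\<beta>\<in>{..<k}. (\<Sum>j\<in>J. m j * a j \<beta>) = (if \<alpha> = \<beta> then 1 else 0)" for \<alpha>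
    using independent_rows_surj[OF _ finJ cols, of "\<lambda>\<beta>. if \<alpha> = \<beta> then 1 else 0"]
    by (metis finite_lessThan)
  then obtain m where m: "\<And>\<alpha> \<beta>. \<beta> < k \<Longrightarrow> (\<Sum>j\<in>J. m \<alpha> j * a j \<beta>) = (if \<alpha> = \<beta> then 1 else 0)"
    by (metis lessThan_iff)
  \<comment> \<open>\<open>m\<close> is the inverse of the matrix \<open>a\<close> on
    \<open>J\<close>, so \<open>T n\<close> tends to the identity.\<close>
  define T where "T n \<alpha> \<beta> = (\<Sum>j\<in>J. m \<alpha> j * b n j \<beta>)" for n \<alpha> \<beta>
  define w where "w n \<beta> = (\<Sum>v\<in>V. y v * b n v \<beta>)" for n \<beta>
  have T: "(\<lambda>n. T n \<alpha> \<beta>) \<longlonglongrightarrow> (if \<alpha> = \<beta> then 1 else 0)" if "\<beta> < k" for \<alpha> \<beta>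
    unfolding m[OF that, symmetric] T_def using J(1) that by (intro tendsto_intros b) auto
  have w: "(\<lambda>n. w n \<beta>) \<longlonglongrightarrow> 0" if "\<beta> < k" for \<beta>
  proof -
    have "(\<lambda>n. w n \<beta>) \<longlonglongrightarrow> (\<Sum>v\<in>V. y v * a v \<beta>)"
      unfolding w_def using that by (intro tendsto_intros b) auto
    then show ?thesis using y that by (simp add: dependency_def)
  qed
  \<comment> \<open>The bound \<open>1 / (2 * k)\<close> gives \<open>T n\<close> minus the identity
    norm at most 1/2 for sums of absolute values. A solution \<open>x\<close> of
    \<open>x T = w\<close> then has norm at most twice that of \<open>w\<close>.\<close>
  define close where "close n \<longleftrightarrow> (\<forall>\<beta>\<in>{..<k}. \<forall>\<alpha>\<in>{..<k}. \<bar>T n \<alpha> \<beta> - (if \<alpha> = \<beta> then 1 else 0)\<bar> < 1 / (2 * real k))" for n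
  have "\<forall>\<^sub>F n in sequentially. close n"
    unfolding close_def
  proof (intro eventually_ball_finite ballI)
    fix \<alpha> \<beta> assume "\<beta> \<in> {..<k}" "\<alpha> \<in> {..<k}"
    then have "\<forall>\<^sub>F n in sequentially. dist (T n \<alpha> \<beta>) (if \<alpha> = \<beta> then 1 else 0) < 1 / (2 * real k)"
      by (intro tendstoD[OF T]) auto
    then show "\<forall>\<^sub>F n in sequentially. \<bar>T n \<alpha> \<beta> - (if \<alpha> = \<beta> then 1 else 0)\<bar> < 1 / (2 * real k)"
      by (simp add: dist_real_def)
  qed auto
  have half: "(\<Sum>\<beta><k. \<bar>\<Sum>\<alpha><k. x \<alpha> * (T n \<alpha> \<beta> - (if \<alpha> = \<beta> then 1 else 0))\<bar>) \<le> (\<Sum>\<alpha><k. \<bar>x \<alpha>\<bar>) / 2"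
    if "close n" for n x
  proof -
    have "(\<Sum>\<beta><k. \<bar>\<Sum>\<alpha><k. x \<alpha> * (T n \<alpha> \<beta> - (if \<alpha> = \<beta> then 1 else 0))\<bar>)
        \<le> (\<Sum>\<beta><k. \<Sum>\<alpha><k. \<bar>x \<alpha>\<bar> * (1 / (2 * real k)))"
    proof (rule sum_mono)
      fix \<beta> assume \<beta>: "\<beta> \<in> {..<k}"
      have "\<bar>\<Sum>\<alpha><k. x \<alpha> * (T n \<alpha> \<beta> - (if \<alpha> = \<beta> then 1 else 0))\<bar>
          \<le> (\<Sum>\<alpha><k. \<bar>x \<alpha> * (T n \<alpha> \<beta> - (if \<alpha> = \<beta> then 1 else 0))\<bar>)" by (rule sum_abs)
      also have "\<dots> \<le> (\<Sum>\<alpha><k. \<bar>x \<alpha>\<bar> * (1 / (2 * real k)))"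
      proof (rule sum_mono)
        fix \<alpha> assume "\<alpha> \<in> {..<k}"
        then have "\<bar>T n \<alpha> \<beta> - (if \<alpha> = \<beta> then 1 else 0)\<bar> \<le> 1 / (2 * real k)"
          using that \<beta> unfolding close_def by (blast intro: less_imp_le)
        then show "\<bar>x \<alpha> * (T n \<alpha> \<beta> - (if \<alpha> = \<beta> then 1 else 0))\<bar> \<le> \<bar>x \<alpha>\<bar> * (1 / (2 * real k))"
          unfolding abs_mult by (intro mult_left_mono) auto
      qed
      finally show "\<bar>\<Sum>\<alpha><k. x \<alpha> * (T n \<alpha> \<beta> - (if \<alpha> = \<beta> then 1 else 0))\<bar> \<le> \<dots>" .
    qed
    also have "\<dots> = (\<Sum>\<alpha><k. \<bar>x \<alpha>\<bar>) / 2"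
      by (cases "k = 0") (simp_all add: sum_distrib_right[symmetric] sum_divide_distrib[symmetric])
    finally show ?thesis .
  qed
  have expand: "(\<Sum>\<alpha><k. x \<alpha> * (T n \<alpha> \<beta> - (if \<alpha> = \<beta> then 1 else 0))) = (\<Sum>\<alpha><k. x \<alpha> * T n \<alpha> \<beta>) - x \<beta>"
    if "\<beta> < k" for x n \<beta>
    using that by (simp add: right_diff_distrib sum_subtractf if_distrib[of "\<lambda>t. _ * t"] cong: if_cong)
  have "\<exists>x. (\<forall>\<beta><k. (\<Sum>\<alpha><k. x \<alpha> * T n \<alpha> \<beta>) = w n \<beta>) \<and> (\<Sum>\<alpha><k. \<bar>x \<alpha>\<bar>) \<le> 2 * (\<Sum>\<beta><k. \<bar>w n \<beta>\<bar>)"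
    if cl: "close n" for n
  proof -
    have ri: "rows_independent {..<k} {..<k} (T n)"
      unfolding rows_independent_def
    proof (intro allI impI)
      fix x assume x: "\<forall>\<beta>\<in>{..<k}. (\<Sum>\<alpha><k. x \<alpha> * T n \<alpha> \<beta>) = 0"
      have "(\<Sum>\<beta><k. \<bar>x \<beta>\<bar>) \<le> (\<Sum>\<alpha><k. \<bar>x \<alpha>\<bar>) / 2"
        using half[OF cl, of x] x by (simp add: expand)
      then have "(\<Sum>\<beta><k. \<bar>x \<beta>\<bar>) = 0" by (intro antisym sum_nonneg) auto
      then show "\<forall>i\<in>{..<k}. x i = 0" by (simp add: sum_nonneg_eq_0_iff)
    qed
    obtain x where x: "\<And>\<beta>. \<beta> < k \<Longrightarrow> (\<Sum>\<alpha><k. x \<alpha> * T n \<alpha> \<beta>) = w n \<beta>"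
      using independent_rows_surj[OF _ _ rows_independent_transpose[OF _ _ _ ri], of "w n"] by auto
    have "(\<Sum>\<beta><k. \<bar>x \<beta>\<bar>) \<le> (\<Sum>\<beta><k. \<bar>w n \<beta>\<bar> + \<bar>\<Sum>\<alpha><k. x \<alpha> * (T n \<alpha> \<beta> - (if \<alpha> = \<beta> then 1 else 0))\<bar>)"
    proof (rule sum_mono)
      fix \<beta> assume "\<beta> \<in> {..<k}"
      then show "\<bar>x \<beta>\<bar> \<le> \<bar>w n \<beta>\<bar> + \<bar>\<Sum>\<alpha><k. x \<alpha> * (T n \<alpha> \<beta> - (if \<alpha> = \<beta> then 1 else 0))\<bar>"
        using x[of \<beta>] by (simp add: expand)
    qed
    also have "\<dots> \<le> (\<Sum>\<beta><k. \<bar>w n \<beta>\<bar>) + (\<Sum>\<alpha><k. \<bar>x \<alpha>\<bar>) / 2"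
      using half[OF cl, of x] by (simp add: sum.distrib)
    finally show ?thesis using x by (intro exI[of _ x]) auto
  qed
  then obtain x where x: "\<And>n \<beta>. close n \<Longrightarrow> \<beta> < k \<Longrightarrow> (\<Sum>\<alpha><k. x n \<alpha> * T n \<alpha> \<beta>) = w n \<beta>"
    and xb: "\<And>n. close n \<Longrightarrow> (\<Sum>\<alpha><k. \<bar>x n \<alpha>\<bar>) \<le> 2 * (\<Sum>\<beta><k. \<bar>w n \<beta>\<bar>)"
    by metis
  have x0: "(\<lambda>n. x n \<alpha>) \<longlonglongrightarrow> 0" if "\<alpha> < k" for \<alpha>
  proof (rule Lim_null_comparison)
    have "(\<lambda>n. 2 * (\<Sum>\<beta><k. \<bar>w n \<beta>\<bar>)) \<longlonglongrightarrow> 2 * (\<Sum>\<beta><k. \<bar>0\<bar>)" by (intro tendsto_intros w) auto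
    then show "(\<lambda>n. 2 * (\<Sum>\<beta><k. \<bar>w n \<beta>\<bar>)) \<longlonglongrightarrow> 0" by simp
    show "\<forall>\<^sub>F n in sequentially. norm (x n \<alpha>) \<le> 2 * (\<Sum>\<beta><k. \<bar>w n \<beta>\<bar>)"
      using \<open>\<forall>\<^sub>F n in sequentially. close n\<close>
    proof eventually_elim
      case (elim n)
      have "\<bar>x n \<alpha>\<bar> \<le> (\<Sum>\<alpha><k. \<bar>x n \<alpha>\<bar>)" using that by (intro member_le_sum) auto
      then show ?case using xb[OF elim] by simp
    qed
  qed
  \<comment> \<open>The correction contributes \<open>x T\<close> to the coordinate sums at
    \<open>b n\<close>, which equals the defect \<open>w\<close> of \<open>y\<close>.\<close>
  define ys where "ys n v = y v - (if v \<in> J then \<Sum>\<alpha><k. x n \<alpha> * m \<alpha> v else 0)" for n v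
  have "(\<lambda>n. ys n v) \<longlonglongrightarrow> y v" for v
  proof -
    have "(\<lambda>n. \<Sum>\<alpha><k. x n \<alpha> * m \<alpha> v) \<longlonglongrightarrow> (\<Sum>\<alpha><k. 0 * m \<alpha> v)"
      by (intro tendsto_intros x0) auto
    then have "(\<lambda>n. if v \<in> J then \<Sum>\<alpha><k. x n \<alpha> * m \<alpha> v else 0) \<longlonglongrightarrow> 0"
      by (cases "v \<in> J") simp_all
    from tendsto_diff[OF tendsto_const[of "y v"] this] show ?thesis by (simp add: ys_def)
  qed
  moreover have "dependency V k (b n) (ys n)" if "close n" for n
    unfolding dependency_def
  proof (intro allI impI)
    fix \<beta> assume \<beta>: "\<beta> < k"
    have "(\<Sum>v\<in>V. ys n v * b n v \<beta>)
        = w n \<beta> - (\<Sum>v\<in>V. if v \<in> J then (\<Sum>\<alpha><k. x n \<alpha> * m \<alpha> v) * b n v \<beta> else 0)"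
      unfolding w_def sum_subtractf[symmetric] by (rule sum.cong) (auto simp: ys_def left_diff_distrib)
    also have "(\<Sum>v\<in>V. if v \<in> J then (\<Sum>\<alpha><k. x n \<alpha> * m \<alpha> v) * b n v \<beta> else 0)
        = (\<Sum>v\<in>J. (\<Sum>\<alpha><k. x n \<alpha> * m \<alpha> v) * b n v \<beta>)"
      using J(1) finV by (simp add: sum.inter_restrict[symmetric] Int_absorb1)
    also have "\<dots> = (\<Sum>\<alpha><k. x n \<alpha> * T n \<alpha> \<beta>)"
      unfolding T_def sum_distrib_left sum_distrib_right by (subst sum.swap) (simp add: mult_ac)
    finally show "(\<Sum>v\<in>V. ys n v * b n v \<beta>) = 0" using x[OF that \<beta>] by simp
  qed
  then have "\<forall>\<^sub>F n in sequentially. dependency V k (b n) (ys n)"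
    using \<open>\<forall>\<^sub>F n in sequentially. close n\<close> by (auto elim: eventually_mono)
  ultimately show ?thesis by blast
qed

text \<open>Nonzero strain forms at placements tending to \<open>a\<close>, normalised to absolute
  sum 1, accumulate at a nonzero strain form at \<open>a\<close>. Here every dependency of
  \<open>a\<close> has to be a limit of dependencies.\<close>

lemma strain_rigid_open:
  assumes finV: "finite V" and J: "J \<subseteq> V" "card J = k" "rows_independent {..<k} J a"
    and rigid: "strain_rigid V E k a"
  shows "\<exists>\<epsilon>>0. \<forall>b. (\<forall>v\<in>V. \<forall>\<alpha><k. \<bar>b v \<alpha> - a v \<alpha>\<bar> < \<epsilon>) \<longrightarrow> strain_rigid V E k b"
proof (rule open_condition_by_sequences)
  fix b assume b: "\<And>v \<alpha>. v \<in> V \<Longrightarrow> \<alpha> < k \<Longrightarrow> (\<lambda>n. b n v \<alpha>) \<longlonglongrightarrow> a v \<alpha>"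
    and "\<And>n. \<not> strain_rigid V E k (b n)"
  then have "\<exists>C. strain_form V E k (b n) C \<and> (\<exists>u\<in>V. \<exists>v\<in>V. C u v \<noteq> 0)" for n
    unfolding strain_rigid_def by blast
  then obtain C where C: "\<And>n. strain_form V E k (b n) (C n)"
    and C_nz: "\<And>n. \<exists>u\<in>V. \<exists>v\<in>V. C n u v \<noteq> 0" by metis
  define s where "s n = (\<Sum>(u, v)\<in>V \<times> V. \<bar>C n u v\<bar>)" for n
  have s: "s n > 0" for n
  proof -
    obtain u v where "u \<in> V" "v \<in> V" "C n u v \<noteq> 0" using C_nz by blast
    then show ?thesis unfolding s_def using finV by (intro sum_pos2[of _ "(u, v)"]) auto
  qed
  define D where "D n = (\<lambda>(u, v). C n u v / s n)" for n
  have sum1: "(\<Sum>e\<in>V \<times> V. \<bar>D n e\<bar>) = 1" for n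
  proof -
    have "(\<Sum>e\<in>V \<times> V. \<bar>D n e\<bar>) = (\<Sum>(u, v)\<in>V \<times> V. \<bar>C n u v\<bar>) / s n"
      using s[of n] unfolding sum_divide_distrib by (intro sum.cong) (auto simp: D_def)
    then show ?thesis using s[of n] by (simp add: s_def)
  qed
  have "\<bar>D n e\<bar> \<le> 1" if "e \<in> V \<times> V" for n e
    using member_le_sum[of e "V \<times> V" "\<lambda>e. \<bar>D n e\<bar>"] finV that sum1[of n] by simp
  then have "\<exists>r l. strict_mono r \<and> (\<forall>e\<in>V \<times> V. (\<lambda>n. D (r n) e) \<longlonglongrightarrow> l e)"
    by (intro bounded_family_convergent_subsequence[where B = 1] finite_cartesian_product finV)
  then obtain r l where r: "strict_mono r"
    and l: "\<And>e. e \<in> V \<times> V \<Longrightarrow> (\<lambda>n. D (r n) e) \<longlonglongrightarrow> l e" by blast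
  have lim: "(\<lambda>n. C (r n) u v / s (r n)) \<longlonglongrightarrow> l (u, v)" if "u \<in> V" "v \<in> V" for u v
    using l[of "(u, v)"] that by (simp add: D_def)
  have br: "(\<lambda>n. b (r n) v \<alpha>) \<longlonglongrightarrow> a v \<alpha>" if "v \<in> V" "\<alpha> < k" for v \<alpha>
    using LIMSEQ_subseq_LIMSEQ[OF b[OF that] r] by (simp add: o_def)
  have "strain_form V E k a (\<lambda>u v. l (u, v))"
    unfolding strain_form_def
  proof (intro conjI ballI impI allI)
    fix u v assume uv: "u \<in> V" "v \<in> V"
    have "C n u v = C n v u" for n using C uv by (auto simp: strain_form_def)
    then show "l (u, v) = l (v, u)" using lim[OF uv] lim[OF uv(2,1)] LIMSEQ_unique by fastforce
  next
    fix v assume v: "v \<in> V"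
    have "C n v v = 0" for n using C v by (auto simp: strain_form_def)
    then show "l (v, v) = 0" using lim[OF v v] by (simp add: LIMSEQ_const_iff)
  next
    fix u v assume uv: "u \<in> V" "v \<in> V" "{u, v} \<in> E"
    have "C n u v = 0" for n using C uv by (auto simp: strain_form_def)
    then show "l (u, v) = 0" using lim[OF uv(1,2)] by (simp add: LIMSEQ_const_iff)
  next
    fix y z assume y: "dependency V k a y" and z: "dependency V k a z"
    obtain ys where ys: "\<And>v. v \<in> V \<Longrightarrow> (\<lambda>n. ys n v) \<longlonglongrightarrow> y v"
      "\<forall>\<^sub>F n in sequentially. dependency V k (b (r n)) (ys n)"
      using dependency_approximation[OF finV J, of "\<lambda>n. b (r n)", OF br y] by auto
    obtain zs where zs: "\<And>v. v \<in> V \<Longrightarrow> (\<lambda>n. zs n v) \<longlonglongrightarrow> z v"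
      "\<forall>\<^sub>F n in sequentially. dependency V k (b (r n)) (zs n)"
      using dependency_approximation[OF finV J, of "\<lambda>n. b (r n)", OF br z] by auto
    let ?S = "\<lambda>n. \<Sum>u\<in>V. \<Sum>v\<in>V. ys n u * (C (r n) u v / s (r n)) * zs n v"
    have "\<forall>\<^sub>F n in sequentially. ?S n = 0"
      using ys(2) zs(2)
    proof eventually_elim
      case (elim n)
      have "(\<Sum>u\<in>V. \<Sum>v\<in>V. ys n u * C (r n) u v * zs n v) = 0"
        using C[of "r n"] elim unfolding strain_form_def by blast
      moreover have "?S n = (\<Sum>u\<in>V. \<Sum>v\<in>V. ys n u * C (r n) u v * zs n v) / s (r n)"
        by (simp add: sum_divide_distrib)
      ultimately show ?case by simp
    qed
    then have "?S \<longlonglongrightarrow> 0" by (rule tendsto_eventually)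
    moreover have "?S \<longlonglongrightarrow> (\<Sum>u\<in>V. \<Sum>v\<in>V. y u * l (u, v) * z v)"
      by (intro tendsto_intros lim ys zs)
    ultimately show "(\<Sum>u\<in>V. \<Sum>v\<in>V. y u * l (u, v) * z v) = 0" by (rule LIMSEQ_unique[rotated])
  qed
  then have "\<forall>e\<in>V \<times> V. l e = 0" using rigid by (auto simp: strain_rigid_def)
  then have "(\<Sum>e\<in>V \<times> V. \<bar>l e\<bar>) = 0" by (intro sum.neutral) auto
  moreover have "(\<lambda>n. \<Sum>e\<in>V \<times> V. \<bar>D (r n) e\<bar>) \<longlonglongrightarrow> (\<Sum>e\<in>V \<times> V. \<bar>l e\<bar>)" by (intro tendsto_intros l)
  ultimately show False by (simp add: sum1 LIMSEQ_const_iff)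
qed

section \<open>Congruent placements and continuous motions\<close>

definition homog :: "('v \<Rightarrow> nat \<Rightarrow> real) \<Rightarrow> 'v \<Rightarrow> nat \<Rightarrow> real" where
  "homog p v \<alpha> = (case \<alpha> of 0 \<Rightarrow> 1 | Suc \<beta> \<Rightarrow> p v \<beta>)"

lemma homog_simps [simp]: "homog p v 0 = 1" "homog p v (Suc \<beta>) = p v \<beta>"
  by (simp_all add: homog_def)

lemma dependency_homog:
  "dependency V (Suc d) (homog p) y \<longleftrightarrow> (\<Sum>v\<in>V. y v) = 0 \<and> (\<forall>\<beta><d. (\<Sum>v\<in>V. y v * p v \<beta>) = 0)"
  by (simp add: dependency_def All_less_Suc2)

definition sqdist :: "nat \<Rightarrow> (nat \<Rightarrow> real) \<Rightarrow> (nat \<Rightarrow> real) \<Rightarrow> real" where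
  "sqdist d x y = (\<Sum>i<d. (x i - y i)\<^sup>2)"

lemma euclid_dist_eq_iff: "euclid_dist d x y = euclid_dist d x' y' \<longleftrightarrow> sqdist d x y = sqdist d x' y'"
  by (simp add: euclid_dist_def L2_set_def sqdist_def sum_nonneg)

text \<open>After expanding the squares, the terms with a squared coordinate carry the factor
  \<open>(\<Sum>v\<in>V. y v) = 0\<close>, and only the mixed terms remain.\<close>

lemma sum_sqdist_dependency:
  assumes y: "(\<Sum>v\<in>V. y v) = 0"
  shows "(\<Sum>u\<in>V. \<Sum>v\<in>V. y u * y v * sqdist d (p u) (p v)) = - 2 * (\<Sum>i<d. (\<Sum>v\<in>V. y v * p v i)\<^sup>2)"
proof -
  have "(\<Sum>u\<in>V. \<Sum>v\<in>V. y u * y v * (p u i - p v i)\<^sup>2) = - 2 * (\<Sum>v\<in>V. y v * p v i)\<^sup>2" for i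
  proof -
    have "(\<Sum>u\<in>V. \<Sum>v\<in>V. y u * y v * (p u i - p v i)\<^sup>2)
      = (\<Sum>u\<in>V. \<Sum>v\<in>V. (y u * (p u i)\<^sup>2) * y v + y u * (y v * (p v i)\<^sup>2) - 2 * ((y u * p u i) * (y v * p v i)))"
      by (intro sum.cong refl) (simp add: power2_eq_square algebra_simps)
    also have "\<dots> = (\<Sum>u\<in>V. y u * (p u i)\<^sup>2) * (\<Sum>v\<in>V. y v) + (\<Sum>u\<in>V. y u) * (\<Sum>v\<in>V. y v * (p v i)\<^sup>2)
        - 2 * ((\<Sum>u\<in>V. y u * p u i) * (\<Sum>v\<in>V. y v * p v i))"
      by (simp only: sum_subtractf sum.distrib sum_product sum_distrib_left[symmetric])
    finally show ?thesis using y by (simp add: power2_eq_square)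
  qed
  moreover have "(\<Sum>u\<in>V. \<Sum>v\<in>V. y u * y v * sqdist d (p u) (p v))
      = (\<Sum>i<d. \<Sum>u\<in>V. \<Sum>v\<in>V. y u * y v * (p u i - p v i)\<^sup>2)"
  proof -
    have "(\<Sum>u\<in>V. \<Sum>v\<in>V. y u * y v * sqdist d (p u) (p v))
       = (\<Sum>u\<in>V. \<Sum>v\<in>V. \<Sum>i<d. y u * y v * (p u i - p v i)\<^sup>2)"
      by (simp add: sqdist_def sum_distrib_left)
    also have "\<dots> = (\<Sum>u\<in>V. \<Sum>i<d. \<Sum>v\<in>V. y u * y v * (p u i - p v i)\<^sup>2)"
      by (intro sum.cong refl sum.swap)
    also have "\<dots> = (\<Sum>i<d. \<Sum>u\<in>V. \<Sum>v\<in>V. y u * y v * (p u i - p v i)\<^sup>2)"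
      by (rule sum.swap)
    finally show ?thesis .
  qed
  ultimately show ?thesis by (simp add: sum_distrib_left)
qed

text \<open>Affine dependencies can be read off the distances: among weights with sum 0 they are the
  zeros of the form above, which is -2 times a sum of squares.\<close>

lemma dependency_homog_congruent:
  assumes "\<And>u v. u \<in> V \<Longrightarrow> v \<in> V \<Longrightarrow> sqdist d (p u) (p v) = sqdist d (q u) (q v)"
  shows "dependency V (Suc d) (homog p) y \<longleftrightarrow> dependency V (Suc d) (homog q) y"
proof -
  have iff: "dependency V (Suc d) (homog p) y \<longleftrightarrow>
      (\<Sum>v\<in>V. y v) = 0 \<and> (\<Sum>u\<in>V. \<Sum>v\<in>V. y u * y v * sqdist d (p u) (p v)) = 0" for p
    using sum_sqdist_dependency[of y V d p]
    by (auto simp: dependency_homog sum_nonneg_eq_0_iff)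
  show ?thesis unfolding iff using assms by simp
qed

text \<open>For two placements with equal edge lengths, the differences of the squared distances are strains
  of an infinitesimal motion at the midpoint.\<close>

lemma strain_form_midpoint:
  assumes "\<And>u v. u \<in> V \<Longrightarrow> v \<in> V \<Longrightarrow> {u, v} \<in> E \<Longrightarrow> sqdist d (q u) (q v) = sqdist d (p u) (p v)"
  shows "strain_form V E (Suc d) (homog (\<lambda>v i. (p v i + q v i) / 2))
           (\<lambda>u v. sqdist d (q u) (q v) - sqdist d (p u) (p v))"
  unfolding strain_form_def
proof (intro conjI ballI impI allI)
  fix y z
  let ?s = "\<lambda>v i. (p v i + q v i) / 2" and ?g = "\<lambda>v i. q v i - p v i"
  assume y: "dependency V (Suc d) (homog ?s) y" and z: "dependency V (Suc d) (homog ?s) z"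
  have expand: "y * (2 * (s - s') * (g - g')) * z
      = (2 * y * s * g) * z - (2 * y * s) * (g' * z) - (2 * y * g) * (z * s') + y * (2 * s' * g' * z)"
    for y z s s' g g' :: real
    by (simp add: algebra_simps)
  \<comment> \<open>A difference of squares: the sum of the two edge vectors is twice that of the
    midpoint, and their difference is the edge vector of \<open>q - p\<close>.\<close>
  have "sqdist d (q u) (q v) - sqdist d (p u) (p v) = (\<Sum>i<d. 2 * (?s u i - ?s v i) * (?g u i - ?g v i))" for u v
    unfolding sqdist_def sum_subtractf[symmetric]
    by (intro sum.cong refl) (simp add: power2_eq_square field_simps)
  then have "(\<Sum>u\<in>V. \<Sum>v\<in>V. y u * (sqdist d (q u) (q v) - sqdist d (p u) (p v)) * z v)
      = (\<Sum>u\<in>V. \<Sum>v\<in>V. \<Sum>i<d. y u * (2 * (?s u i - ?s v i) * (?g u i - ?g v i)) * z v)"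
    by (simp add: sum_distrib_left sum_distrib_right)
  also have "\<dots> = (\<Sum>u\<in>V. \<Sum>i<d. \<Sum>v\<in>V. y u * (2 * (?s u i - ?s v i) * (?g u i - ?g v i)) * z v)"
    by (intro sum.cong refl sum.swap)
  also have "\<dots> = (\<Sum>i<d. \<Sum>u\<in>V. \<Sum>v\<in>V. y u * (2 * (?s u i - ?s v i) * (?g u i - ?g v i)) * z v)"
    by (rule sum.swap)
  also have "\<dots> = (\<Sum>i<d. 0)"
  proof (rule sum.cong[OF refl])
    fix i assume i: "i \<in> {..<d}"
    have "(\<Sum>u\<in>V. \<Sum>v\<in>V. y u * (2 * (?s u i - ?s v i) * (?g u i - ?g v i)) * z v)
      = (\<Sum>u\<in>V. \<Sum>v\<in>V. (2 * y u * ?s u i * ?g u i) * z v - (2 * y u * ?s u i) * (?g v i * z v)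
          - (2 * y u * ?g u i) * (z v * ?s v i) + y u * (2 * ?s v i * ?g v i * z v))"
      by (intro sum.cong refl expand)
    also have "\<dots> = (\<Sum>u\<in>V. 2 * y u * ?s u i * ?g u i) * (\<Sum>v\<in>V. z v)
        - (\<Sum>u\<in>V. 2 * y u * ?s u i) * (\<Sum>v\<in>V. ?g v i * z v)
        - (\<Sum>u\<in>V. 2 * y u * ?g u i) * (\<Sum>v\<in>V. z v * ?s v i)
        + (\<Sum>u\<in>V. y u) * (\<Sum>v\<in>V. 2 * ?s v i * ?g v i * z v)"
      by (simp only: sum_subtractf sum.distrib sum_product)
    also have "(\<Sum>u\<in>V. 2 * y u * ?s u i) = 2 * (\<Sum>u\<in>V. y u * ?s u i)"
      by (simp only: sum_distrib_left mult.assoc)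
    finally show "(\<Sum>u\<in>V. \<Sum>v\<in>V. y u * (2 * (?s u i - ?s v i) * (?g u i - ?g v i)) * z v) = 0"
      using y z i by (simp add: dependency_homog)
  qed
  finally show "(\<Sum>u\<in>V. \<Sum>v\<in>V. y u * (sqdist d (q u) (q v) - sqdist d (p u) (p v)) * z v) = 0" by simp
qed (use assms in \<open>auto simp: sqdist_def power2_commute\<close>)

text \<open>In terms of dependencies, independence passes between congruent placements just as
  strain rigidity does.\<close>

lemma rows_independent_iff_dependency:
  assumes "finite V" "J \<subseteq> V"
  shows "rows_independent {..<k} J a \<longleftrightarrow>
    (\<forall>y. dependency V k a y \<longrightarrow> (\<forall>v\<in>V - J. y v = 0) \<longrightarrow> (\<forall>v\<in>J. y v = 0))"
proof -
  have restrict: "(\<Sum>v\<in>V. y v * a v \<alpha>) = (\<Sum>v\<in>J. y v * a v \<alpha>)" if "\<forall>v\<in>V - J. y v = 0" for y \<alpha>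
    using assms that by (intro sum.mono_neutral_right) auto
  show ?thesis
  proof
    assume "rows_independent {..<k} J a"
    then show "\<forall>y. dependency V k a y \<longrightarrow> (\<forall>v\<in>V - J. y v = 0) \<longrightarrow> (\<forall>v\<in>J. y v = 0)"
      using restrict by (auto simp: rows_independent_def dependency_def)
  next
    assume R: "\<forall>y. dependency V k a y \<longrightarrow> (\<forall>v\<in>V - J. y v = 0) \<longrightarrow> (\<forall>v\<in>J. y v = 0)"
    show "rows_independent {..<k} J a"
      unfolding rows_independent_def
    proof (intro allI impI)
      fix c assume c: "\<forall>\<alpha>\<in>{..<k}. (\<Sum>i\<in>J. c i * a i \<alpha>) = 0"
      let ?y = "\<lambda>v. if v \<in> J then c v else 0"
      have "(\<Sum>v\<in>J. ?y v * a v \<alpha>) = (\<Sum>i\<in>J. c i * a i \<alpha>)" for \<alpha> by (intro sum.cong) auto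
      then have "dependency V k a ?y" using c restrict[of ?y] by (auto simp: dependency_def)
      then have "\<forall>v\<in>J. ?y v = 0" using R by auto
      then show "\<forall>i\<in>J. c i = 0" by simp
    qed
  qed
qed

text \<open>The times at which \<open>q t\<close> is congruent to \<open>p\<close> form a clopen
  subset of the interval. For openness, strain rigidity at \<open>q t\<close> persists at its
  midpoint with a nearby \<open>q t'\<close>, where the differences of squared distances form a
  strain form and therefore vanish.\<close>

lemma rigid_framework_if_strain_rigid:
  assumes finV: "finite V" and J: "J \<subseteq> V" "card J = Suc d"
    and indep: "rows_independent {..<Suc d} J (homog p)"
    and rigid: "strain_rigid V E (Suc d) (homog p)"
  shows "rigid_framework d V E p"
  unfolding rigid_framework_def
proof (intro allI impI)
  fix q assume q: "framework_motion d V E p q"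
  let ?I = "{0..1::real}"
  \<comment> \<open>Congruence to \<open>p\<close> as the zero set of a single continuous
    function.\<close>
  define h where "h t = (\<Sum>u\<in>V. \<Sum>v\<in>V. (sqdist d (q t u) (q t v) - sqdist d (p u) (p v))\<^sup>2)" for t
  have h0: "h t = 0 \<longleftrightarrow> (\<forall>u\<in>V. \<forall>v\<in>V. sqdist d (q t u) (q t v) = sqdist d (p u) (p v))" for t
    using finV by (simp add: h_def sum_nonneg_eq_0_iff sum_nonneg)
  have cont: "continuous_on ?I (\<lambda>t. q t v i)" if "v \<in> V" "i < d" for v i
    using q that by (auto simp: framework_motion_def)
  have edges: "sqdist d (q t u) (q t v) = sqdist d (p u) (p v)"
    if "t \<in> ?I" "u \<in> V" "v \<in> V" "{u, v} \<in> E" for t u v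
    using q that unfolding framework_motion_def euclid_dist_eq_iff by blast
  have "continuous_on ?I h"
    unfolding h_def sqdist_def by (intro continuous_intros cont) auto
  define T where "T = {t \<in> ?I. h t = 0}"
  have "closedin (top_of_set ?I) T"
    unfolding T_def by (rule continuous_closedin_preimage_constant[OF \<open>continuous_on ?I h\<close>])
  moreover have "openin (top_of_set ?I) T"
    unfolding openin_euclidean_subtopology_iff
  proof (intro conjI ballI)
    show "T \<subseteq> ?I" by (auto simp: T_def)
    fix t assume t: "t \<in> T"
    then have tI: "t \<in> ?I" by (simp add: T_def)
    have cong: "sqdist d (q t u) (q t v) = sqdist d (p u) (p v)" if "u \<in> V" "v \<in> V" for u v
      using t h0 that by (simp add: T_def)
    have dep: "dependency V (Suc d) (homog (q t)) y \<longleftrightarrow> dependency V (Suc d) (homog p) y" for y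
      by (rule dependency_homog_congruent) (rule cong)
    have "strain_rigid V E (Suc d) (homog (q t))"
      using rigid strain_rigid_cong_dependency[OF dep] by blast
    moreover have "rows_independent {..<Suc d} J (homog (q t))"
      using indep unfolding rows_independent_iff_dependency[OF finV J(1)] dep .
    ultimately obtain \<epsilon> where \<epsilon>: "\<epsilon> > 0" and near: "\<And>b. (\<forall>v\<in>V. \<forall>\<alpha><Suc d. \<bar>b v \<alpha> - homog (q t) v \<alpha>\<bar> < \<epsilon>)
        \<Longrightarrow> strain_rigid V E (Suc d) b"
      using strain_rigid_open[OF finV J] by blast
    have "\<forall>\<^sub>F t' in at t within ?I. \<forall>v\<in>V. \<forall>i\<in>{..<d}. \<bar>q t' v i - q t v i\<bar> < \<epsilon>"
    proof (intro eventually_ball_finite ballI)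
      fix v i assume "v \<in> V" "i \<in> {..<d}"
      then have "((\<lambda>t'. q t' v i) \<longlongrightarrow> q t v i) (at t within ?I)"
        using cont tI by (auto simp: continuous_on_def)
      from tendstoD[OF this \<epsilon>] show "\<forall>\<^sub>F t' in at t within ?I. \<bar>q t' v i - q t v i\<bar> < \<epsilon>"
        by (simp add: dist_real_def)
    qed (use finV in auto)
    then obtain e where e: "e > 0" and close: "\<And>t' v i. t' \<in> ?I \<Longrightarrow> t' \<noteq> t \<Longrightarrow> dist t' t < e \<Longrightarrow>
        v \<in> V \<Longrightarrow> i < d \<Longrightarrow> \<bar>q t' v i - q t v i\<bar> < \<epsilon>"
      unfolding eventually_at by auto
    show "\<exists>e>0. \<forall>t'\<in>?I. dist t' t < e \<longrightarrow> t' \<in> T"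
    proof (intro exI[of _ e] conjI e ballI impI)
      fix t' assume t': "t' \<in> ?I" "dist t' t < e"
      show "t' \<in> T"
      proof (cases "t' = t")
        case False
        let ?s = "\<lambda>v i. (q t v i + q t' v i) / 2"
        have "\<bar>homog ?s v \<alpha> - homog (q t) v \<alpha>\<bar> < \<epsilon>" if "v \<in> V" "\<alpha> < Suc d" for v \<alpha>
        proof (cases \<alpha>)
          case (Suc i)
          have "?s v i - q t v i = (q t' v i - q t v i) / 2" by (simp add: field_simps)
          then show ?thesis using close[OF t'(1) False t'(2) that(1), of i] that(2) Suc \<epsilon> by simp
        qed (use \<epsilon> in simp)
        then have "strain_rigid V E (Suc d) (homog ?s)" by (intro near) auto
        moreover have "strain_form V E (Suc d) (homog ?s)
            (\<lambda>u v. sqdist d (q t' u) (q t' v) - sqdist d (q t u) (q t v))"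
          using edges[OF t'(1)] edges[OF tI] by (intro strain_form_midpoint) auto
        ultimately have "\<forall>u\<in>V. \<forall>v\<in>V. sqdist d (q t' u) (q t' v) - sqdist d (q t u) (q t v) = 0"
          unfolding strain_rigid_def by blast
        then have "h t' = 0" using cong by (simp add: h0)
        then show ?thesis using t' by (simp add: T_def)
      qed (use t in simp)
    qed
  qed
  moreover have "connected ?I" by simp
  moreover have "0 \<in> T"
    using q by (auto simp: T_def h0 framework_motion_def sqdist_def intro!: sum.cong)
  ultimately have "T = ?I" unfolding connected_clopen by blast
  then show "\<forall>t\<in>?I. \<forall>u\<in>V. \<forall>v\<in>V. euclid_dist d (q t u) (q t v) = euclid_dist d (p u) (p v)"
    unfolding euclid_dist_eq_iff using h0 by (auto simp: T_def)
qed

lemma strain_rigid_cong: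
  assumes "\<And>v \<alpha>. v \<in> V \<Longrightarrow> \<alpha> < k \<Longrightarrow> a v \<alpha> = b v \<alpha>"
  shows "strain_rigid V E k a \<longleftrightarrow> strain_rigid V E k b"
proof (rule strain_rigid_cong_dependency)
  fix y
  have "(\<Sum>v\<in>V. y v * a v \<alpha>) = (\<Sum>v\<in>V. y v * b v \<alpha>)" if "\<alpha> < k" for \<alpha>
    using assms that by (intro sum.cong) auto
  then show "dependency V k a y \<longleftrightarrow> dependency V k b y" by (simp add: dependency_def)
qed

text \<open>\<open>p0\<close> may be far from generic, with many coinciding points. Strain rigidity
  and independence of \<open>J\<close> are open, so both hold at some generic placement close to
  it.\<close>

lemma rigid_graph_if_strain_rigid:
  assumes finV: "finite V" and J: "J \<subseteq> V" "card J = Suc d"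
    and indep: "rows_independent {..<Suc d} J (homog p0)"
    and rigid: "strain_rigid V E (Suc d) (homog p0)"
  shows "rigid_graph d V E"
proof -
  obtain \<epsilon>1 where \<epsilon>1: "\<epsilon>1 > 0" "\<And>b. (\<forall>v\<in>V. \<forall>\<alpha><Suc d. \<bar>b v \<alpha> - homog p0 v \<alpha>\<bar> < \<epsilon>1) \<Longrightarrow> strain_rigid V E (Suc d) b"
    using strain_rigid_open[OF finV J indep rigid] by blast
  have "finite J" using J finV finite_subset by blast
  obtain \<epsilon>2 where \<epsilon>2: "\<epsilon>2 > 0" "\<And>b. (\<forall>v\<in>J. \<forall>\<alpha><Suc d. \<bar>b v \<alpha> - homog p0 v \<alpha>\<bar> < \<epsilon>2) \<Longrightarrow> rows_independent {..<Suc d} J b"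
    using rows_independent_open[OF \<open>finite J\<close> indep] by blast
  obtain a where a: "alg_indep (V \<times> {..<d}) a" "\<forall>x\<in>V \<times> {..<d}. \<bar>a x - (\<lambda>(v, i). p0 v i) x\<bar> < min \<epsilon>1 \<epsilon>2"
    using alg_indep_dense[of "V \<times> {..<d}" "min \<epsilon>1 \<epsilon>2" "\<lambda>(v, i). p0 v i"] finV \<epsilon>1(1) \<epsilon>2(1) by auto
  define p where "p v i = a (v, i)" for v i
  have close: "\<bar>homog p v \<alpha> - homog p0 v \<alpha>\<bar> < min \<epsilon>1 \<epsilon>2" if "v \<in> V" "\<alpha> < Suc d" for v \<alpha>
    using a(2) that \<epsilon>1(1) \<epsilon>2(1) by (cases \<alpha>) (auto simp: p_def)
  have "strain_rigid V E (Suc d) (homog p)" by (rule \<epsilon>1(2)) (use close in auto)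
  moreover have "rows_independent {..<Suc d} J (homog p)" by (rule \<epsilon>2(2)) (use close J in auto)
  ultimately have "rigid_framework d V E p" using finV J by (intro rigid_framework_if_strain_rigid) auto
  moreover have "(\<lambda>(v, i). p v i) = a" by (auto simp: p_def)
  then have "generic_placement d V p"
    unfolding generic_placement_def
    using alg_independent_over_rat_if_alg_indep[OF a(1)] finV by simp
  ultimately show ?thesis unfolding rigid_graph_def by blast
qed

section \<open>Assembling the proof from the given partition\<close>

lemma joined_if_reduced_edge:
  assumes "{i, j} \<in> reduced_edges E \<kappa> m Vs"
  shows "joined E \<kappa> (Vs i) (Vs j)"
proof -
  obtain i' j' where ij: "{i, j} = {i', j'}" and ne: "\<And>X Y. X \<subseteq> Vs i' \<Longrightarrow> Y \<subseteq> Vs j' \<Longrightarrow> card X = \<kappa> \<Longrightarrow>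
      card Y = \<kappa> \<Longrightarrow> edges_between E X Y \<noteq> {}"
    using assms unfolding reduced_edges_def by blast
  have e: "\<exists>x\<in>X. \<exists>y\<in>Y. {x, y} \<in> E" if "edges_between E X Y \<noteq> {}" for X Y
    using that unfolding edges_between_def by auto
  have "i = i' \<and> j = j' \<or> i = j' \<and> j = i'" using ij by (auto simp: doubleton_eq_iff)
  then show ?thesis
  proof
    assume "i = i' \<and> j = j'"
    then show ?thesis unfolding joined_def using ne e by blast
  next
    assume [simp]: "i = j' \<and> j = i'"
    show ?thesis
      unfolding joined_def
    proof (intro allI impI)
      fix A B assume "A \<subseteq> Vs i" "B \<subseteq> Vs j" "card A = \<kappa>" "card B = \<kappa>"
      then have "\<exists>x\<in>B. \<exists>y\<in>A. {x, y} \<in> E" using ne e by simp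
      then show "\<exists>x\<in>A. \<exists>y\<in>B. {x, y} \<in> E" by (metis insert_commute)
    qed
  qed
qed

lemma reduced_edges_vertex_degree:
  assumes "i \<in> {1..m}"
  shows "vertex_degree (reduced_edges E \<kappa> m Vs) i = card {j \<in> {1..m}. j \<noteq> i \<and> {i, j} \<in> reduced_edges E \<kappa> m Vs}"
    (is "_ = card ?N")
proof -
  have "{e \<in> reduced_edges E \<kappa> m Vs. i \<in> e} = (\<lambda>j. {i, j}) ` ?N"
  proof (intro equalityI subsetI)
    fix e assume e: "e \<in> {e \<in> reduced_edges E \<kappa> m Vs. i \<in> e}"
    then obtain i' j' where "e = {i', j'}" "i' \<in> {1..m}" "j' \<in> {1..m}" "i' \<noteq> j'"
      unfolding reduced_edges_def by blast
    with e show "e \<in> (\<lambda>j. {i, j}) ` ?N" by (auto simp: insert_commute)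
  qed auto
  moreover have "inj_on (\<lambda>j. {i, j}) ?N" by (auto simp: inj_on_def doubleton_eq_iff)
  ultimately show ?thesis by (simp add: vertex_degree_def card_image)
qed

theorem theorem1p5:
  fixes V :: "'v set" and E :: "'v set set" and k m :: nat and \<eta> :: real
    and Vs :: "nat \<Rightarrow> 'v set"
  assumes "simple_graph V E"
    and "k \<ge> 1" and "m \<ge> 1"
    and "1 / 2 < \<eta>" and "\<eta> \<le> 1"
    and "(\<Union>i\<in>{1..m}. Vs i) = V" and "disjoint_family_on Vs {1..m}"
    and "\<forall>i\<in>{1..m}. Vs i \<noteq> {}"
    and "\<forall>i\<in>{1..m}. int (card (Vs i)) > 7 * int k - 3"
    and "real (min_degree {1..m} (reduced_edges E k m Vs)) \<ge> \<eta> * real m - 1"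
  shows "\<exists>W. W \<subseteq> V \<and>
           rigid_graph (nat \<lfloor>(\<eta> - 1 / 2) * real m\<rfloor>) W (induced_edges E W) \<and>
           (\<forall>i\<in>{1..m}. card (Vs i - W) \<le> 4 * k)"
proof -
  define d where "d = nat \<lfloor>(\<eta> - 1 / 2) * real m\<rfloor>"
  define M where "M = {1..m}"
  define E0 where "E0 = reduced_edges E k m Vs"
  define \<delta> where "\<delta> = min_degree M E0"
  define nbrs where "nbrs i = {j \<in> M. j \<noteq> i \<and> {i, j} \<in> E0}" for i
  have M: "finite M" "M \<noteq> {}" "card M = m" using \<open>m \<ge> 1\<close> by (auto simp: M_def)
  have "finite V" using \<open>simple_graph V E\<close> by (simp add: simple_graph_def)
  have VsV: "Vs i \<subseteq> V" if "i \<in> M" for i using that assms(6) by (auto simp: M_def)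
  then have finVs: "finite (Vs i)" if "i \<in> M" for i
    using that \<open>finite V\<close> finite_subset by blast
  have d_le: "real d \<le> (\<eta> - 1 / 2) * real m"
    using assms(4) unfolding d_def by (intro of_nat_floor) auto
  have deg: "\<delta> \<le> card (nbrs i)" if "i \<in> M" for i
  proof -
    have "\<delta> \<le> vertex_degree E0 i"
      unfolding \<delta>_def min_degree_def using that M by (intro Min_le) auto
    then show ?thesis
      using reduced_edges_vertex_degree[of i m E k Vs] that by (simp add: nbrs_def E0_def M_def)
  qed
  have "real m + 2 * real d \<le> 2 * real \<delta> + 2"
    using assms(10) d_le by (simp add: \<delta>_def M_def E0_def algebra_simps)
  \<comment> \<open>This is \<open>2 * \<eta> * m \<le> 2 * \<delta> + 2\<close> combined with
    \<open>2 * d \<le> (2 * \<eta> - 1) * m\<close>.\<close>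
  then have \<delta>: "m + 2 * d \<le> 2 * \<delta> + 2" by linarith
  have nbrs_sub: "nbrs i \<subseteq> M - {i}" for i by (auto simp: nbrs_def)
  have \<delta>m: "\<delta> + 1 \<le> m"
  proof -
    obtain i where i: "i \<in> M" using M by blast
    have "card (nbrs i) \<le> card (M - {i})" using nbrs_sub M by (intro card_mono) auto
    then show ?thesis using deg[OF i] i M \<open>m \<ge> 1\<close> by simp
  qed
  \<comment> \<open>There are enough clusters for \<open>d + 1\<close> affinely independent
    points.\<close>
  have dm: "Suc d \<le> m"
    using \<delta> \<delta>m by linarith
  have size: "7 * k \<le> card (Vs i) + 2" if "i \<in> M" for i
  proof -
    have "7 * int k - 3 < int (card (Vs i))" using assms(9) that unfolding M_def by blast
    then show ?thesis by linarith
  qed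
  interpret cluster_graph E k d M Vs nbrs
  proof
    show "joined E k (Vs i) (Vs j)" if "j \<in> nbrs i" for i j
      using that joined_if_reduced_edge by (auto simp: nbrs_def E0_def)
    show "card M + 2 * d \<le> 2 * card (nbrs i) + 2" if "i \<in> M" for i
      using deg[OF that] \<delta> M by linarith
  qed (use M finVs nbrs_sub size assms in \<open>auto simp: M_def\<close>)
  obtain W where W: "W \<subseteq> (\<Union>i\<in>M. Vs i)" and few: "\<And>i. i \<in> M \<Longrightarrow> card (Vs i - W) \<le> 4 * (k - 1)"
    and good: "\<And>i u. i \<in> M \<Longrightarrow> u \<in> Vs i \<inter> W \<Longrightarrow> 2 * card {j \<in> nbrs i. u \<notin> G W i j} + d \<le> card (nbrs i)"
    by (rule peeling) (rule that)
  define Us where "Us i = Vs i \<inter> W" for i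
  have W_eq: "W = (\<Union>i\<in>M. Us i)" using W by (auto simp: Us_def)
  have finU: "finite (Us i)" if "i \<in> M" for i using finVs that by (simp add: Us_def)
  have sizeU: "3 * k + 2 \<le> card (Us i)" if "i \<in> M" for i
  proof -
    have "card (Vs i) = card (Us i) + card (Vs i - W)"
      unfolding Us_def using finVs that by (metis card_Int_Diff)
    then show ?thesis using few[OF that] size[OF that] \<open>k \<ge> 1\<close> by linarith
  qed
  define cls where "cls u = (THE i. i \<in> M \<and> u \<in> Vs i)" for u
  have cls: "cls u = i" if "i \<in> M" "u \<in> Us i" for i u
    unfolding cls_def
  proof (rule the_equality)
    show "i \<in> M \<and> u \<in> Vs i" using that by (simp add: Us_def)
    show "j = i" if "j \<in> M \<and> u \<in> Vs j" for j
      using that \<open>i \<in> M\<close> \<open>u \<in> Us i\<close> disj unfolding Us_def disjoint_family_on_def by blast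
  qed
  have clsM: "cls u \<in> M" if "u \<in> W" for u using that cls unfolding W_eq by blast
  \<comment> \<open>Target 1 with tolerance 1 keeps every coordinate positive, so the first ones can
    be divided out.\<close>
  obtain A' where A': "alg_indep (M \<times> {..<Suc d}) A'" "\<forall>x\<in>M \<times> {..<Suc d}. \<bar>A' x - 1\<bar> < 1"
    using alg_indep_dense[of "M \<times> {..<Suc d}" 1 "\<lambda>_. 1"] M by auto
  define A where "A i \<alpha> = A' (i, \<alpha>)" for i \<alpha>
  have gen: "alg_indep (M \<times> {..<Suc d}) (\<lambda>(i, \<alpha>). A i \<alpha>)" using A'(1) by (simp add: A_def)
  have A0: "A i 0 \<noteq> 0" if "i \<in> M" for i using A'(2) that by (force simp: A_def)
  define a where "a i \<alpha> = A i \<alpha> / A i 0" for i \<alpha>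
  have "strain_rigid M E0 (Suc d) A"
  proof (rule generic_strain_rigid[OF gen M(1)])
    show "card {u \<in> M. u \<noteq> i \<and> {u, i} \<notin> E0} \<le> m - 1 - \<delta>" if i: "i \<in> M" for i
    proof -
      have "{u \<in> M. u \<noteq> i \<and> {u, i} \<notin> E0} = (M - {i}) - nbrs i" by (auto simp: nbrs_def insert_commute)
      then have "card {u \<in> M. u \<noteq> i \<and> {u, i} \<notin> E0} = card (M - {i}) - card (nbrs i)"
        using card_Diff_subset[OF _ nbrs_sub[of i]] nbrs_sub[of i] M by (simp add: finite_subset)
      then show ?thesis using deg[OF i] i M by simp
    qed
    show "2 * (m - 1 - \<delta>) + 2 * Suc d \<le> card M + 2" using \<delta> \<delta>m M by simp
  qed simp
  then have rigid_a: "strain_rigid M E0 (Suc d) a"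
    unfolding a_def[abs_def] using A0 by (intro strain_rigid_rescale)
  have inj: "\<forall>\<alpha><Suc d. x \<alpha> = 0"
    if J: "J \<subseteq> M" "card J = Suc d" and x: "\<And>j. j \<in> J \<Longrightarrow> (\<Sum>\<alpha><Suc d. a j \<alpha> * x \<alpha>) = 0" for J x
  proof (rule generic_rows_injective[OF gen M(1) J])
    fix j assume j: "j \<in> J"
    then have "A j 0 \<noteq> 0" using A0 J by blast
    then have "(\<Sum>\<alpha><Suc d. A j \<alpha> * x \<alpha>) = A j 0 * (\<Sum>\<alpha><Suc d. a j \<alpha> * x \<alpha>)"
      unfolding sum_distrib_left a_def by (intro sum.cong) auto
    then show "(\<Sum>\<alpha><Suc d. A j \<alpha> * x \<alpha>) = 0" using x[OF j] by simp
  qed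
  have "strain_rigid W E (Suc d) (\<lambda>u. a (cls u))"
    unfolding W_eq
  proof (rule strain_rigid_blowup[where nbrs = nbrs and \<kappa> = k and ?E0.0 = E0 and a = a and cls = cls])
    show "3 * k \<le> card (Us i) + 2" "k \<le> card (Us i)" if "i \<in> M" for i
      using sizeU[OF that] by auto
    show "joined E k (Us i) (Us j)" if "i \<in> M" "j \<in> nbrs i" for i j
      using joined_subset[OF nbrs_joined[OF that]] by (simp add: Us_def)
    show "i = j \<or> j \<in> nbrs i" if "i \<in> M" "j \<in> M" "{i, j} \<in> E0" for i j
      using that by (auto simp: nbrs_def)
    show "\<forall>\<alpha><Suc d. x \<alpha> = 0" if "J \<subseteq> M" "card J = Suc d"
      "\<And>j. j \<in> J \<Longrightarrow> (\<Sum>\<alpha><Suc d. a j \<alpha> * x \<alpha>) = 0" for J x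
      by (rule inj[OF that])
    fix i u u' assume i: "i \<in> M" and u: "u \<in> Us i" and u': "u' \<in> Us i"
    let ?bad = "\<lambda>u. {j \<in> nbrs i. u \<notin> giant E k (Us i) (Us j)}"
    let ?good = "{j \<in> nbrs i. u \<in> giant E k (Us i) (Us j) \<and> u' \<in> giant E k (Us i) (Us j)}"
    have finN: "finite (nbrs i)" using nbrs_sub M finite_subset by blast
    have "2 * card (?bad u) + d \<le> card (nbrs i)" "2 * card (?bad u') + d \<le> card (nbrs i)"
      using good[OF i, of u] good[OF i, of u'] u u' by (auto simp: Us_def)
    \<comment> \<open>Each vertex misses at most half of \<open>card (nbrs i) - d\<close> giants, so
      at least \<open>d\<close> contain both.\<close>
    moreover have "card (nbrs i) \<le> card ?good + (card (?bad u) + card (?bad u'))"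
    proof -
      have "card (nbrs i) \<le> card (?good \<union> (?bad u \<union> ?bad u'))" using finN by (intro card_mono) auto
      also have "\<dots> \<le> card ?good + card (?bad u \<union> ?bad u')" by (rule card_Un_le)
      finally show ?thesis using card_Un_le[of "?bad u" "?bad u'"] by linarith
    qed
    ultimately show "Suc d \<le> card ?good + 1" by linarith
  qed (use M finU cls \<open>k \<ge> 1\<close> nbrs_sub rigid_a in simp_all)
  \<comment> \<open>All vertices of a cluster are placed at its point. Since \<open>a\<close> has
    first coordinate 1, it gives the homogeneous coordinates of this placement.\<close>
  moreover define p0 where "p0 u \<beta> = a (cls u) (Suc \<beta>)" for u \<beta>
  have p0: "homog p0 u \<alpha> = a (cls u) \<alpha>" if "u \<in> W" for u \<alpha>
    using A0[OF clsM[OF that]] by (cases \<alpha>) (auto simp: p0_def a_def)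
  ultimately have "strain_rigid W E (Suc d) (homog p0)"
    using strain_rigid_cong[of W "Suc d" "homog p0" "\<lambda>u. a (cls u)" E] by simp
  then have rigid: "strain_rigid W (induced_edges E W) (Suc d) (homog p0)"
    by (simp add: strain_rigid_def strain_form_def induced_edges_def)
  have WV: "W \<subseteq> V" using W VsV by blast
  then have finW: "finite W" using \<open>finite V\<close> finite_subset by blast
  define rep where "rep i = (SOME x. x \<in> Us i)" for i
  have rep: "rep i \<in> Us i" if "i \<in> M" for i
  proof -
    have "Us i \<noteq> {}" using sizeU[OF that] by force
    then show ?thesis unfolding rep_def by (rule some_in_eq[THEN iffD2])
  qed
  have clsrep: "cls (rep i) = i" if "i \<in> M" for i using cls rep that by blast
  obtain L where L: "L \<subseteq> M" "card L = Suc d" using obtain_subset_with_card_n[of "Suc d" M] dm M by auto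
  have finL: "finite L" using L M finite_subset by blast
  have injrep: "inj_on rep L" using clsrep L by (metis inj_onI subsetD)
  have repW: "rep i \<in> W" if "i \<in> M" for i using rep that unfolding W_eq by blast
  have "rows_independent L {..<Suc d} (\<lambda>\<alpha> j. a j \<alpha>)"
    unfolding rows_independent_def
  proof (intro allI impI)
    fix c assume "\<forall>j\<in>L. (\<Sum>\<alpha><Suc d. c \<alpha> * a j \<alpha>) = 0"
    then have "\<forall>\<alpha><Suc d. c \<alpha> = 0" by (intro inj[OF L]) (simp add: mult.commute)
    then show "\<forall>\<alpha>\<in>{..<Suc d}. c \<alpha> = 0" by simp
  qed
  from rows_independent_transpose[OF finite_lessThan finL _ this]
  have "rows_independent {..<Suc d} L a" using L(2) by simp
  then have "rows_independent {..<Suc d} (rep ` L) (homog p0)"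
  proof -
    assume La: "rows_independent {..<Suc d} L a"
    show ?thesis
      unfolding rows_independent_def
    proof (intro allI impI)
      fix c assume c: "\<forall>\<alpha>\<in>{..<Suc d}. (\<Sum>v\<in>rep ` L. c v * homog p0 v \<alpha>) = 0"
      have "(\<Sum>v\<in>rep ` L. c v * homog p0 v \<alpha>) = (\<Sum>i\<in>L. c (rep i) * a i \<alpha>)" for \<alpha>
        unfolding sum.reindex[OF injrep] o_def
        using p0 repW clsrep L(1) by (intro sum.cong refl) (auto simp: subset_iff)
      then have "\<forall>i\<in>L. c (rep i) = 0"
        using c La[unfolded rows_independent_def, THEN spec[of _ "\<lambda>i. c (rep i)"]] by simp
      then show "\<forall>v\<in>rep ` L. c v = 0" by simp
    qed
  qed
  then have "rigid_graph d W (induced_edges E W)"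
    using finW rigid repW L injrep
    by (intro rigid_graph_if_strain_rigid[of W "rep ` L" d p0]) (auto simp: card_image)
  moreover have "card (Vs i - W) \<le> 4 * k" if "i \<in> M" for i using few[OF that] by linarith
  ultimately show ?thesis using WV unfolding d_def M_def by blast
qed

end
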